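(* Let $g\in L^\infty([0,1])$ (extended 1-periodically), let $g(x,y):=g(x)$, and let $u_0\in W^{2,\infty}([0,1])$ satisfy periodic boundary conditions. Then there exists $T>0$ depending only on $u_0$ and $\|g\|_\infty$ such that the equation $$u_t=\frac{u_{xx}}{1+u_x^2}+g(x)\sqrt{1+u_x^2}$$ admits a weak solution $u$ with $u(\cdot,0)=u_0$ and $u\in W^{1,\infty}([0,T];L^\infty([0,1]))\cap L^\infty([0,T];W^{2,\infty}([0,1]))$.
   Context: Periodic boundary conditions: $u(0)=u(1)$, $u_x(0)=u_x(1)$. A weak solution is a function $u\in H^1([0,T];L^2([0,1]))\cap L^\infty([0,T];H^1([0,1]))$, 1-periodic in $x$, such that $$\int_{[0,1]\times[0,T]}\Big(u_t\varphi+\arctan(u_x)\varphi_x-g(x)\sqrt{1+u_x^2}\,\varphi\Big)dx\,dt=0$$ for all test functions $\varphi\in C^1_c([0,1]\times(0,T))$ with periodic boundary conditions in $x$. *)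

theory Defs
  imports "HOL-Analysis.Analysis"
begin

definition Linf_on :: "'a::euclidean_space set \<Rightarrow> ('a \<Rightarrow> real) \<Rightarrow> bool" where
  "Linf_on A f \<longleftrightarrow> set_borel_measurable lebesgue A f \<and>
     (\<exists>C. AE z in lebesgue. z \<in> A \<longrightarrow> \<bar>f z\<bar> \<le> C)"

definition L2_on :: "'a::euclidean_space set \<Rightarrow> ('a \<Rightarrow> real) \<Rightarrow> bool" where
  "L2_on A f \<longleftrightarrow> set_borel_measurable lebesgue A f \<and>
     set_integrable lebesgue A (\<lambda>z. (f z)^2)"

definition linf_norm :: "'a::euclidean_space set \<Rightarrow> ('a \<Rightarrow> real) \<Rightarrow> real" where
  "linf_norm A f = Inf {C. AE z in lebesgue. z \<in> A \<longrightarrow> \<bar>f z\<bar> \<le> C}"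

definition loc_int_on :: "'a::euclidean_space set \<Rightarrow> ('a \<Rightarrow> real) \<Rightarrow> bool" where
  "loc_int_on U f \<longleftrightarrow> (\<forall>K. compact K \<and> K \<subseteq> U \<longrightarrow> set_integrable lebesgue K f)"

definition test1 :: "real set \<Rightarrow> (real \<Rightarrow> real) \<Rightarrow> (real \<Rightarrow> real) \<Rightarrow> bool" where
  "test1 U \<phi> \<phi>' \<longleftrightarrow> (\<forall>x. (\<phi> has_real_derivative \<phi>' x) (at x)) \<and> continuous_on UNIV \<phi>' \<and>
     (\<exists>K. compact K \<and> K \<subseteq> U \<and> (\<forall>x. x \<notin> K \<longrightarrow> \<phi> x = 0))"

definition weak_deriv1 :: "real set \<Rightarrow> (real \<Rightarrow> real) \<Rightarrow> (real \<Rightarrow> real) \<Rightarrow> bool" where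
  "weak_deriv1 U f f' \<longleftrightarrow> loc_int_on U f \<and> loc_int_on U f' \<and>
     (\<forall>\<phi> \<phi>'. test1 U \<phi> \<phi>' \<longrightarrow>
        (LINT x:U|lebesgue. f x * \<phi>' x) = - (LINT x:U|lebesgue. f' x * \<phi> x))"

definition W2inf :: "real set \<Rightarrow> (real \<Rightarrow> real) \<Rightarrow> bool" where
  "W2inf U f \<longleftrightarrow> (\<exists>f' f''. Linf_on U f \<and> Linf_on U f' \<and> Linf_on U f'' \<and>
      weak_deriv1 U f f' \<and> weak_deriv1 U f' f'')"

definition test2 :: "(real \<times> real) set \<Rightarrow> (real \<times> real \<Rightarrow> real) \<Rightarrow> (real \<times> real \<Rightarrow> real)
    \<Rightarrow> (real \<times> real \<Rightarrow> real) \<Rightarrow> bool" where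
  "test2 U \<phi> \<phi>x \<phi>t \<longleftrightarrow>
     (\<forall>z. (\<phi> has_derivative (\<lambda>h. fst h * \<phi>x z + snd h * \<phi>t z)) (at z)) \<and>
     continuous_on UNIV \<phi>x \<and> continuous_on UNIV \<phi>t \<and>
     (\<exists>K. compact K \<and> K \<subseteq> U \<and> (\<forall>z. z \<notin> K \<longrightarrow> \<phi> z = 0))"

definition weak_dx :: "(real \<times> real) set \<Rightarrow> (real \<times> real \<Rightarrow> real) \<Rightarrow> (real \<times> real \<Rightarrow> real) \<Rightarrow> bool" where
  "weak_dx U f fx \<longleftrightarrow> loc_int_on U f \<and> loc_int_on U fx \<and>
     (\<forall>\<phi> \<phi>x \<phi>t. test2 U \<phi> \<phi>x \<phi>t \<longrightarrow>
        (LINT z:U|lebesgue. f z * \<phi>x z) = - (LINT z:U|lebesgue. fx z * \<phi> z))"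

definition weak_dt :: "(real \<times> real) set \<Rightarrow> (real \<times> real \<Rightarrow> real) \<Rightarrow> (real \<times> real \<Rightarrow> real) \<Rightarrow> bool" where
  "weak_dt U f ft \<longleftrightarrow> loc_int_on U f \<and> loc_int_on U ft \<and>
     (\<forall>\<phi> \<phi>x \<phi>t. test2 U \<phi> \<phi>x \<phi>t \<longrightarrow>
        (LINT z:U|lebesgue. f z * \<phi>t z) = - (LINT z:U|lebesgue. ft z * \<phi> z))"

definition strip :: "real \<Rightarrow> (real \<times> real) set" where
  "strip T = UNIV \<times> {0<..<T}"

definition cyl :: "real \<Rightarrow> (real \<times> real) set" where
  "cyl T = {0..1} \<times> {0..T}"

definition per_test :: "real \<Rightarrow> (real \<times> real \<Rightarrow> real) \<Rightarrow> (real \<times> real \<Rightarrow> real)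
    \<Rightarrow> (real \<times> real \<Rightarrow> real) \<Rightarrow> bool" where
  "per_test T \<phi> \<phi>x \<phi>t \<longleftrightarrow>
     (\<forall>z. (\<phi> has_derivative (\<lambda>h. fst h * \<phi>x z + snd h * \<phi>t z)) (at z)) \<and>
     continuous_on UNIV \<phi>x \<and> continuous_on UNIV \<phi>t \<and>
     (\<forall>x t. \<phi> (x + 1, t) = \<phi> (x, t)) \<and>
     (\<exists>a b. 0 < a \<and> a \<le> b \<and> b < T \<and> (\<forall>x t. t \<notin> {a..b} \<longrightarrow> \<phi> (x, t) = 0))"

text \<open>Weak solution on [0,T] of u_t = u_xx/(1+u_x^2) + g(x) sqrt(1+u_x^2), periodic in x:
  u in H^1(0,T;L^2(0,1)) cap L^infinity(0,T;H^1(0,1)), written in space-time form.\<close>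
definition weak_solution :: "(real \<Rightarrow> real) \<Rightarrow> real \<Rightarrow> (real \<Rightarrow> real \<Rightarrow> real) \<Rightarrow> bool" where
  "weak_solution g T u \<longleftrightarrow>
     (\<forall>x t. u (x + 1) t = u x t) \<and>
     (\<exists>ut ux.
        weak_dt (strip T) (\<lambda>(x, t). u x t) ut \<and> weak_dx (strip T) (\<lambda>(x, t). u x t) ux \<and>
        L2_on (cyl T) (\<lambda>(x, t). u x t) \<and> L2_on (cyl T) ut \<and> L2_on (cyl T) ux \<and>
        (\<exists>C. AE t in lebesgue. t \<in> {0..T} \<longrightarrow>
            set_integrable lebesgue {0..1} (\<lambda>x. (u x t)^2 + (ux (x, t))^2) \<and>
            (LINT x:{0..1}|lebesgue. (u x t)^2 + (ux (x, t))^2) \<le> C) \<and>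
        (\<forall>\<phi> \<phi>x \<phi>t. per_test T \<phi> \<phi>x \<phi>t \<longrightarrow>
           set_integrable lebesgue (cyl T)
             (\<lambda>z. ut z * \<phi> z + arctan (ux z) * \<phi>x z - g (fst z) * sqrt (1 + (ux z)^2) * \<phi> z) \<and>
           (LINT z:cyl T|lebesgue.
              ut z * \<phi> z + arctan (ux z) * \<phi>x z - g (fst z) * sqrt (1 + (ux z)^2) * \<phi> z) = 0))"

definition initial_value :: "(real \<Rightarrow> real \<Rightarrow> real) \<Rightarrow> (real \<Rightarrow> real) \<Rightarrow> bool" where
  "initial_value u u0 \<longleftrightarrow>
     (\<forall>\<^sub>F t in at_right 0. set_integrable lebesgue {0..1} (\<lambda>x. (u x t - u0 x)^2)) \<and>
     ((\<lambda>t. LINT x:{0..1}|lebesgue. (u x t - u0 x)^2) \<longlongrightarrow> 0) (at_right 0)"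

text \<open>u in W^{1,infinity}(0,T;L^infinity(0,1)) cap L^infinity(0,T;W^{2,infinity}(0,1)),
  in space-time form: u, u_t, u_x, u_xx essentially bounded on [0,1] x [0,T].\<close>
definition W1inf_W2inf :: "real \<Rightarrow> (real \<Rightarrow> real \<Rightarrow> real) \<Rightarrow> bool" where
  "W1inf_W2inf T u \<longleftrightarrow>
     (\<exists>ut ux uxx.
        weak_dt (strip T) (\<lambda>(x, t). u x t) ut \<and> weak_dx (strip T) (\<lambda>(x, t). u x t) ux \<and>
        weak_dx (strip T) ux uxx \<and>
        Linf_on (cyl T) (\<lambda>(x, t). u x t) \<and> Linf_on (cyl T) ut \<and>
        Linf_on (cyl T) ux \<and> Linf_on (cyl T) uxx)"

end

theory Submission
  imports Defs "HOL-Complex_Analysis.Great_Picard"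
begin

text \<open>
  Truncate the nonlinearities at slope \<open>R = \<parallel>u\<^sub>0'\<parallel> + 1\<close>: replace \<open>arctan\<close> by a function \<open>A\<close> whose
  difference quotients lie in \<open>[1 / (1 + R\<^sup>2), 1]\<close> and \<open>sqrt (1 + p\<^sup>2)\<close> by a bounded 1-Lipschitz function
  \<open>G\<close>. The truncated equation is discretised by an explicit finite difference scheme with
  \<open>\<tau> = h\<^sup>2 / 4\<close>. The time differences of a discrete solution satisfy a scheme with nonnegative
  weights of sum 1, so they stay bounded by their initial size; by the equation and the lower bound on
  the difference quotients of \<open>A\<close>, the second space differences are bounded as well. A diagonal argument
  yields a limit that is Lipschitz in time and \<open>C\<^bsup>1,1\<^esup>\<close> in space, and summation by parts passes to the limit
  in the weak formulation. Since \<open>u\<close> stays within \<open>C t\<close> of \<open>u\<^sub>0\<close> while \<open>u\<^sub>x\<^sub>x\<close> is bounded, interpolation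
  keeps \<open>u\<^sub>x\<close> within distance 1 of \<open>u\<^sub>0'\<close> for short time, where the truncation is not active.
\<close>

section \<open>Directional derivatives of Lipschitz functions\<close>

text \<open>The obstacle is that \<open>g\<close> is merely bounded: differentiating the equation in
  x would produce a derivative of \<open>g\<close>. As \<open>g\<close> does not depend on t, a time
  difference leaves it untouched, and u_t obeys a linear equation without zeroth-order term. This is
  why u_xx is bounded through u_t and the equation, and never by differentiating in x. The bounds
  for u_t and u_xx involve \<open>g\<close> only through its norm, so they, and with them T, are
  known before \<open>g\<close> is chosen. They hold for all times, but the resulting slope bound
  may exceed the truncation level; only comparison with the datum brings the slope below R. The
  limit is a Lipschitz function, so its weak derivatives have to be constructed as almost-everywhere
  limits of difference quotients along one coordinate. The slopes converge pointwise, not just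
  weakly, and this lets the nonlinearities pass to the limit.\<close>

lemma negligible_AE_lborel: "negligible N \<Longrightarrow> AE x in lborel. x \<notin> N"
  using AE_not_in[of N lebesgue] by (simp add: negligible_iff_null_sets AE_completion_iff)

text \<open>On half-open intervals both sides give (F1 b - F1 a) + (F2 b - F2 a) = b - a, and these
  intervals form a generating pi-system. The purpose is domination:
  \<open>interval_measure F1\<close> lies below Lebesgue measure and therefore has a
  density.\<close>

lemma interval_measures_add_lborel:
  fixes F1 F2 :: "real \<Rightarrow> real"
  assumes mono1: "\<And>x y. x \<le> y \<Longrightarrow> F1 x \<le> F1 y" and mono2: "\<And>x y. x \<le> y \<Longrightarrow> F2 x \<le> F2 y"
    and cont1: "continuous_on UNIV F1" and cont2: "continuous_on UNIV F2"
    and sum: "\<And>t. F1 t + F2 t = t" and A: "A \<in> sets borel"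
  shows "emeasure (interval_measure F1) A + emeasure (interval_measure F2) A = emeasure lborel A"
proof -
  have rc: "continuous (at_right a) F1" "continuous (at_right a) F2" for a
    using cont1 cont2 by (auto simp: continuous_on_eq_continuous_within intro: continuous_within_subset)
  define \<nu> where "\<nu> = measure_of UNIV (sets borel)
    (\<lambda>A. emeasure (interval_measure F1) A + emeasure (interval_measure F2) A)"
  have sets_nu: "sets \<nu> = sets borel"
    using sets.sets_measure_of_eq[of borel] by (simp add: \<nu>_def)
  have "positive (sets borel) (\<lambda>A. emeasure (interval_measure F1) A + emeasure (interval_measure F2) A)"
    by (simp add: positive_def)
  moreover have "countably_additive (sets borel)
     (\<lambda>A. emeasure (interval_measure F1) A + emeasure (interval_measure F2) A)"
    unfolding countably_additive_def
    by (intro allI impI) (simp add: suminf_add[symmetric] suminf_emeasure subset_eq)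
  ultimately have em: "emeasure \<nu> B = emeasure (interval_measure F1) B + emeasure (interval_measure F2) B"
    if "B \<in> sets borel" for B
    unfolding \<nu>_def using that sets.sigma_algebra_axioms[of borel]
    by (intro emeasure_measure_of_sigma) auto
  have "\<nu> = interval_measure (\<lambda>x. x)"
  proof (rule measure_eqI_generator_eq[where E="range (\<lambda>(a, b). {a <.. b::real})" and \<Omega>=UNIV
        and A="\<lambda>i::nat. {- real i <.. real i}"])
    show "Int_stable (range (\<lambda>(a, b). {a <.. b::real}))"
      by (auto simp: Int_stable_def)
    fix X assume "X \<in> range (\<lambda>(a, b). {a <.. b::real})"
    then obtain a b where X: "X = {a<..b}" by auto
    show "emeasure \<nu> X = emeasure (interval_measure (\<lambda>x. x)) X"
    proof (cases "a \<le> b")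
      case True
      have "ennreal (F1 b - F1 a) + ennreal (F2 b - F2 a) = ennreal (b - a)"
        using mono1[OF True] mono2[OF True] sum[of a] sum[of b]
        by (simp add: ennreal_plus[symmetric] del: ennreal_plus)
      with True show ?thesis
        by (simp add: X em emeasure_interval_measure_Ioc mono1 mono2 rc)
    next
      case False
      then show ?thesis by (simp add: X em)
    qed
  next
    show "sets \<nu> = sigma_sets UNIV (range (\<lambda>(a, b). {a <.. b::real}))"
      "sets (interval_measure (\<lambda>x. x)) = sigma_sets UNIV (range (\<lambda>(a, b). {a <.. b::real}))"
      by (simp_all add: sets_nu borel_sigma_sets_Ioc)
    show "(\<Union>i. {- real i <.. real i}) = UNIV"
    proof (intro set_eqI iffI UNIV_I)
      fix x :: real
      obtain n where "\<bar>x\<bar> < real n" using reals_Archimedean2 by blast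
      then show "x \<in> (\<Union>i. {- real i <.. real i})" by (intro UN_I[of n]) auto
    qed
    show "emeasure \<nu> {- real i <.. real i} \<noteq> \<infinity>" for i
      by (simp add: em emeasure_interval_measure_Ioc mono1 mono2 rc)
  qed auto
  also have "\<dots> = lborel"
    by (simp add: lborel_eq_real)
  finally show ?thesis using em[OF A] by simp
qed

text \<open>The Stieltjes measure of \<open>f + C t\<close> is dominated by Lebesgue measure, so Lebesgue's differentiation
  theorem applies to its Radon--Nikodym density.\<close>
lemma lipschitz_right_quotients_AE:
  fixes f :: "real \<Rightarrow> real"
  assumes lip: "\<And>x y. \<bar>f x - f y\<bar> \<le> C * \<bar>x - y\<bar>"
  shows "AE t in lborel. convergent (\<lambda>n. (f (t + 1 / real (Suc n)) - f t) * real (Suc n))"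
proof -
  \<comment> \<open>Adding 1 makes \<open>D\<close> positive, so that one may divide by it; f / D is
    then 1-Lipschitz.\<close>
  define D where "D = \<bar>C\<bar> + 1"
  have D: "D > 0" by (simp add: D_def)
  have lipD: "\<bar>f x - f y\<bar> \<le> D * \<bar>x - y\<bar>" for x y
    using order_trans[OF lip[of x y] mult_right_mono[of C D "\<bar>x - y\<bar>"]] by (simp add: D_def)
  \<comment> \<open>The identity is split into two nondecreasing parts, which is exactly the
    1-Lipschitz property of f / D. The function is recovered as f t = D * (2 * F1 t - t).\<close>
  define F1 where "F1 t = (f t / D + t) / 2" for t
  define F2 where "F2 t = (t - f t / D) / 2" for t
  have lip1: "\<bar>f x / D - f y / D\<bar> \<le> \<bar>x - y\<bar>" for x y
    using lipD[of x y] D by (simp add: diff_divide_distrib[symmetric] abs_divide divide_le_eq mult.commute)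
  have mono1: "F1 x \<le> F1 y" and mono2: "F2 x \<le> F2 y" if "x \<le> y" for x y
  proof -
    have "f x / D + x \<le> f y / D + y" "x - f x / D \<le> y - f y / D"
      using lip1[of x y] that by linarith+
    then show "F1 x \<le> F1 y" "F2 x \<le> F2 y"
      unfolding F1_def F2_def by - (rule divide_right_mono; simp)+
  qed
  have contf: "continuous_on UNIV f"
    by (rule lipschitz_on_continuous_on[of D]) (use lipD D in \<open>auto simp: lipschitz_on_def dist_real_def\<close>)
  have cont1: "continuous_on UNIV F1" and cont2: "continuous_on UNIV F2"
    unfolding F1_def F2_def using D by (auto intro!: continuous_intros contf)
  have rc: "continuous (at_right a) F1" for a
    using cont1 by (auto simp: continuous_on_eq_continuous_within intro: continuous_within_subset)
  have sum: "F1 t + F2 t = t" for t by (simp add: F1_def F2_def field_simps)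
  have add: "emeasure (interval_measure F1) A + emeasure (interval_measure F2) A = emeasure lborel A"
    if "A \<in> sets borel" for A
    by (rule interval_measures_add_lborel[OF mono1 mono2 cont1 cont2 sum that])
  have "absolutely_continuous lborel (interval_measure F1)"
    unfolding absolutely_continuous_def
  proof
    fix N :: "real set" assume N: "N \<in> null_sets lborel"
    then have "emeasure (interval_measure F1) N + emeasure (interval_measure F2) N = 0"
      using add[of N] by (simp add: null_sets_def)
    with N show "N \<in> null_sets (interval_measure F1)"
      by (auto simp: null_sets_def)
  qed
  then obtain k where k: "k \<in> borel_measurable lborel" and dens: "density lborel k = interval_measure F1"
    using sigma_finite_measure.Radon_Nikodym[OF sigma_finite_lborel, of "interval_measure F1"] by auto
  have kI: "(\<integral>\<^sup>+ x. k x * indicator {a<..b} x \<partial>lborel) = ennreal (F1 b - F1 a)" if "a \<le> b" for a b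
  proof -
    have "(\<integral>\<^sup>+ x. k x * indicator {a<..b} x \<partial>lborel) = emeasure (density lborel k) {a<..b}"
      using k by (simp add: emeasure_density)
    also have "\<dots> = ennreal (F1 b - F1 a)"
      unfolding dens using that by (simp add: emeasure_interval_measure_Ioc mono1 rc)
    finally show ?thesis .
  qed
  have kI': "(\<integral>\<^sup>+ x. k x * indicator {a..b} x \<partial>lborel) = ennreal (F1 b - F1 a)" if "a \<le> b" for a b
  proof -
    have "(\<integral>\<^sup>+ x. k x * indicator {a..b} x \<partial>lborel) = (\<integral>\<^sup>+ x. k x * indicator {a<..b} x \<partial>lborel)"
      by (intro nn_integral_cong_AE eventually_mono[OF AE_lborel_singleton[of a]]) (auto split: split_indicator)
    then show ?thesis using kI[OF that] by simp
  qed
  \<comment> \<open>A density with finite integral over every bounded interval is finite almost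
    everywhere, so it may be replaced by the real function \<open>q\<close> below.\<close>
  have fin: "AE x in lborel. k x \<noteq> \<infinity>"
  proof -
    have "AE x in lborel. k x * indicator {- real i..real i} x \<noteq> \<infinity>" for i
      by (rule nn_integral_noteq_infinite) (use k kI'[of "- real i" "real i"] in auto)
    then have "AE x in lborel. \<forall>i. k x * indicator {- real i..real i} x \<noteq> \<infinity>"
      by (simp add: AE_all_countable)
    then show ?thesis
    proof eventually_elim
      case (elim x)
      obtain n where "\<bar>x\<bar> < real n" using reals_Archimedean2 by blast
      then have "x \<in> {- real n..real n}" by auto
      with elim[THEN spec, of n] show ?case by auto
    qed
  qed
  define q where "q x = enn2real (k x)" for x
  have q: "q \<in> borel_measurable borel" using k unfolding q_def by simp
  have hi: "(q has_integral (F1 b - F1 a)) {a..b}" if "a \<le> b" for a b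
  proof -
    have "((\<lambda>x. q x * indicator {a..b} x) has_integral (F1 b - F1 a)) UNIV"
    proof (rule nn_integral_has_integral)
      show "(\<lambda>x. q x * indicator {a..b} x) \<in> borel_measurable borel" using q by simp
      show "0 \<le> q x * indicator {a..b} x" for x by (simp add: q_def)
      show "0 \<le> F1 b - F1 a" using mono1[OF that] by simp
      have "(\<integral>\<^sup>+ x. ennreal (q x * indicator {a..b} x) \<partial>lborel) = (\<integral>\<^sup>+ x. k x * indicator {a..b} x \<partial>lborel)"
        by (intro nn_integral_cong_AE eventually_mono[OF fin])
          (auto simp: q_def top.not_eq_extremum split: split_indicator)
      then show "(\<integral>\<^sup>+ x. ennreal (q x * indicator {a..b} x) \<partial>lborel) = ennreal (F1 b - F1 a)"
        using kI'[OF that] by simp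
    qed
    then show ?thesis
      by (subst has_integral_restrict_UNIV[symmetric])
        (erule has_integral_eq[rotated], auto simp: indicator_def)
  qed
  have "q integrable_on cbox a b" for a b
  proof (cases "a \<le> b")
    case True then show ?thesis using hi[OF True] by auto
  qed auto
  then obtain N where N: "negligible N"
    and lim: "\<And>x e. \<lbrakk>x \<notin> N; 0 < e\<rbrakk> \<Longrightarrow>
               \<exists>d>0. \<forall>h. 0 < h \<and> h < d \<longrightarrow>
                         norm(integral (cbox x (x + h *\<^sub>R One)) q /\<^sub>R h ^ DIM(real) - q x) < e"
    using integrable_ccontinuous_explicit[of q] by blast
  have lim1: "(\<lambda>n. (F1 (x + 1 / real (Suc n)) - F1 x) * real (Suc n)) \<longlonglongrightarrow> q x" if "x \<notin> N" for x
  proof (rule LIMSEQ_I)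
    fix r :: real assume "0 < r"
    then obtain d where d: "d > 0"
      "\<And>h. 0 < h \<and> h < d \<Longrightarrow> norm(integral (cbox x (x + h *\<^sub>R One)) q /\<^sub>R h ^ DIM(real) - q x) < r"
      using lim[OF \<open>x \<notin> N\<close>] by blast
    obtain n0 where n0: "inverse (real (Suc n0)) < d" using reals_Archimedean[OF d(1)] by blast
    show "\<exists>no. \<forall>n\<ge>no. norm ((F1 (x + 1 / real (Suc n)) - F1 x) * real (Suc n) - q x) < r"
    proof (intro exI allI impI)
      fix n assume "n0 \<le> n"
      then have "1 / real (Suc n) \<le> inverse (real (Suc n0))" by (simp add: field_simps)
      then have "1 / real (Suc n) < d" using n0 by simp
      with d(2)[of "1 / real (Suc n)"] 
        integral_unique[OF hi[of x "x + 1 / real (Suc n)"]]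
      show "norm ((F1 (x + 1 / real (Suc n)) - F1 x) * real (Suc n) - q x) < r"
        by (simp add: mult.commute)
    qed
  qed
  have "convergent (\<lambda>n. (f (x + 1 / real (Suc n)) - f x) * real (Suc n))" if "x \<notin> N" for x
  proof -
    have "(\<lambda>n. D * (2 * ((F1 (x + 1 / real (Suc n)) - F1 x) * real (Suc n)) - 1)) \<longlonglongrightarrow> D * (2 * q x - 1)"
      by (intro tendsto_intros lim1 that)
    moreover have "D * (2 * ((F1 (x + 1 / real (Suc n)) - F1 x) * real (Suc n)) - 1)
      = (f (x + 1 / real (Suc n)) - f x) * real (Suc n)" for n
    proof -
      have ff: "f s = D * (2 * F1 s - s)" for s using D by (simp add: F1_def field_simps)
      show ?thesis unfolding ff by (simp add: field_simps)
    qed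
    ultimately show ?thesis by (auto simp: convergent_def)
  qed
  then show ?thesis using negligible_AE_lborel[OF N] by (auto elim: eventually_mono)
qed

text \<open>The cylinder over a null set is null because 0 times infinity is 0. This carries
  almost-everywhere statements about functions of x alone, such as \<open>g\<close>, to the
  plane.\<close>

lemma AE_lborel_fst:
  fixes P :: "real \<Rightarrow> bool"
  assumes "AE x in lborel. P x"
  shows "AE z::real \<times> real in lborel. P (fst z)"
proof -
  obtain Z where Z: "Z \<in> null_sets lborel" "\<And>x. x \<notin> Z \<Longrightarrow> P x" using assms by (auto elim!: AE_E3)
  have "Z \<times> UNIV \<in> null_sets (lborel \<Otimes>\<^sub>M (lborel :: real measure))"
    using Z(1) by (auto simp: lborel.emeasure_pair_measure_Times null_sets_def)
  then have "AE z::real \<times> real in lborel. z \<notin> Z \<times> UNIV" unfolding lborel_prod by (rule AE_not_in)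
  then show ?thesis by eventually_elim (use Z(2) in \<open>auto simp: mem_Times_iff\<close>)
qed

section \<open>Integration by parts along a coordinate direction\<close>

lemma integral_lborel_translate:
  fixes h :: "'a::euclidean_space \<Rightarrow> real"
  assumes "h \<in> borel_measurable borel"
  shows "(\<integral>z. h (z + c) \<partial>lborel) = (\<integral>z. h z \<partial>lborel)"
proof -
  have "(\<integral>z. h z \<partial>lborel) = (\<integral>z. h z \<partial>distr lborel borel ((+) c))"
    by (simp add: lborel_distr_plus)
  also have "\<dots> = (\<integral>z. h (c + z) \<partial>lborel)"
    using assms by (subst integral_distr) auto
  finally show ?thesis by (simp add: add.commute)
qed

lemma integrable_bounded_support:
  fixes h :: "'a::euclidean_space \<Rightarrow> real"
  assumes "h \<in> borel_measurable borel" "\<And>z. norm z \<le> r \<Longrightarrow> \<bar>h z\<bar> \<le> B" "\<And>z. r < norm z \<Longrightarrow> h z = 0"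
  shows "integrable lborel h"
proof (rule Bochner_Integration.integrable_bound)
  show "integrable lborel (\<lambda>z::'a. B * indicator (cball 0 r) z :: real)"
    by (intro integrable_mult_right integrable_real_indicator)
      (auto simp: emeasure_bounded_finite[unfolded infinity_ennreal_def])
  show "AE z in lborel. norm (h z) \<le> norm (B * indicator (cball 0 r) z :: real)"
    using assms(2,3) by (intro AE_I2) (fastforce simp: indicator_def not_le)
qed (use assms in auto)

text \<open>Translation invariance moves a difference quotient of f onto \<psi> with the step
  reversed; dominated convergence then lets the step tend to 0 on both sides. Only quotients of
  \<psi> along e are involved, so \<psi> may jump across lines parallel to e; test functions cut off
  at the edges of a period cell do so.\<close>

lemma integral_directional_by_parts:
  fixes f \<psi> \<psi>' fe :: "real \<times> real \<Rightarrow> real"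
  assumes [measurable]: "f \<in> borel_measurable borel" "\<psi> \<in> borel_measurable borel"
      "\<psi>' \<in> borel_measurable borel" "fe \<in> borel_measurable borel"
    and fb: "\<And>r. \<exists>B. \<forall>z. norm z \<le> r \<longrightarrow> \<bar>f z\<bar> \<le> B"
    and lipf: "\<And>z s. 0 \<le> s \<Longrightarrow> \<bar>f (z + s *\<^sub>R e) - f z\<bar> \<le> C * s"
    and convf: "AE z in lborel. (\<lambda>n. (f (z + (1 / real (Suc n)) *\<^sub>R e) - f z) * real (Suc n)) \<longlonglongrightarrow> fe z"
    and supp: "\<And>z. r < norm z \<Longrightarrow> \<psi> z = 0"
    and bd: "\<And>z. \<bar>\<psi> z\<bar> \<le> B"
    and lippsi: "\<And>z s. 0 \<le> s \<Longrightarrow> \<bar>\<psi> (z - s *\<^sub>R e) - \<psi> z\<bar> \<le> D * s"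
    and convpsi: "\<And>z. (\<lambda>n. (\<psi> (z - (1 / real (Suc n)) *\<^sub>R e) - \<psi> z) * real (Suc n)) \<longlonglongrightarrow> - \<psi>' z"
  shows "integrable lborel (\<lambda>z. fe z * \<psi> z)" "integrable lborel (\<lambda>z. f z * \<psi>' z)"
    "(\<integral>z. fe z * \<psi> z \<partial>lborel) = - (\<integral>z. f z * \<psi>' z \<partial>lborel)"
proof -
  let ?s = "\<lambda>n. 1 / real (Suc n)"
  have s: "0 \<le> ?s n" "?s n \<le> 1" "?s n * real (Suc n) = 1" for n by auto
  \<comment> \<open>All steps are at most 1, so the shifted \<psi> still vanishes outside the ball
    of radius R, and one ball serves both dominating functions.\<close>
  define R where "R = \<bar>r\<bar> + norm e"
  obtain Bf where Bf: "\<And>z. norm z \<le> R \<Longrightarrow> \<bar>f z\<bar> \<le> Bf" using fb by blast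
  have q: "\<bar>(f (z + ?s n *\<^sub>R e) - f z) * real (Suc n)\<bar> \<le> C" for z n
    using mult_right_mono[OF lipf[OF s(1)[of n], of z], of "real (Suc n)"] s(3)[of n]
    by (simp add: abs_mult)
  have qp: "\<bar>(\<psi> (z - ?s n *\<^sub>R e) - \<psi> z) * real (Suc n)\<bar> \<le> D" for z n
    using mult_right_mono[OF lippsi[OF s(1)[of n], of z], of "real (Suc n)"] s(3)[of n]
    by (simp add: abs_mult)
  have C: "0 \<le> C" using q[of 0 0] by linarith
  have D: "0 \<le> D" using qp[of 0 0] by linarith
  have far: "\<psi> (z - ?s n *\<^sub>R e) = 0" "\<psi> z = 0" if "R < norm z" for z n
  proof -
    have "norm z \<le> norm (z - ?s n *\<^sub>R e) + norm (?s n *\<^sub>R e)"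
      using norm_triangle_ineq[of "z - ?s n *\<^sub>R e" "?s n *\<^sub>R e"] by simp
    moreover have "norm (?s n *\<^sub>R e) \<le> norm e"
      using mult_right_mono[OF s(2)[of n], of "norm e"] by simp
    ultimately show "\<psi> (z - ?s n *\<^sub>R e) = 0" using that by (intro supp) (simp add: R_def)
    show "\<psi> z = 0" using that norm_ge_zero[of e] abs_ge_self[of r] unfolding R_def by (intro supp) linarith
  qed
  have ind: "integrable lborel (\<lambda>z::real \<times> real. K * indicator (cball 0 \<rho>) z :: real)" for K \<rho>
    by (intro integrable_mult_right integrable_real_indicator) (auto simp: emeasure_bounded_finite[unfolded infinity_ennreal_def])
  have lim1: "AE z in lborel. (\<lambda>n. (f (z + ?s n *\<^sub>R e) - f z) * real (Suc n) * \<psi> z) \<longlonglongrightarrow> fe z * \<psi> z"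
    using convf by eventually_elim (intro tendsto_intros)
  have dom1: "AE z in lborel. norm ((f (z + ?s n *\<^sub>R e) - f z) * real (Suc n) * \<psi> z)
      \<le> C * B * indicator (cball 0 R) z" for n
  proof (intro AE_I2)
    fix z :: "real \<times> real"
    show "norm ((f (z + ?s n *\<^sub>R e) - f z) * real (Suc n) * \<psi> z) \<le> C * B * indicator (cball 0 R) z"
    proof (cases "norm z \<le> R")
      case True
      then show ?thesis using mult_mono[OF q[of z n] bd[of z] C] by (simp add: abs_mult)
    next
      case False
      then show ?thesis using far(2)[of z] by simp
    qed
  qed
  have m1: "(\<lambda>z. (f (z + ?s n *\<^sub>R e) - f z) * real (Suc n) * \<psi> z) \<in> borel_measurable lborel" for n
    by measurable
  have m1': "(\<lambda>z. fe z * \<psi> z) \<in> borel_measurable lborel" by measurable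
  show "integrable lborel (\<lambda>z. fe z * \<psi> z)"
    by (rule integrable_dominated_convergence[OF m1' m1 ind lim1 dom1])
  have L1: "(\<lambda>n. \<integral>z. (f (z + ?s n *\<^sub>R e) - f z) * real (Suc n) * \<psi> z \<partial>lborel) \<longlonglongrightarrow> (\<integral>z. fe z * \<psi> z \<partial>lborel)"
    by (rule integral_dominated_convergence[OF m1' m1 ind lim1 dom1])
  have lim2: "AE z in lborel. (\<lambda>n. f z * ((\<psi> (z - ?s n *\<^sub>R e) - \<psi> z) * real (Suc n))) \<longlonglongrightarrow> f z * - \<psi>' z"
    using convpsi by (intro AE_I2 tendsto_intros)
  have dom2: "AE z in lborel. norm (f z * ((\<psi> (z - ?s n *\<^sub>R e) - \<psi> z) * real (Suc n)))
      \<le> Bf * D * indicator (cball 0 R) z" for n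
  proof (intro AE_I2)
    fix z :: "real \<times> real"
    show "norm (f z * ((\<psi> (z - ?s n *\<^sub>R e) - \<psi> z) * real (Suc n))) \<le> Bf * D * indicator (cball 0 R) z"
    proof (cases "norm z \<le> R")
      case True
      then show ?thesis using mult_mono[OF Bf[OF True] qp[of z n]] Bf[OF True] by (simp add: abs_mult)
    next
      case False
      then show ?thesis using far(1)[of z n] far(2)[of z] by simp
    qed
  qed
  have m2: "(\<lambda>z. f z * ((\<psi> (z - ?s n *\<^sub>R e) - \<psi> z) * real (Suc n))) \<in> borel_measurable lborel" for n
    by measurable
  have m2': "(\<lambda>z. f z * - \<psi>' z) \<in> borel_measurable lborel" by measurable
  have "integrable lborel (\<lambda>z. f z * - \<psi>' z)"
    by (rule integrable_dominated_convergence[OF m2' m2 ind lim2 dom2])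
  then show "integrable lborel (\<lambda>z. f z * \<psi>' z)" by simp
  have L2: "(\<lambda>n. \<integral>z. f z * ((\<psi> (z - ?s n *\<^sub>R e) - \<psi> z) * real (Suc n)) \<partial>lborel) \<longlonglongrightarrow> (\<integral>z. f z * - \<psi>' z \<partial>lborel)"
    by (rule integral_dominated_convergence[OF m2' m2 ind lim2 dom2])
  have eq: "(\<integral>z. (f (z + ?s n *\<^sub>R e) - f z) * real (Suc n) * \<psi> z \<partial>lborel)
     = (\<integral>z. f z * ((\<psi> (z - ?s n *\<^sub>R e) - \<psi> z) * real (Suc n)) \<partial>lborel)" for n
  proof -
    have a: "integrable lborel (\<lambda>z. f z * \<psi> z)"
      by (rule integrable_bounded_support[where r=R and B="Bf * B"])
        (use far Bf bd in \<open>auto simp: abs_mult intro!: mult_mono order_trans[OF abs_ge_zero Bf]\<close>)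
    have b: "integrable lborel (\<lambda>z. f z * \<psi> (z - ?s n *\<^sub>R e))"
      by (rule integrable_bounded_support[where r=R and B="Bf * B"])
        (use far Bf in \<open>auto simp: abs_mult intro!: mult_mono bd order_trans[OF abs_ge_zero Bf]\<close>)
    have c: "integrable lborel (\<lambda>z. f (z + ?s n *\<^sub>R e) * \<psi> z)"
    proof -
      have "integrable (distr lborel borel ((+) (?s n *\<^sub>R e))) (\<lambda>z. f z * \<psi> (z - ?s n *\<^sub>R e))"
        using b by (simp add: lborel_distr_plus)
      then show ?thesis by (subst (asm) integrable_distr_eq) (auto simp: add.commute)
    qed
    have "(\<integral>z. (f (z + ?s n *\<^sub>R e) - f z) * real (Suc n) * \<psi> z \<partial>lborel)
       = real (Suc n) * ((\<integral>z. f (z + ?s n *\<^sub>R e) * \<psi> z \<partial>lborel) - (\<integral>z. f z * \<psi> z \<partial>lborel))"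
      by (subst Bochner_Integration.integral_diff[symmetric, OF c a], subst integral_mult_right_zero[symmetric])
        (simp add: algebra_simps)
    also have "(\<integral>z. f (z + ?s n *\<^sub>R e) * \<psi> z \<partial>lborel) = (\<integral>z. f z * \<psi> (z - ?s n *\<^sub>R e) \<partial>lborel)"
      using integral_lborel_translate[of "\<lambda>z. f z * \<psi> (z - ?s n *\<^sub>R e)" "?s n *\<^sub>R e"] by simp
    also have "real (Suc n) * ((\<integral>z. f z * \<psi> (z - ?s n *\<^sub>R e) \<partial>lborel) - (\<integral>z. f z * \<psi> z \<partial>lborel))
       = (\<integral>z. f z * ((\<psi> (z - ?s n *\<^sub>R e) - \<psi> z) * real (Suc n)) \<partial>lborel)"
      by (subst Bochner_Integration.integral_diff[symmetric, OF b a], subst integral_mult_right_zero[symmetric])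
        (simp add: algebra_simps)
    finally show ?thesis .
  qed
  show "(\<integral>z. fe z * \<psi> z \<partial>lborel) = - (\<integral>z. f z * \<psi>' z \<partial>lborel)"
    using LIMSEQ_unique[OF L1 L2[folded eq]] by simp
qed

text \<open>On every line in direction e the restriction is Lipschitz, so the exceptional set meets
  each such line in a null set, and Fubini makes it null in the plane. Its measurability comes from
  writing convergence as the Cauchy property. For e = (1, 0) the inner variable is x, so the two AE
  quantifiers have to be exchanged.\<close>

lemma lipschitz_direction_quotients_AE:
  fixes f :: "real \<times> real \<Rightarrow> real"
  assumes [measurable]: "f \<in> borel_measurable borel"
    and e: "e = (1, 0) \<or> e = (0, 1)"
    and lip: "\<And>z s. 0 \<le> s \<Longrightarrow> \<bar>f (z + s *\<^sub>R e) - f z\<bar> \<le> C * s"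
  shows "AE z in lborel. convergent (\<lambda>n. (f (z + (1 / real (Suc n)) *\<^sub>R e) - f z) * real (Suc n))"
proof -
  let ?P = "\<lambda>z. convergent (\<lambda>n. (f (z + (1 / real (Suc n)) *\<^sub>R e) - f z) * real (Suc n))"
  have "Measurable.pred borel (\<lambda>z. Cauchy (\<lambda>n. (f (z + (1 / real (Suc n)) *\<^sub>R e) - f z) * real (Suc n)))"
    by measurable
  then have m: "{z \<in> space (lborel \<Otimes>\<^sub>M lborel). ?P z} \<in> sets (lborel \<Otimes>\<^sub>M lborel)"
    unfolding lborel_prod by (simp add: Cauchy_convergent_iff pred_def)
  have "AE z in lborel \<Otimes>\<^sub>M lborel. ?P z"
  proof (rule lborel_pair.AE_pair_measure[OF m])
    from e show "AE x in lborel. AE y in lborel. ?P (x, y)"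
    proof
      assume e: "e = (0, 1)"
      have "\<bar>f (x, s) - f (x, t)\<bar> \<le> C * \<bar>s - t\<bar>" for x s t
        using lip[of "s - t" "(x, t)"] lip[of "t - s" "(x, s)"]
        by (cases "t \<le> s") (auto simp: e abs_minus_commute)
      from lipschitz_right_quotients_AE[OF this] show ?thesis by (simp add: e)
    next
      assume e: "e = (1, 0)"
      have "\<bar>f (s, y) - f (t, y)\<bar> \<le> C * \<bar>s - t\<bar>" for y s t
        using lip[of "s - t" "(t, y)"] lip[of "t - s" "(s, y)"]
        by (cases "t \<le> s") (auto simp: e abs_minus_commute)
      from lipschitz_right_quotients_AE[OF this] have "AE y in lborel. AE x in lborel. ?P (x, y)"
        by (simp add: e)
      then show ?thesis
        using lborel_pair.AE_commute[of "\<lambda>x y. ?P (x, y)"] m by simp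
    qed
  qed
  then show ?thesis by (simp only: lborel_prod)
qed

text \<open>Clipping the limit to [-C, C] makes the bound hold at every point, including those where
  \<open>lim\<close> has an arbitrary value. Almost everywhere the limit lies in this interval and
  clipping changes nothing.\<close>

lemma lipschitz_direction_derivative:
  fixes f :: "real \<times> real \<Rightarrow> real"
  assumes [measurable]: "f \<in> borel_measurable borel"
    and e: "e = (1, 0) \<or> e = (0, 1)"
    and lip: "\<And>z s. 0 \<le> s \<Longrightarrow> \<bar>f (z + s *\<^sub>R e) - f z\<bar> \<le> C * s"
  obtains fe where "fe \<in> borel_measurable borel" "\<And>z. \<bar>fe z\<bar> \<le> C"
    "AE z in lborel. (\<lambda>n. (f (z + (1 / real (Suc n)) *\<^sub>R e) - f z) * real (Suc n)) \<longlonglongrightarrow> fe z"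
proof -
  define q where "q n z = (f (z + (1 / real (Suc n)) *\<^sub>R e) - f z) * real (Suc n)" for n z
  have qm[measurable]: "q n \<in> borel_measurable borel" for n unfolding q_def by measurable
  have bd: "\<bar>q n z\<bar> \<le> C" for n z
    using mult_right_mono[OF lip[of "1 / real (Suc n)" z], of "real (Suc n)"]
    by (simp add: q_def abs_mult)
  define fe where "fe z = max (- C) (min C (lim (\<lambda>n. q n z)))" for z
  have "fe \<in> borel_measurable borel" unfolding fe_def by measurable
  moreover have "0 \<le> C" using bd[of 0 0] by linarith
  then have "\<bar>fe z\<bar> \<le> C" for z by (auto simp: fe_def)
  moreover have "AE z in lborel. convergent (\<lambda>n. q n z)"
    unfolding q_def by (rule lipschitz_direction_quotients_AE[OF assms])
  then have "AE z in lborel. (\<lambda>n. q n z) \<longlonglongrightarrow> fe z"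
  proof eventually_elim
    case (elim z)
    then have l: "(\<lambda>n. q n z) \<longlonglongrightarrow> lim (\<lambda>n. q n z)" by (simp add: convergent_LIMSEQ_iff)
    have "lim (\<lambda>n. q n z) \<le> C" using bd[of _ z] by (intro LIMSEQ_le_const2[OF l]) (auto simp: abs_le_iff)
    moreover have "- C \<le> lim (\<lambda>n. q n z)"
      using bd[of _ z] by (intro LIMSEQ_le_const[OF l]) (auto simp: abs_le_iff minus_le_iff)
    ultimately have "fe z = lim (\<lambda>n. q n z)" by (simp add: fe_def)
    with l show ?case by simp
  qed
  ultimately show ?thesis by (intro that) (auto simp: q_def)
qed

section \<open>The initial datum\<close>

lemma average_tendsto_AE:
  fixes f :: "real \<Rightarrow> real"
  assumes "\<And>a b. f integrable_on {a..b}"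
  shows "AE x in lborel. ((\<lambda>h. integral {x..x + h} f / h) \<longlongrightarrow> f x) (at_right 0)"
proof -
  have "f integrable_on cbox a b" for a b using assms by simp
  then obtain N where N: "negligible N"
    and lim: "\<And>x e. \<lbrakk>x \<notin> N; 0 < e\<rbrakk> \<Longrightarrow>
               \<exists>d>0. \<forall>h. 0 < h \<and> h < d \<longrightarrow>
                         norm(integral (cbox x (x + h *\<^sub>R One)) f /\<^sub>R h ^ DIM(real) - f x) < e"
    using integrable_ccontinuous_explicit[of f] by blast
  have "((\<lambda>h. integral {x..x + h} f / h) \<longlongrightarrow> f x) (at_right 0)" if "x \<notin> N" for x
  proof (rule tendstoI)
    fix e :: real assume "0 < e"
    then obtain d where "d > 0"
      "\<And>h. 0 < h \<and> h < d \<Longrightarrow> norm(integral (cbox x (x + h *\<^sub>R One)) f /\<^sub>R h ^ DIM(real) - f x) < e"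
      using lim[OF \<open>x \<notin> N\<close>] by blast
    then show "\<forall>\<^sub>F h in at_right 0. dist (integral {x..x + h} f / h) (f x) < e"
      unfolding eventually_at_right_field
      by (intro exI[of _ d]) (auto simp: dist_real_def divide_inverse mult.commute)
  qed
  then show ?thesis using negligible_AE_lborel[OF N] by (auto elim: eventually_mono)
qed

section \<open>Smoothed ramps and increments of weakly differentiable functions\<close>

definition ppart :: "real \<Rightarrow> real" where "ppart r = max 0 r"

lemma has_real_derivative_ppart_sq: "((\<lambda>r. (ppart r)\<^sup>2 / 2) has_real_derivative ppart r) (at r)"
proof (cases "r = 0")
  case True
  have "\<bar>(ppart h)\<^sup>2 / 2 / h\<bar> \<le> \<bar>h\<bar>" for h
    by (auto simp: ppart_def max_def power2_eq_square)
  then have "(\<lambda>h. (ppart h)\<^sup>2 / 2 / h) \<midarrow>0\<rightarrow> 0"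
    by (intro Lim_null_comparison[of "\<lambda>h. (ppart h)\<^sup>2 / 2 / h" "\<lambda>h. \<bar>h\<bar>"])
      (auto intro!: always_eventually tendsto_eq_intros)
  then show ?thesis using True by (simp add: DERIV_def ppart_def)
next
  case False
  show ?thesis
  proof (cases "r > 0")
    case True
    have "((\<lambda>r. r\<^sup>2 / 2) has_real_derivative r) (at r)"
      by (auto intro!: derivative_eq_intros)
    then have "((\<lambda>r. (ppart r)\<^sup>2 / 2) has_real_derivative r) (at r)"
      by (rule has_field_derivative_transform_within_open[where S="{0<..}"])
        (use True in \<open>auto simp: ppart_def\<close>)
    then show ?thesis using True by (simp add: ppart_def)
  next
    case r: False
    have "((\<lambda>r. (ppart r)\<^sup>2 / 2) has_real_derivative 0) (at r)"
      by (rule has_field_derivative_transform_within_open[where S="{..<0}" and f="\<lambda>_. 0"])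
        (use r False in \<open>auto simp: ppart_def\<close>)
    then show ?thesis using r by (simp add: ppart_def)
  qed
qed

text \<open>\<^term>\<open>ramp k\<close> is a \<open>C\<^sup>1\<close> approximation of \<^term>\<open>ppart\<close>.\<close>
definition ramp :: "nat \<Rightarrow> real \<Rightarrow> real" where
  "ramp k r = real (Suc k) * ((ppart r)\<^sup>2 / 2 - (ppart (r - 1 / real (Suc k)))\<^sup>2 / 2)"

definition ramp' :: "nat \<Rightarrow> real \<Rightarrow> real" where
  "ramp' k r = real (Suc k) * (ppart r - ppart (r - 1 / real (Suc k)))"

lemma ramp_nonpos: assumes "r \<le> 0" shows "ramp k r = 0" "ramp' k r = 0"
proof -
  have "0 < 1 / real (Suc k)" by simp
  with assms have "r - 1 / real (Suc k) \<le> 0" by linarith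
  with assms have p: "ppart r = 0" "ppart (r - 1 / real (Suc k)) = 0"
    unfolding ppart_def by linarith+
  show "ramp k r = 0" "ramp' k r = 0" unfolding ramp_def ramp'_def p by simp_all
qed

text \<open>Past its corner the ramp lags behind \<open>ppart\<close> by a constant. In the
  trapezoid the four ramps carry the signs +, -, -, +, so beyond the last corner both the lags and
  the linear parts cancel.\<close>

lemma ramp_large:
  assumes "1 / real (Suc k) \<le> r"
  shows "ramp k r = r - 1 / (2 * real (Suc k))" "ramp' k r = 1"
proof -
  have "0 < 1 / real (Suc k)" by simp
  then have p: "ppart r = r" "ppart (r - 1 / real (Suc k)) = r - 1 / real (Suc k)"
    using assms unfolding ppart_def by linarith+
  show "ramp k r = r - 1 / (2 * real (Suc k))" "ramp' k r = 1"
    unfolding ramp_def ramp'_def p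
    by (simp_all add: power2_eq_square field_simps del: of_nat_Suc)
qed

text \<open>The half square of \<open>ppart\<close> is a primitive of \<open>ppart\<close>, so
  \<open>ramp k r\<close> is the mean of \<open>ppart\<close> over the interval of length 1 / (k +
  1) ending at r, and \<open>ramp' k r\<close> is the difference quotient of \<open>ppart\<close>
  over that interval. Monotonicity and slope at most 1 give the bounds.\<close>

lemma ramp_bounds: "0 \<le> ramp k r" "ramp k r \<le> ppart r" "0 \<le> ramp' k r" "ramp' k r \<le> 1"
proof -
  let ?a = "1 / real (Suc k)"
  have a: "0 < ?a" "real (Suc k) * ?a = 1" by auto
  consider "r \<le> 0" | "0 < r" "r \<le> ?a" | "?a < r" by linarith
  then have "0 \<le> ramp k r \<and> ramp k r \<le> ppart r \<and> 0 \<le> ramp' k r \<and> ramp' k r \<le> 1"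
  proof cases
    case 1 then show ?thesis by (simp add: ramp_nonpos ppart_def)
  next
    case 2
    then have p: "ppart r = r" "ppart (r - ?a) = 0" by (auto simp: ppart_def)
    have "real (Suc k) * r \<le> 1" using mult_left_mono[OF 2(2), of "real (Suc k)"] by simp
    moreover have "real (Suc k) * (r\<^sup>2 / 2) = (real (Suc k) * r) * r / 2" by (simp add: power2_eq_square)
    moreover have "(real (Suc k) * r) * r \<le> 1 * r" using 2 calculation(1) by (intro mult_right_mono) auto
    ultimately show ?thesis using 2 by (auto simp: ramp_def ramp'_def p simp del: of_nat_Suc)
  next
    case 3
    then have "0 < r" using a(1) by linarith
    have "1 / (2 * real (Suc k)) \<le> ?a" by (simp add: field_simps)
    then have "1 / (2 * real (Suc k)) \<le> r" using 3 by linarith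
    with 3 \<open>0 < r\<close> show ?thesis by (auto simp: ramp_large ppart_def simp del: of_nat_Suc)
  qed
  then show "0 \<le> ramp k r" "ramp k r \<le> ppart r" "0 \<le> ramp' k r" "ramp' k r \<le> 1" by auto
qed

text \<open>The limit slope at r = 0 is 0, since the ramps are flat on the closed left half line.
  This is why half-open intervals, open on the left, appear when the slopes are combined.\<close>

lemma ramp_tendsto: "(\<lambda>k. ramp k r) \<longlonglongrightarrow> ppart r" "(\<lambda>k. ramp' k r) \<longlonglongrightarrow> (if r > 0 then 1 else 0)"
proof -
  have *: "\<forall>\<^sub>F k in sequentially. 1 / real (Suc k) \<le> r" if "r > 0"
  proof -
    have "(\<lambda>k. 1 / real (Suc k)) \<longlonglongrightarrow> 0" using LIMSEQ_inverse_real_of_nat by (simp add: inverse_eq_divide)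
    from order_tendstoD(2)[OF this that] show ?thesis by (rule eventually_mono) simp
  qed
  have "(\<lambda>k. r - 1 / (2 * real (Suc k))) \<longlonglongrightarrow> r - 0"
    using tendsto_mult_right[OF LIMSEQ_inverse_real_of_nat, of "1/2"]
    by (intro tendsto_intros) (simp add: inverse_eq_divide mult.commute)
  then show "(\<lambda>k. ramp k r) \<longlonglongrightarrow> ppart r"
    using * by (cases "r > 0")
     (auto simp: ramp_nonpos ppart_def max_def ramp_large(1) elim!: Lim_transform_eventually eventually_mono simp del: of_nat_Suc)
  show "(\<lambda>k. ramp' k r) \<longlonglongrightarrow> (if r > 0 then 1 else 0)"
    using * by (cases "r > 0")
     (auto simp: ramp_nonpos ramp_large(2) intro!: tendsto_eventually elim!: eventually_mono simp del: of_nat_Suc)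
qed

lemma has_real_derivative_ramp: "(ramp k has_real_derivative ramp' k r) (at r)"
proof -
  have "((\<lambda>r. (ppart (r - 1 / real (Suc k)))\<^sup>2 / 2) has_real_derivative ppart (r - 1 / real (Suc k)) * 1) (at r)"
    by (rule DERIV_chain2[OF has_real_derivative_ppart_sq]) (auto intro!: derivative_eq_intros)
  from DERIV_cmult[OF DERIV_diff[OF has_real_derivative_ppart_sq[of r] this], of "real (Suc k)"]
  show ?thesis by (simp add: ramp_def[abs_def] ramp'_def)
qed

lemma continuous_ramp': "continuous_on UNIV (ramp' k)"
  unfolding ramp'_def[abs_def] ppart_def by (intro continuous_intros)

lemma loc_int_on_UNIV_integrable_on:
  fixes f :: "real \<Rightarrow> real"
  assumes "loc_int_on UNIV f"
  shows "set_integrable lebesgue {a..b} f" "f integrable_on {a..b}"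
proof -
  show "set_integrable lebesgue {a..b} f" using assms by (auto simp: loc_int_on_def)
  then show "f integrable_on {a..b}" by (rule set_lebesgue_integral_eq_integral)
qed

text \<open>The test functions are \<open>C\<^sup>1\<close> approximations of the trapezoid with slopes \<open>\<plusminus>1\<close> on
  \<open>[x, x + h]\<close> and \<open>[y, y + h]\<close>.\<close>
lemma weak_deriv1_trapezoid:
  assumes wd: "weak_deriv1 UNIV f f'" and xy: "x \<le> y" and h: "0 < h"
  shows "integral {y..y + h} f - integral {x..x + h} f
    = (\<integral>s. f' s * (ppart (s - x) - ppart (s - (x + h)) - ppart (s - y) + ppart (s - (y + h))) \<partial>lebesgue)"
proof -
  define \<phi> where "\<phi> k s = ramp k (s - x) - ramp k (s - (x + h)) - ramp k (s - y) + ramp k (s - (y + h))" for k s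
  define \<phi>' where "\<phi>' k s = ramp' k (s - x) - ramp' k (s - (x + h)) - ramp' k (s - y) + ramp' k (s - (y + h))" for k s
  define \<phi>l where "\<phi>l s = ppart (s - x) - ppart (s - (x + h)) - ppart (s - y) + ppart (s - (y + h))" for s
  define J where "J r = (if r > 0 then 1 else 0 :: real)" for r :: real
  define \<phi>l' where "\<phi>l' s = J (s - x) - J (s - (x + h)) - J (s - y) + J (s - (y + h))" for s
  \<comment> \<open>\<open>ramp k\<close> attains its final slope only 1 / (k + 1) after its corner;
    the extra 1 contains this delay for every k.\<close>
  let ?K = "{x..y + h + 1}"
  have lf: "loc_int_on UNIV f" and lf': "loc_int_on UNIV f'"
    and ibp: "\<And>\<phi> \<phi>'. test1 UNIV \<phi> \<phi>' \<Longrightarrow> (\<integral>s. f s * \<phi>' s \<partial>lebesgue) = - (\<integral>s. f' s * \<phi> s \<partial>lebesgue)"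
    using wd by (auto simp: weak_deriv1_def set_lebesgue_integral_def)
  have zero: "\<phi> k s = 0" "\<phi>' k s = 0" if "s \<notin> ?K" for k s
  proof -
    have "1 / real (Suc k) \<le> 1" by simp
    then have "s < x \<or> (1 / real (Suc k) \<le> s - x \<and> 1 / real (Suc k) \<le> s - (x + h) \<and> 1 / real (Suc k) \<le> s - y
        \<and> 1 / real (Suc k) \<le> s - (y + h))"
      using that xy h unfolding atLeastAtMost_iff by linarith
    then show "\<phi> k s = 0" "\<phi>' k s = 0"
      using xy h by (auto simp: \<phi>_def \<phi>'_def ramp_nonpos ramp_large simp del: of_nat_Suc)
  qed
  have test: "test1 UNIV (\<phi> k) (\<phi>' k)" for k
    unfolding test1_def
  proof (intro conjI allI exI[of _ ?K] impI)
    have d: "((\<lambda>s. ramp k (s - c)) has_real_derivative ramp' k (s - c)) (at s)" for c s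
    proof -
      have "((\<lambda>s. s - c) has_real_derivative 1) (at s)" by (auto intro!: derivative_eq_intros)
      from DERIV_chain2[OF has_real_derivative_ramp this] show ?thesis by simp
    qed
    show "(\<phi> k has_real_derivative \<phi>' k s) (at s)" for s
      unfolding \<phi>_def[abs_def] \<phi>'_def by (intro DERIV_add DERIV_diff d)
    show "continuous_on UNIV (\<phi>' k)"
      unfolding \<phi>'_def[abs_def]
      by (intro continuous_intros continuous_on_compose2[OF continuous_ramp']) auto
  qed (use zero in auto)
  have bd': "\<bar>\<phi>' k s\<bar> \<le> 2" for k s
    using ramp_bounds(3,4)[of k "s - x"] ramp_bounds(3,4)[of k "s - y"]
      ramp_bounds(3,4)[of k "s - (x + h)"] ramp_bounds(3,4)[of k "s - (y + h)"]
    unfolding \<phi>'_def abs_le_iff by linarith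
  have bd: "\<bar>\<phi> k s\<bar> \<le> 4 * (y + h + 1 - x)" if "s \<in> ?K" for k s
  proof -
    have "ppart (s - c) \<le> y + h + 1 - x" if "c \<ge> x" for c
      using \<open>s \<in> ?K\<close> that h xy by (auto simp: ppart_def)
    from this[of x] this[of y] this[of "x + h"] this[of "y + h"]
    show ?thesis using xy h
      ramp_bounds(1,2)[of k "s - x"] ramp_bounds(1,2)[of k "s - y"]
      ramp_bounds(1,2)[of k "s - (x + h)"] ramp_bounds(1,2)[of k "s - (y + h)"]
      unfolding \<phi>_def abs_le_iff by (simp; linarith)
  qed
  have contc: "continuous_on UNIV (\<phi> k)" "continuous_on UNIV (\<phi>' k)" "continuous_on UNIV \<phi>l" for k
    using test[of k] DERIV_continuous_on[of UNIV "\<phi> k" "\<phi>' k"]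
    by (auto simp: test1_def \<phi>l_def[abs_def] ppart_def intro!: continuous_intros)
  have leb: "F \<in> borel_measurable lebesgue" if "continuous_on UNIV F" for F :: "real \<Rightarrow> real"
    using that by (intro measurable_completion) (simp add: borel_measurable_continuous_onI)
  \<comment> \<open>Local integrability gives measurability on each bounded interval, and the
    function is the pointwise limit of its cutoffs.\<close>
  have fm [measurable]: "f \<in> borel_measurable lebesgue" "f' \<in> borel_measurable lebesgue"
  proof -
    have m: "F \<in> borel_measurable lebesgue" if "loc_int_on UNIV F" for F :: "real \<Rightarrow> real"
    proof (rule borel_measurable_LIMSEQ_real[where u="\<lambda>i x. indicator {- real i..real i} x * F x"])
      fix x :: real
      obtain i0 where i0: "\<bar>x\<bar> < real i0" using reals_Archimedean2 by blast
      have "\<forall>\<^sub>F i in sequentially. indicator {- real i..real i} x * F x = F x"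
        using eventually_ge_at_top[of i0] by eventually_elim (use i0 in \<open>auto simp: indicator_def\<close>)
      then show "(\<lambda>i. indicator {- real i..real i} x * F x) \<longlonglongrightarrow> F x" by (rule tendsto_eventually)
      show "(\<lambda>x. indicator {- real i..real i} x * F x) \<in> borel_measurable lebesgue" for i
        using loc_int_on_UNIV_integrable_on(1)[OF that, of "- real i" "real i"]
        by (auto simp: set_integrable_def)
    qed
    show "f \<in> borel_measurable lebesgue" "f' \<in> borel_measurable lebesgue" using m lf lf' by auto
  qed
  have [measurable]: "\<phi>l' \<in> borel_measurable lebesgue"
    by (rule measurable_completion) (unfold \<phi>l'_def[abs_def] J_def, measurable)
  have L1: "(\<lambda>k. \<integral>s. f s * \<phi>' k s \<partial>lebesgue) \<longlonglongrightarrow> (\<integral>s. f s * \<phi>l' s \<partial>lebesgue)"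
  proof (rule integral_dominated_convergence[where w="\<lambda>s. 2 * \<bar>indicator ?K s * f s\<bar>"])
    show "integrable lebesgue (\<lambda>s. 2 * \<bar>indicator ?K s * f s\<bar>)"
      using loc_int_on_UNIV_integrable_on(1)[OF lf, of x "y + h + 1"]
      by (auto simp: set_integrable_def)
    show "AE s in lebesgue. (\<lambda>k. f s * \<phi>' k s) \<longlonglongrightarrow> f s * \<phi>l' s"
      unfolding \<phi>'_def \<phi>l'_def J_def by (intro AE_I2 tendsto_intros ramp_tendsto)
    show "AE s in lebesgue. norm (f s * \<phi>' k s) \<le> 2 * \<bar>indicator ?K s * f s\<bar>" for k
    proof (intro AE_I2)
      fix s show "norm (f s * \<phi>' k s) \<le> 2 * \<bar>indicator ?K s * f s\<bar>"
        using zero[of s k] mult_left_mono[OF bd'[of k s], of "\<bar>f s\<bar>"]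
        by (cases "s \<in> ?K") (auto simp: abs_mult)
    qed
    show "(\<lambda>s. f s * \<phi>' k s) \<in> borel_measurable lebesgue" for k
      using leb[OF contc(2)[of k]] by measurable
  qed measurable
  have L2: "(\<lambda>k. \<integral>s. f' s * \<phi> k s \<partial>lebesgue) \<longlonglongrightarrow> (\<integral>s. f' s * \<phi>l s \<partial>lebesgue)"
  proof (rule integral_dominated_convergence[where w="\<lambda>s. 4 * (y + h + 1 - x) * \<bar>indicator ?K s * f' s\<bar>"])
    show "integrable lebesgue (\<lambda>s. 4 * (y + h + 1 - x) * \<bar>indicator ?K s * f' s\<bar>)"
      using loc_int_on_UNIV_integrable_on(1)[OF lf', of x "y + h + 1"]
      by (auto simp: set_integrable_def)
    show "AE s in lebesgue. (\<lambda>k. f' s * \<phi> k s) \<longlonglongrightarrow> f' s * \<phi>l s"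
      unfolding \<phi>_def \<phi>l_def by (intro AE_I2 tendsto_intros ramp_tendsto)
    show "AE s in lebesgue. norm (f' s * \<phi> k s) \<le> 4 * (y + h + 1 - x) * \<bar>indicator ?K s * f' s\<bar>" for k
    proof (intro AE_I2)
      fix s show "norm (f' s * \<phi> k s) \<le> 4 * (y + h + 1 - x) * \<bar>indicator ?K s * f' s\<bar>"
        using zero[of s k] mult_right_mono[OF bd[of s k], of "\<bar>f' s\<bar>"]
        by (cases "s \<in> ?K") (auto simp: abs_mult mult.commute)
    qed
    show "(\<lambda>s. f' s * \<phi> k s) \<in> borel_measurable lebesgue" for k
      using leb[OF contc(1)[of k]] by measurable
    show "(\<lambda>s. f' s * \<phi>l s) \<in> borel_measurable lebesgue"
      using leb[OF contc(3)] by measurable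
  qed
  have "(\<integral>s. f s * \<phi>l' s \<partial>lebesgue) = - (\<integral>s. f' s * \<phi>l s \<partial>lebesgue)"
    using LIMSEQ_unique[OF L1] tendsto_minus[OF L2] ibp[OF test] by simp
  moreover have "(\<integral>s. f s * \<phi>l' s \<partial>lebesgue) = integral {x..x + h} f - integral {y..y + h} f"
  proof -
    have eqs: "(\<integral>s. indicator {a<..a + h} s * f s \<partial>lebesgue) = integral {a..a + h} f"
      "integrable lebesgue (\<lambda>s. indicator {a<..a + h} s * f s)" for a
    proof -
      have si: "set_integrable lebesgue {a..a + h} f" by (rule loc_int_on_UNIV_integrable_on[OF lf])
      have n: "AE s in lebesgue. s \<noteq> a" by (rule AE_completion[OF AE_lborel_singleton])
      have "(\<integral>s. indicator {a<..a + h} s * f s \<partial>lebesgue) = (\<integral>s. indicator {a..a + h} s * f s \<partial>lebesgue)"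
      proof (rule integral_cong_AE)
        show "AE s in lebesgue. indicator {a<..a + h} s * f s = indicator {a..a + h} s * f s"
          using n by eventually_elim (auto simp: indicator_def)
      qed (intro borel_measurable_times borel_measurable_indicator fm; simp)+
      also have "\<dots> = integral {a..a + h} f"
        using set_lebesgue_integral_eq_integral(2)[OF si] by (simp add: set_lebesgue_integral_def)
      finally show "(\<integral>s. indicator {a<..a + h} s * f s \<partial>lebesgue) = integral {a..a + h} f" .
      show "integrable lebesgue (\<lambda>s. indicator {a<..a + h} s * f s)"
        using set_integrable_subset[OF si, of "{a<..a + h}"]
        by (simp add: set_integrable_def greaterThanAtMost_subseteq_atLeastAtMost_iff)
    qed
    have "f s * \<phi>l' s = indicator {x<..x + h} s * f s - indicator {y<..y + h} s * f s" for s
      using h by (auto simp: \<phi>l'_def J_def indicator_def)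
    then show ?thesis
      using Bochner_Integration.integral_diff[OF eqs(2)[of x] eqs(2)[of y]] by (simp add: eqs(1))
  qed
  ultimately show ?thesis unfolding \<phi>l_def by simp
qed

text \<open>Dividing the trapezoid identity by h turns its left side into right-hand averages, which
  tend to f y - f x off the null set where they fail to recover f. On the right the normalised
  trapezoid tends to the indicator of (x, y].\<close>

lemma weak_deriv1_increment:
  assumes wd: "weak_deriv1 UNIV f f'"
  shows "\<exists>N. negligible N \<and> (\<forall>x y. x \<notin> N \<longrightarrow> y \<notin> N \<longrightarrow> x \<le> y \<longrightarrow> f y - f x = integral {x..y} f')"
proof -
  have lf: "loc_int_on UNIV f" and lf': "loc_int_on UNIV f'" using wd by (auto simp: weak_deriv1_def)
  define h where "h n = 1 / real (Suc n)" for n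
  have h: "0 < h n" "h n \<le> 1" for n by (auto simp: h_def)
  have h0: "h \<longlonglongrightarrow> 0" unfolding h_def using LIMSEQ_inverse_real_of_nat by (simp add: inverse_eq_divide)
  have hr: "filterlim h (at_right 0) sequentially"
    unfolding filterlim_at using h0 less_imp_neq[OF h(1)] h(1) by auto
  have "AE x in lborel. ((\<lambda>h. integral {x..x + h} f / h) \<longlongrightarrow> f x) (at_right 0)"
    by (rule average_tendsto_AE) (rule loc_int_on_UNIV_integrable_on[OF lf])
  then have "AE x in lebesgue. ((\<lambda>h. integral {x..x + h} f / h) \<longlongrightarrow> f x) (at_right 0)"
    by (rule AE_completion)
  then obtain N where N: "N \<in> null_sets lebesgue"
    and avg: "\<And>x. x \<notin> N \<Longrightarrow> ((\<lambda>h. integral {x..x + h} f / h) \<longlongrightarrow> f x) (at_right 0)"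
    by (auto elim!: AE_E3 simp: space_completion)
  have "f y - f x = integral {x..y} f'" if x: "x \<notin> N" and y: "y \<notin> N" and xy: "x \<le> y" for x y
  proof -
    \<comment> \<open>The trapezoid scaled to height 1: bounded by 1 and, as h n is at most 1,
      supported in [x, y + 1] for all n.\<close>
    define \<kappa> where "\<kappa> n s = (ppart (s - x) - ppart (s - (x + h n)) - ppart (s - y) + ppart (s - (y + h n))) / h n" for n s
    have q: "0 \<le> (ppart r - ppart (r - h n)) / h n" "(ppart r - ppart (r - h n)) / h n \<le> 1" for r n
      using h(1)[of n] by (auto simp: ppart_def max_def)
    have k2: "\<kappa> n s = (ppart (s - x) - ppart (s - x - h n)) / h n - (ppart (s - y) - ppart (s - y - h n)) / h n" for n s
      by (simp add: \<kappa>_def diff_divide_distrib add_divide_distrib algebra_simps)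
    have bd: "\<bar>\<kappa> n s\<bar> \<le> 1" for n s
      using q[of "s - x" n] q[of "s - y" n] unfolding k2 abs_le_iff by linarith
    have q1: "(ppart r - ppart (r - h n)) / h n = 1" if "h n \<le> r" for r n
      using h(1)[of n] that by (simp add: ppart_def max_def)
    have q0: "(ppart r - ppart (r - h n)) / h n = 0" if "r \<le> 0" for r n
      using h(1)[of n] that by (simp add: ppart_def max_def)
    have zero: "\<kappa> n s = 0" if "s \<notin> {x..y + 1}" for n s
      using that xy h[of n] by (cases "s < x") (simp_all add: k2 q0 q1)
    have ql: "(\<lambda>n. (ppart r - ppart (r - h n)) / h n) \<longlonglongrightarrow> (if r > 0 then 1 else 0)" for r
    proof (cases "r > 0")
      case True
      have "\<forall>\<^sub>F n in sequentially. h n < r" using order_tendstoD(2)[OF h0 True] .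
      then have "\<forall>\<^sub>F n in sequentially. (ppart r - ppart (r - h n)) / h n = 1"
        by eventually_elim (rule q1, simp)
      then show ?thesis using True by (simp add: tendsto_eventually)
    qed (simp add: q0)
    have m: "\<kappa> n \<in> borel_measurable lebesgue" for n
      unfolding \<kappa>_def[abs_def] ppart_def by (intro measurable_completion) measurable
    have si: "set_integrable lebesgue {x..y + 1} f'" "set_integrable lebesgue {x..y} f'"
      by (rule loc_int_on_UNIV_integrable_on[OF lf'])+
    have fk: "f' s * \<kappa> n s = (indicator {x..y + 1} s * f' s) * \<kappa> n s" for s n
      using zero[of s n] by (auto simp: indicator_def)
    have "(\<lambda>n. \<integral>s. f' s * \<kappa> n s \<partial>lebesgue) \<longlonglongrightarrow> (\<integral>s. indicator {x..y} s * f' s \<partial>lebesgue)"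
    proof (rule integral_dominated_convergence[where w="\<lambda>s. \<bar>indicator {x..y + 1} s * f' s\<bar>"])
      show "integrable lebesgue (\<lambda>s. \<bar>indicator {x..y + 1} s * f' s\<bar>)"
        using si(1) by (auto simp: set_integrable_def)
      show "AE s in lebesgue. norm (f' s * \<kappa> n s) \<le> \<bar>indicator {x..y + 1} s * f' s\<bar>" for n
        using mult_left_mono[OF bd[of n]] by (intro AE_I2) (simp add: fk abs_mult mult_left_le)
      have "AE s in lebesgue. s \<noteq> x" by (rule AE_completion[OF AE_lborel_singleton])
      then show "AE s in lebesgue. (\<lambda>n. f' s * \<kappa> n s) \<longlonglongrightarrow> indicator {x..y} s * f' s"
      proof eventually_elim
        case (elim s)
        have "(\<lambda>n. f' s * \<kappa> n s) \<longlonglongrightarrow> f' s * ((if s - x > 0 then 1 else 0) - (if s - y > 0 then 1 else 0))"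
          unfolding k2 by (intro tendsto_intros ql)
        moreover have "f' s * ((if s - x > 0 then 1 else 0) - (if s - y > 0 then 1 else 0)) = indicator {x..y} s * f' s"
          using xy elim by (auto simp: indicator_def)
        ultimately show ?case by (simp only:)
      qed
      show "(\<lambda>s. indicator {x..y} s * f' s) \<in> borel_measurable lebesgue"
        using si(2) by (auto simp: set_integrable_def)
      show "(\<lambda>s. f' s * \<kappa> n s) \<in> borel_measurable lebesgue" for n
        unfolding fk using si(1) m[of n] by (auto simp: set_integrable_def)
    qed
    moreover have "(\<integral>s. indicator {x..y} s * f' s \<partial>lebesgue) = integral {x..y} f'"
      using set_lebesgue_integral_eq_integral(2)[OF si(2)] by (simp add: set_lebesgue_integral_def)
    moreover have "(\<integral>s. f' s * \<kappa> n s \<partial>lebesgue) = integral {y..y + h n} f / h n - integral {x..x + h n} f / h n" for n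
    proof -
      have "(\<integral>s. f' s * \<kappa> n s \<partial>lebesgue) = (\<integral>s. f' s * (ppart (s - x) - ppart (s - (x + h n)) - ppart (s - y) + ppart (s - (y + h n))) \<partial>lebesgue) / h n"
        unfolding \<kappa>_def times_divide_eq_right by (rule integral_divide_zero)
      then show ?thesis
        using weak_deriv1_trapezoid[OF wd xy h(1)[of n]] by (simp add: diff_divide_distrib[symmetric])
    qed
    moreover have "(\<lambda>n. integral {y..y + h n} f / h n - integral {x..x + h n} f / h n) \<longlonglongrightarrow> f y - f x"
      by (rule tendsto_diff[OF filterlim_compose[OF avg[OF y] hr] filterlim_compose[OF avg[OF x] hr]])
    ultimately show ?thesis using LIMSEQ_unique by fastforce
  qed
  moreover have "negligible N" using N by (simp add: negligible_iff_null_sets)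
  ultimately show ?thesis by blast
qed

text \<open>Integrating the second weak derivative twice, from base points outside the exceptional
  sets, yields a C^1 function with Lipschitz derivative that equals u0 almost everywhere. A single K
  bounds both w' and its Lipschitz constant, because w' vanishes somewhere in each period.\<close>

lemma W2inf_periodic_representative:
  assumes per: "\<forall>x. u0 (x + 1) = u0 x" and W: "W2inf UNIV u0"
  obtains w w' K where "AE x in lborel. u0 x = w x" "\<And>x. w (x + 1) = w x"
    "\<And>x. (w has_real_derivative w' x) (at x)" "\<And>x y. \<bar>w' x - w' y\<bar> \<le> K * \<bar>x - y\<bar>" "0 \<le> K"
    "\<And>x. \<bar>w' x\<bar> \<le> K"
proof -
  obtain f f2 where L: "Linf_on UNIV f2" and wd1: "weak_deriv1 UNIV u0 f" and wd2: "weak_deriv1 UNIV f f2"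
    using W by (auto simp: W2inf_def)
  have l2: "f2 integrable_on {a..b}" for a b
    using wd2 by (intro loc_int_on_UNIV_integrable_on) (auto simp: weak_deriv1_def)
  obtain K1 where K1: "AE x in lebesgue. \<bar>f2 x\<bar> \<le> K1" using L by (auto simp: Linf_on_def)
  define K where "K = \<bar>K1\<bar>"
  have K0: "0 \<le> K" by (simp add: K_def)
  obtain Z where Z: "Z \<in> null_sets lebesgue" "\<And>x. x \<notin> Z \<Longrightarrow> \<bar>f2 x\<bar> \<le> K1"
    using K1 by (auto elim!: AE_E3 simp: space_completion)
  have f2_bound: "\<bar>integral {x..y} f2\<bar> \<le> K * (y - x)" if "x \<le> y" for x y
  proof -
    \<comment> \<open>\<open>f2\<close> is bounded only off the null set Z; the value 0 on Z gives a
      pointwise bound without changing the integral.\<close>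
    define g where "g s = (if s \<in> Z then 0 else f2 s)" for s
    have "(f2 has_integral integral {x..y} f2) {x..y}" using l2 by (simp add: integrable_integral)
    then have "(g has_integral integral {x..y} f2) (cbox x y)"
      using Z(1) by - (rule has_integral_spike[where S=Z and f=f2],
        auto simp: g_def negligible_iff_null_sets)
    moreover have "norm (g s) \<le> K" for s using Z(2)[of s] K0 by (auto simp: g_def K_def)
    ultimately have "norm (integral {x..y} f2) \<le> K * measure lborel (cbox x y)"
      using K0 by (intro has_integral_bound[of K g]) auto
    then show ?thesis using that by simp
  qed
  \<comment> \<open>A signed primitive: for either sign of x one of the two intervals is empty or a
    point.\<close>
  define H where "H x = integral {0..x} f2 - integral {x..0} f2" for x
  have Hd: "H y - H x = integral {x..y} f2" if "x \<le> y" for x y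
  proof -
    have c: "integral {a..b} f2 + integral {b..c} f2 = integral {a..c} f2" if "a \<le> b" "b \<le> c" for a b c
      by (rule Henstock_Kurzweil_Integration.integral_combine[OF that l2])
    have e: "integral {a..b} f2 = 0" if "b \<le> a" for a b using that by (cases "a = b") auto
    consider "0 \<le> x" | "x \<le> 0" "0 \<le> y" | "y \<le> 0" by linarith
    then show ?thesis
    proof cases
      case 1 then show ?thesis using c[of 0 x y] that by (simp add: H_def e)
    next
      case 2 then show ?thesis using c[of x 0 y] by (simp add: H_def e)
    next
      case 3 then show ?thesis using c[of x y 0] that by (simp add: H_def e)
    qed
  qed
  have Hlip: "\<bar>H x - H y\<bar> \<le> K * \<bar>x - y\<bar>" for x y
    using Hd[of x y] Hd[of y x] f2_bound[of x y] f2_bound[of y x]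
    by (cases "x \<le> y") (auto simp: abs_minus_commute)
  obtain N1 where N1: "negligible N1"
    "\<And>x y. x \<notin> N1 \<Longrightarrow> y \<notin> N1 \<Longrightarrow> x \<le> y \<Longrightarrow> u0 y - u0 x = integral {x..y} f"
    using weak_deriv1_increment[OF wd1] by blast
  obtain N2 where N2: "negligible N2"
    "\<And>x y. x \<notin> N2 \<Longrightarrow> y \<notin> N2 \<Longrightarrow> x \<le> y \<Longrightarrow> f y - f x = integral {x..y} f2"
    using weak_deriv1_increment[OF wd2] by blast
  \<comment> \<open>The base points \<open>c1\<close> and \<open>c2\<close> are taken outside the
    negligible sets, where the increment formulas hold.\<close>
  have nonneg: "\<exists>c. c \<notin> N" if "negligible N" for N :: "real set"
    using that non_negligible_UNIV by (metis UNIV_eq_I)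
  obtain c2 where c2: "c2 \<notin> N2" using nonneg[OF N2(1)] by blast
  obtain c1 where c1: "c1 \<notin> N1" using nonneg[OF N1(1)] by blast
  define q where "q x = f c2 + H x - H c2" for x
  have qf: "q x = f x" if "x \<notin> N2" for x
    using N2(2)[OF that c2] N2(2)[OF c2 that] Hd[of x c2] Hd[of c2 x]
    by (cases "x \<le> c2") (auto simp: q_def)
  have qlip: "\<bar>q x - q y\<bar> \<le> K * \<bar>x - y\<bar>" for x y using Hlip[of x y] by (simp add: q_def)
  have contq: "continuous_on UNIV q"
    by (rule lipschitz_on_continuous_on[of K]) (use qlip K0 in \<open>auto simp: lipschitz_on_def dist_real_def\<close>)
  then have "isCont q x" for x by (simp add: continuous_on_eq_continuous_at)
  then obtain W where W: "\<And>x. (W has_real_derivative q x) (at x)"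
    using einterval_antiderivative[of "-\<infinity>" "\<infinity>" q]
    by (auto simp: has_real_derivative_iff_has_vector_derivative)
  have Wint: "integral {x..y} q = W y - W x" if "x \<le> y" for x y
    by (rule integral_unique, rule fundamental_theorem_of_calculus[OF that])
      (use W in \<open>auto simp: has_real_derivative_iff_has_vector_derivative[symmetric] intro: has_field_derivative_at_within\<close>)
  have fq: "integral {x..y} f = integral {x..y} q" for x y
    by (rule integral_spike[OF N2(1)]) (use qf in auto)
  define w where "w x = u0 c1 + W x - W c1" for x
  have wu: "w x = u0 x" if "x \<notin> N1" for x
    using N1(2)[OF that c1] N1(2)[OF c1 that] Wint[of x c1] Wint[of c1 x] fq
    by (cases "x \<le> c1") (auto simp: w_def)
  have ae: "AE x in lborel. u0 x = w x"
    using negligible_AE_lborel[OF N1(1)] by eventually_elim (simp add: wu)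
  have dw: "(w has_real_derivative q x) (at x)" for x
    unfolding w_def[abs_def] using W by (auto intro!: derivative_eq_intros)
  have contw: "continuous_on UNIV w" using dw by (intro continuous_at_imp_continuous_on ballI DERIV_isCont)
  have perw: "w (x + 1) = w x" for x
  proof -
    define D where "D x = w (x + 1) - w x" for x
    have "continuous_on UNIV (\<lambda>x. w (x + 1))"
      by (rule continuous_on_compose2[OF contw]) (auto intro!: continuous_intros)
    then have contD: "continuous_on UNIV D"
      unfolding D_def[abs_def] by (rule continuous_on_diff[OF _ contw])
    \<comment> \<open>Off this set both x and x + 1 avoid \<open>N1\<close>, so w inherits the
      periodicity of u0 there. Continuity of D extends it everywhere, since a nonempty open set is
      not negligible.\<close>
    define N where "N = N1 \<union> (\<lambda>x. - 1 + x) ` N1"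
    have N: "negligible N"
      unfolding N_def using N1(1) negligible_translation[OF N1(1), of "- 1"] by (intro negligible_Un)
    have D0: "D x = 0" if "x \<notin> N" for x
    proof -
      have "x \<notin> N1" "x + 1 \<notin> N1" using that by (auto simp: N_def image_iff)
      then show ?thesis using wu[of x] wu[of "x + 1"] per by (simp add: D_def)
    qed
    have "D x = 0"
    proof (rule ccontr)
      assume "D x \<noteq> 0"
      have "open (D -` (- {0}))" using contD by (intro open_vimage) auto
      moreover have "D -` (- {0}) \<subseteq> N" using D0 by auto
      ultimately have "D -` (- {0}) = {}"
        using negligible_subset[OF N, of "D -` (- {0})"] open_not_negligible[of "D -` (- {0})"] by blast
      with \<open>D x \<noteq> 0\<close> show False by auto
    qed
    then show ?thesis by (simp add: D_def)
  qed
  have qK: "\<bar>q x\<bar> \<le> K" for x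
  proof -
    \<comment> \<open>Rolle: periodicity forces a zero of q in (x, x + 1), at distance less than 1
      from x.\<close>
    obtain z where z: "x < z" "z < x + 1" "w (x + 1) - w x = (x + 1 - x) * q z"
      using MVT2[of x "x + 1" w q] dw by auto
    then have "q z = 0" using perw[of x] by simp
    then have "\<bar>q x\<bar> \<le> K * \<bar>x - z\<bar>" using qlip[of x z] by simp
    also have "\<dots> \<le> K * 1" using z K0 by (intro mult_left_mono) auto
    finally show ?thesis by simp
  qed
  show ?thesis by (rule that[OF ae perw dw qlip K0 qK])
qed

section \<open>The explicit scheme\<close>

text \<open>The scheme sees \<open>A\<close> and \<open>G\<close> only through increments, so
  ellipticity and the Lipschitz bounds are stated for increments. \<open>a\<close> is the
  ellipticity constant; the time step is adjusted to the upper slope 1 of \<open>A\<close>.\<close>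

locale nonlinearity =
  fixes A G :: "real \<Rightarrow> real" and a B :: real
  assumes a_pos: "0 < a" and a_le: "a \<le> 1"
    and A_lower: "\<And>p q. q \<le> p \<Longrightarrow> a * (p - q) \<le> A p - A q"
    and A_upper: "\<And>p q. q \<le> p \<Longrightarrow> A p - A q \<le> p - q"
    and G_lip: "\<And>p q. \<bar>G p - G q\<bar> \<le> \<bar>p - q\<bar>"
    and G_bound: "\<And>p. \<bar>G p\<bar> \<le> B"
begin

lemma B_nonneg: "0 \<le> B" using G_bound[of 0] by linarith

text \<open>A mean value theorem for increments: \<alpha> stands for the derivative of
  \<open>A\<close> at an intermediate point and makes the linearisation of the scheme exact. For p =
  q any value in [a, 1] would do, and a is taken.\<close>

lemma A_quotient: obtains \<alpha> where "a \<le> \<alpha>" "\<alpha> \<le> 1" "A p - A q = \<alpha> * (p - q)"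
proof (cases "p = q")
  case True then show ?thesis using that[of a] a_le by simp
next
  case False
  have "a \<le> (A p - A q) / (p - q) \<and> (A p - A q) / (p - q) \<le> 1"
  proof (cases "q < p")
    case True
    then show ?thesis using A_lower[of q p] A_upper[of q p] by (simp add: field_simps)
  next
    case F: False
    then have "p < q" using False by simp
    then have "a \<le> (A q - A p) / (q - p) \<and> (A q - A p) / (q - p) \<le> 1"
      using A_lower[of p q] A_upper[of p q] by (simp add: field_simps)
    moreover have "(A q - A p) / (q - p) = (A p - A q) / (p - q)"
      using \<open>p < q\<close> by (simp add: field_simps)
    ultimately show ?thesis by simp
  qed
  then show ?thesis using that[of "(A p - A q) / (p - q)"] False by simp
qed

lemma A_upper_abs: "\<bar>A p - A q\<bar> \<le> \<bar>p - q\<bar>"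
proof -
  obtain \<alpha> where "a \<le> \<alpha>" "\<alpha> \<le> 1" "A p - A q = \<alpha> * (p - q)" by (rule A_quotient)
  then show ?thesis using a_pos by (auto simp: abs_mult mult_left_le_one_le)
qed

lemma A_lower_abs: "a * \<bar>p - q\<bar> \<le> \<bar>A p - A q\<bar>"
proof -
  obtain \<alpha> where "a \<le> \<alpha>" "\<alpha> \<le> 1" "A p - A q = \<alpha> * (p - q)" by (rule A_quotient)
  then show ?thesis using a_pos by (auto simp: abs_mult intro!: mult_right_mono)
qed

lemma G_quotient: obtains \<beta> where "\<bar>\<beta>\<bar> \<le> 1" "G p - G q = \<beta> * (p - q)"
proof (cases "p = q")
  case True then show ?thesis using that[of 0] by simp
next
  case False
  then show ?thesis using that[of "(G p - G q) / (p - q)"] G_lip[of p q] by (simp add: abs_divide)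
qed

lemma continuous_A: "continuous_on UNIV A"
  by (rule lipschitz_on_continuous_on[of 1]) (use A_upper_abs in \<open>auto simp: lipschitz_on_def dist_real_def\<close>)

lemma continuous_G: "continuous_on UNIV G"
  by (rule lipschitz_on_continuous_on[of 1]) (use G_lip in \<open>auto simp: lipschitz_on_def dist_real_def\<close>)

end

text \<open>Explicit Euler scheme on the grid of spacing \<open>1 / N\<close>; the time step \<open>1 / (4 N\<^sup>2)\<close> makes
  it monotone as soon as \<open>M \<le> a N\<close>.\<close>
locale explicit_scheme = nonlinearity +
  fixes N :: nat and \<gamma> w :: "int \<Rightarrow> real" and M K0 :: real
  assumes N_pos: "0 < N" and N_large: "M \<le> a * real N"
    and gamma_bound: "\<And>i. \<bar>\<gamma> i\<bar> \<le> M"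
    and w_second: "\<And>i. real N * \<bar>real N * (w (i + 1) - w i) - real N * (w i - w (i - 1))\<bar> \<le> K0"
    and w_per: "\<And>i. w (i + int N) = w i" and gamma_per: "\<And>i. \<gamma> (i + int N) = \<gamma> i"
begin

text \<open>The space part is in divergence form, a difference of the fluxes \<open>A\<close> at
  neighbouring slopes, so that it can later be summed by parts exactly.\<close>

primrec U :: "nat \<Rightarrow> int \<Rightarrow> real" where
  "U 0 = w"
| "U (Suc n) = (\<lambda>i. U n i + 1 / (4 * (real N)\<^sup>2) *
      (real N * (A (real N * (U n (i + 1) - U n i)) - A (real N * (U n i - U n (i - 1))))
       + \<gamma> i * G (real N * (U n (i + 1) - U n i))))"

definition slope :: "nat \<Rightarrow> int \<Rightarrow> real" where "slope n i = real N * (U n (i + 1) - U n i)"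

definition velocity :: "nat \<Rightarrow> int \<Rightarrow> real" where
  "velocity n i = real N * (A (slope n i) - A (slope n (i - 1))) + \<gamma> i * G (slope n i)"

text \<open>The size of the initial velocity: \<open>K0\<close> comes from the second differences of
  the datum, since \<open>A\<close> does not enlarge increments, and M * B from the source.
  \<open>K\<close> results from solving the equation for the second difference and dividing by the
  ellipticity constant. Neither involves the mesh.\<close>

definition C :: real where "C = K0 + M * B"
definition K :: real where "K = (C + M * B) / a"

lemma U_Suc: "U (Suc n) i = U n i + velocity n i / (4 * (real N)\<^sup>2)"
  by (simp add: velocity_def slope_def)

lemma U_periodic: "U n (i + int N) = U n i"
proof (induction n arbitrary: i)
  case (Suc n)
  have "U n (i + int N + 1) = U n (i + 1)" "U n (i + int N - 1) = U n (i - 1)"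
    using Suc[of "i + 1"] Suc[of "i - 1"] by (simp_all add: algebra_simps)
  then show ?case by (simp add: Suc gamma_per)
qed (simp add: w_per)

lemma M_nonneg: "0 \<le> M" using gamma_bound[of 0] by linarith

lemma source_bound: "\<bar>\<gamma> i * G p\<bar> \<le> M * B"
  using mult_mono[OF gamma_bound[of i] G_bound[of p] M_nonneg] by (simp add: abs_mult)

text \<open>Subtract two consecutive time levels. The coefficients \<gamma> do not change with n, so
  only increments of \<open>A\<close> and \<open>G\<close> appear; their quotients \<alpha>,
  \<alpha>' and \<beta> reduce them to slope increments, that is to velocity differences divided by
  4 N. The source contributes \<gamma> i * \<beta> / N, which has no sign; the condition M \<le> a *
  N bounds it by a \<le> \<alpha> and gives c1 \<ge> 0. The factor 4 in the time step keeps c1 and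
  c2 at most 1/2 each.\<close>

lemma velocity_Suc:
  obtains c1 c2 where "0 \<le> c1" "0 \<le> c2" "c1 + c2 \<le> 1"
    "velocity (Suc n) i = (1 - c1 - c2) * velocity n i + c1 * velocity n (i + 1) + c2 * velocity n (i - 1)"
proof -
  let ?N = "real N"
  have N0: "?N > 0" using N_pos by simp
  have ps: "slope (Suc n) j - slope n j = (velocity n (j + 1) - velocity n j) / (4 * ?N)" for j
    using N0 by (simp add: slope_def U_Suc del: U.simps) (simp add: field_simps power2_eq_square)
  obtain \<alpha> where al: "a \<le> \<alpha>" "\<alpha> \<le> 1" "A (slope (Suc n) i) - A (slope n i) = \<alpha> * (slope (Suc n) i - slope n i)"
    by (rule A_quotient)
  obtain \<alpha>' where al': "a \<le> \<alpha>'" "\<alpha>' \<le> 1"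
    "A (slope (Suc n) (i - 1)) - A (slope n (i - 1)) = \<alpha>' * (slope (Suc n) (i - 1) - slope n (i - 1))"
    by (rule A_quotient)
  obtain \<beta> where be: "\<bar>\<beta>\<bar> \<le> 1" "G (slope (Suc n) i) - G (slope n i) = \<beta> * (slope (Suc n) i - slope n i)"
    by (rule G_quotient)
  define c1 where "c1 = (\<alpha> + \<gamma> i * \<beta> / ?N) / 4"
  define c2 where "c2 = \<alpha>' / 4"
  have "\<bar>\<gamma> i * \<beta>\<bar> \<le> M * 1"
    unfolding abs_mult by (rule mult_mono) (use gamma_bound be M_nonneg in auto)
  then have "\<bar>\<gamma> i * \<beta>\<bar> \<le> a * ?N" using N_large by linarith
  then have gb: "\<bar>\<gamma> i * \<beta> / ?N\<bar> \<le> a" using N0 by (simp add: abs_divide divide_le_eq)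
  have "0 \<le> \<alpha> + \<gamma> i * \<beta> / ?N" "\<alpha> + \<gamma> i * \<beta> / ?N \<le> 2"
    using gb al(1,2) a_le unfolding abs_le_iff by linarith+
  moreover have "4 * c1 = \<alpha> + \<gamma> i * \<beta> / ?N" by (simp add: c1_def)
  ultimately have "0 \<le> c1" "c1 \<le> 1 / 2" by linarith+
  moreover have "0 \<le> c2" "c2 \<le> 1 / 2" using al' a_pos unfolding c2_def by linarith+
  moreover have "velocity (Suc n) i = (1 - c1 - c2) * velocity n i + c1 * velocity n (i + 1) + c2 * velocity n (i - 1)"
  proof -
    have "velocity (Suc n) i - velocity n i =
      ?N * ((A (slope (Suc n) i) - A (slope n i)) - (A (slope (Suc n) (i - 1)) - A (slope n (i - 1))))
      + \<gamma> i * (G (slope (Suc n) i) - G (slope n i))"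
      by (simp add: velocity_def algebra_simps)
    also have "\<dots> = ?N * (\<alpha> * ((velocity n (i + 1) - velocity n i) / (4 * ?N))
         - \<alpha>' * ((velocity n i - velocity n (i - 1)) / (4 * ?N)))
      + \<gamma> i * (\<beta> * ((velocity n (i + 1) - velocity n i) / (4 * ?N)))"
      unfolding al al' be ps by simp
    also have "\<dots> = c1 * (velocity n (i + 1) - velocity n i) - c2 * (velocity n i - velocity n (i - 1))"
      using N0 by (simp add: c1_def c2_def field_simps)
    finally show ?thesis by (simp add: algebra_simps)
  qed
  ultimately show ?thesis using that[of c1 c2] by simp
qed

text \<open>Discrete maximum principle: a new velocity is a convex combination of three old ones.
  The second-difference bound on the datum pays for the first level.\<close>

lemma velocity_bound: "\<bar>velocity n i\<bar> \<le> C"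
proof (induction n arbitrary: i)
  case 0
  have "\<bar>real N * (A (slope 0 i) - A (slope 0 (i - 1)))\<bar> \<le> real N * \<bar>slope 0 i - slope 0 (i - 1)\<bar>"
    using A_upper_abs by (simp add: abs_mult mult_left_mono)
  also have "\<dots> \<le> K0" using w_second[of i] by (simp add: slope_def)
  finally show ?case
    using source_bound[of i "slope 0 i"] unfolding velocity_def C_def by linarith
next
  case (Suc n)
  obtain c1 c2 where c: "0 \<le> c1" "0 \<le> c2" "c1 + c2 \<le> 1" and
    eq: "velocity (Suc n) i = (1 - c1 - c2) * velocity n i + c1 * velocity n (i + 1) + c2 * velocity n (i - 1)"
    by (rule velocity_Suc)
  have "\<bar>velocity (Suc n) i\<bar> \<le> (1 - c1 - c2) * \<bar>velocity n i\<bar> + c1 * \<bar>velocity n (i + 1)\<bar> + c2 * \<bar>velocity n (i - 1)\<bar>"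
    unfolding eq using c by (intro order_trans[OF abs_triangle_ineq] add_mono) (auto simp: abs_mult)
  also have "\<dots> \<le> (1 - c1 - c2) * C + c1 * C + c2 * C"
    using c Suc.IH by (intro add_mono mult_left_mono) auto
  finally show ?case by (simp add: algebra_simps)
qed

lemma C_nonneg: "0 \<le> C" using velocity_bound[of 0 0] by linarith

lemma K_nonneg: "0 \<le> K"
  using C_nonneg M_nonneg B_nonneg a_pos by (simp add: K_def)

lemma U_time_lipschitz: "\<bar>U (n + m) i - U n i\<bar> \<le> C * (real m / (4 * (real N)\<^sup>2))"
proof (induction m)
  case (Suc m)
  have "\<bar>U (n + Suc m) i - U (n + m) i\<bar> \<le> C / (4 * (real N)\<^sup>2)"
    using velocity_bound[of "n + m" i] by (simp add: U_Suc abs_divide divide_right_mono del: U.simps)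
  with Suc have "\<bar>U (n + Suc m) i - U n i\<bar> \<le> C * (real m / (4 * (real N)\<^sup>2)) + C / (4 * (real N)\<^sup>2)"
    by linarith
  then show ?case by (simp add: algebra_simps add_divide_distrib)
qed simp

text \<open>The flux difference equals velocity minus source, both bounded independently of the
  mesh. Ellipticity converts it into a slope difference, so second differences are controlled
  without differencing \<gamma>.\<close>

lemma slope_step: "\<bar>slope n i - slope n (i - 1)\<bar> \<le> K / real N"
proof -
  have N0: "real N > 0" using N_pos by simp
  have "real N * (A (slope n i) - A (slope n (i - 1))) = velocity n i - \<gamma> i * G (slope n i)"
    by (simp add: velocity_def)
  then have "\<bar>real N * (A (slope n i) - A (slope n (i - 1)))\<bar> \<le> C + M * B"
    using velocity_bound[of n i] source_bound[of i "slope n i"] by linarith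
  then have "real N * \<bar>A (slope n i) - A (slope n (i - 1))\<bar> \<le> C + M * B"
    by (simp add: abs_mult)
  moreover have "real N * (a * \<bar>slope n i - slope n (i - 1)\<bar>) \<le> real N * \<bar>A (slope n i) - A (slope n (i - 1))\<bar>"
    using A_lower_abs by (intro mult_left_mono) auto
  ultimately have "real N * (a * \<bar>slope n i - slope n (i - 1)\<bar>) \<le> C + M * B" by linarith
  then show ?thesis using N0 a_pos by (simp add: K_def field_simps)
qed

lemma slope_lipschitz: "\<bar>slope n (i + int j) - slope n i\<bar> \<le> K * (real j / real N)"
proof (induction j)
  case (Suc j)
  have "i + int (Suc j) - 1 = i + int j" by simp
  then have "\<bar>slope n (i + int (Suc j)) - slope n (i + int j)\<bar> \<le> K / real N"
    using slope_step[of n "i + int (Suc j)"] by metis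
  with Suc have "\<bar>slope n (i + int (Suc j)) - slope n i\<bar> \<le> K * (real j / real N) + K / real N" by linarith
  then show ?case by (simp add: algebra_simps add_divide_distrib)
qed simp

text \<open>One more grid step adds the drift of the slope over j steps divided by N; the quadratic
  bound closes because j^2 + j \<le> (j + 1)^2.\<close>

lemma U_taylor: "\<bar>U n (i + int j) - U n i - real j / real N * slope n i\<bar> \<le> K * (real j / real N)\<^sup>2"
proof (induction j)
  case (Suc j)
  have N0: "real N > 0" using N_pos by simp
  have "U n (i + int (Suc j)) - U n (i + int j) = slope n (i + int j) / real N"
    using N0 by (simp add: slope_def ac_simps)
  then have eq: "U n (i + int (Suc j)) - U n i - real (Suc j) / real N * slope n i
    = (U n (i + int j) - U n i - real j / real N * slope n i) + (slope n (i + int j) - slope n i) / real N"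
    using N0 by (simp add: field_simps)
  have "\<bar>(slope n (i + int j) - slope n i) / real N\<bar> \<le> K * (real j / real N) / real N"
    using slope_lipschitz[of n i j] N0 by (simp only: abs_divide abs_of_nat) (rule divide_right_mono, auto)
  then have "\<bar>U n (i + int (Suc j)) - U n i - real (Suc j) / real N * slope n i\<bar>
     \<le> K * (real j / real N)\<^sup>2 + K * (real j / real N) / real N"
    unfolding eq using Suc by linarith
  also have "\<dots> = K * ((real j)\<^sup>2 + real j) / (real N)\<^sup>2"
    using N0 by (simp add: field_simps power2_eq_square)
  also have "\<dots> \<le> K * (real (Suc j))\<^sup>2 / (real N)\<^sup>2"
    using K_nonneg by (intro divide_right_mono mult_left_mono) (auto simp: power2_eq_square algebra_simps)
  finally show ?case by (simp add: power_divide)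
qed simp

text \<open>Over a full period, j = N, the increment of U vanishes and the Taylor estimate leaves
  just the slope: a discrete Rolle argument.\<close>

lemma slope_bound: "\<bar>slope n i\<bar> \<le> K"
  using U_taylor[of n i N] U_periodic[of n i] N_pos by simp

lemma U_space_lipschitz: "\<bar>U n (i + int j) - U n i\<bar> \<le> K * (real j / real N)"
proof (induction j)
  case (Suc j)
  have "U n (i + int (Suc j)) - U n (i + int j) = slope n (i + int j) / real N"
    using N_pos by (simp add: slope_def ac_simps)
  moreover have "\<bar>slope n (i + int j) / real N\<bar> \<le> K / real N"
    using slope_bound by (simp only: abs_divide abs_of_nat) (rule divide_right_mono, auto)
  ultimately have "\<bar>U n (i + int (Suc j)) - U n i\<bar> \<le> K * (real j / real N) + K / real N"
    using Suc by linarith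
  then show ?case by (simp add: algebra_simps add_divide_distrib)
qed simp

end

section \<open>Compactness of the scheme\<close>

text \<open>The comparison sequence c may depend on e. It will consist of values at a nearby
  rational point, or of difference quotients of fixed width.\<close>

lemma convergent_if_approx:
  fixes s :: "nat \<Rightarrow> real"
  assumes "\<And>e. e > 0 \<Longrightarrow> \<exists>c. convergent c \<and> (\<forall>\<^sub>F k in sequentially. \<bar>s k - c k\<bar> \<le> e)"
  shows "convergent s"
proof -
  have "Cauchy s"
  proof (rule metric_CauchyI)
    fix e :: real assume "e > 0"
    then obtain c where c: "convergent c" "\<forall>\<^sub>F k in sequentially. \<bar>s k - c k\<bar> \<le> e / 4"
      using assms[of "e / 4"] by auto
    obtain k0 where k0: "\<And>k. k \<ge> k0 \<Longrightarrow> \<bar>s k - c k\<bar> \<le> e / 4"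
      using c(2) by (auto simp: eventually_sequentially)
    obtain k1 where k1: "\<And>m n. m \<ge> k1 \<Longrightarrow> n \<ge> k1 \<Longrightarrow> dist (c m) (c n) < e / 4"
      using metric_CauchyD[OF convergent_Cauchy[OF c(1)], of "e / 4"] \<open>e > 0\<close> by auto
    show "\<exists>M. \<forall>m\<ge>M. \<forall>n\<ge>M. dist (s m) (s n) < e"
    proof (intro exI allI impI)
      fix m n assume "max k0 k1 \<le> m" "max k0 k1 \<le> n"
      then show "dist (s m) (s n) < e"
        using k0[of m] k0[of n] k1[of m n] \<open>e > 0\<close> unfolding dist_real_def max.bounded_iff by linarith
    qed
  qed
  then show ?thesis by (simp add: Cauchy_convergent_iff)
qed

lemma floor_diff_le: "\<bar>real_of_int \<lfloor>x\<rfloor> - real_of_int \<lfloor>y\<rfloor>\<bar> \<le> \<bar>x - y\<bar> + 1"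
  by linarith

lemma nat_floor_diff_le: "\<bar>real (nat \<lfloor>x\<rfloor>) - real (nat \<lfloor>y\<rfloor>)\<bar> \<le> \<bar>x - y\<bar> + 1"
  by linarith

lemma grid_steps_tendsto_0:
  assumes "strict_mono r"
  shows "(\<lambda>k. 1 / real (r k)) \<longlonglongrightarrow> 0" "(\<lambda>k. 1 / (4 * (real (r k))\<^sup>2)) \<longlonglongrightarrow> 0"
proof -
  show h0: "(\<lambda>k. 1 / real (r k)) \<longlonglongrightarrow> 0"
    using filterlim_compose[OF lim_1_over_n filterlim_subseq[OF assms]] by simp
  show "(\<lambda>k. 1 / (4 * (real (r k))\<^sup>2)) \<longlonglongrightarrow> 0"
    using tendsto_mult_right[OF tendsto_power[OF h0, of 2], of "1/4"] by (simp add: power_divide mult.commute)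
qed

section \<open>Step functions obtained from the scheme\<close>

locale scheme_limit = nonlinearity +
  fixes w w' g :: "real \<Rightarrow> real" and M K0 :: real
  assumes w_per: "\<And>x. w (x + 1) = w x"
    and w_deriv: "\<And>x. (w has_real_derivative w' x) (at x)"
    and w'_lip: "\<And>x y. \<bar>w' x - w' y\<bar> \<le> K0 * \<bar>x - y\<bar>"
    and g_meas [measurable]: "g \<in> borel_measurable borel"
    and g_bound: "\<And>x. \<bar>g x\<bar> \<le> M"
    and g_per: "\<And>x. g (x + 1) = g x"
begin

text \<open>The averaging length \<open>N\<^bsup>-1/2\<^esup>\<close> is large compared with the grid spacing \<open>1 / N\<close>, so that the
  averages at grid points still converge to \<open>g\<close> almost everywhere.\<close>
definition g_avg :: "nat \<Rightarrow> real \<Rightarrow> real" where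
  "g_avg N x = sqrt (real N) * integral {x..x + 1 / sqrt (real N)} g"

abbreviation gN :: "nat \<Rightarrow> int \<Rightarrow> real" where "gN N \<equiv> \<lambda>i. g_avg N (real_of_int i / real N)"
abbreviation wN :: "nat \<Rightarrow> int \<Rightarrow> real" where "wN N \<equiv> \<lambda>i. w (real_of_int i / real N)"

definition grid :: "nat \<Rightarrow> nat \<Rightarrow> int \<Rightarrow> real" where
  "grid N = explicit_scheme.U A G N (gN N) (wN N)"

text \<open>A step function on the whole plane. For t < 0 the cast \<open>nat\<close> selects level
  0, so the datum extends backwards in time and shifts in t stay meaningful.\<close>

definition uN :: "nat \<Rightarrow> real \<Rightarrow> real \<Rightarrow> real" where
  "uN N x t = grid N (nat \<lfloor>4 * (real N)\<^sup>2 * t\<rfloor>) \<lfloor>real N * x\<rfloor>"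

definition pN :: "nat \<Rightarrow> real \<Rightarrow> real \<Rightarrow> real" where
  "pN N x t = real N * (uN N (x + 1 / real N) t - uN N x t)"

text \<open>\<open>CC\<close> and \<open>KK\<close> are the scheme constants C and K for a datum
  with second differences bounded by 2 * K0. They become the Lipschitz constants of the limit in t
  and of its slope in x.\<close>

definition CC :: real where "CC = 2 * K0 + M * B"
definition KK :: real where "KK = (CC + M * B) / a"
definition good :: "nat \<Rightarrow> bool" where "good N \<longleftrightarrow> 0 < N \<and> M \<le> a * real N"

lemma g_integrable: "g integrable_on {c..d}"
proof -
  have "set_integrable lborel {c..d} g"
    unfolding set_integrable_def
    by (rule integrable_bounded_support[where r="\<bar>c\<bar> + \<bar>d\<bar>" and B=M])
      (use g_bound in \<open>auto simp: indicator_def intro: order_trans[OF abs_ge_zero]\<close>)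
  then show ?thesis by (simp add: set_borel_integral_eq_integral)
qed

lemma M_nonneg: "0 \<le> M" using g_bound[of 0] by linarith

lemma integral_g_bound: "\<bar>integral {x..y} g\<bar> \<le> M * \<bar>y - x\<bar>"
proof (cases "x \<le> y")
  case True
  have "(g has_integral integral {x..y} g) (cbox x y)" using g_integrable by (simp add: integrable_integral)
  then have "norm (integral {x..y} g) \<le> M * measure lborel (cbox x y)"
    using M_nonneg g_bound by (intro has_integral_bound[of M g]) auto
  then show ?thesis using True by simp
qed (simp add: M_nonneg)

lemma g_avg_bound: assumes "0 < N" shows "\<bar>g_avg N x\<bar> \<le> M"
proof -
  have s: "sqrt (real N) > 0" using assms by simp
  have "sqrt (real N) * \<bar>integral {x..x + 1 / sqrt (real N)} g\<bar> \<le> sqrt (real N) * (M * (1 / sqrt (real N)))"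
    using integral_g_bound[of x "x + 1 / sqrt (real N)"] s by (intro mult_left_mono) auto
  then show ?thesis using s by (simp add: g_avg_def abs_mult)
qed

lemma integral_g_shift: "integral {x + 1..y + 1} g = integral {x..y} g"
proof -
  have "(g has_integral integral {x + 1..y + 1} g) (cbox (x + 1) (y + 1))"
    using g_integrable by (simp add: integrable_integral)
  then have "((\<lambda>z. g (z + 1)) has_integral integral {x + 1..y + 1} g) (cbox x y)"
    using has_integral_affinity'[of g "integral {x + 1..y + 1} g" "x + 1" "y + 1" 1 1] by simp
  then show ?thesis by (simp add: g_per integral_unique)
qed

lemma g_avg_per: "g_avg N (x + 1) = g_avg N x"
  using integral_g_shift[of x "x + 1 / sqrt (real N)"] by (simp add: g_avg_def ac_simps)

lemma K0_nonneg: "0 \<le> K0" using w'_lip[of 0 1] by simp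

text \<open>Two neighbouring difference quotients of w are values of w' at points less than 2 / N
  apart; this is the origin of the factor in 2 * K0.\<close>

lemma scheme: assumes "good N"
  shows "explicit_scheme A G a B N (gN N) (wN N) M (2 * K0)"
proof
  have N: "0 < N" "0 < real N" using assms by (auto simp: good_def)
  show "0 < N" "M \<le> a * real N" using assms by (auto simp: good_def)
  show "\<bar>g_avg N (real_of_int i / real N)\<bar> \<le> M" for i by (rule g_avg_bound[OF N(1)])
  have sh: "real_of_int (i + int N) / real N = real_of_int i / real N + 1" for i
    using N by (simp add: add_divide_distrib)
  show "w (real_of_int (i + int N) / real N) = w (real_of_int i / real N)" for i
    unfolding sh by (rule w_per)
  show "g_avg N (real_of_int (i + int N) / real N) = g_avg N (real_of_int i / real N)" for i
    unfolding sh by (rule g_avg_per)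
  fix i :: int
  define h where "h = 1 / real N"
  define x where "x = real_of_int i / real N"
  have h: "h > 0" using N by (simp add: h_def)
  have x: "real_of_int (i + 1) / real N = x + h" "real_of_int (i - 1) / real N = x - h"
    by (simp_all add: x_def h_def add_divide_distrib diff_divide_distrib)
  obtain z1 where z1: "x < z1" "z1 < x + h" "w (x + h) - w x = (x + h - x) * w' z1"
    using MVT2[of x "x + h" w w'] h w_deriv by auto
  obtain z2 where z2: "x - h < z2" "z2 < x" "w x - w (x - h) = (x - (x - h)) * w' z2"
    using MVT2[of "x - h" x w w'] h w_deriv by auto
  have "real N * \<bar>real N * (w (x + h) - w x) - real N * (w x - w (x - h))\<bar> = real N * \<bar>w' z1 - w' z2\<bar>"
    using z1(3) z2(3) N by (simp add: h_def)
  also have "\<dots> \<le> real N * (K0 * \<bar>z1 - z2\<bar>)" using w'_lip by (intro mult_left_mono) auto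
  also have "\<dots> \<le> real N * (K0 * (2 * h))" using z1 z2 K0_nonneg by (intro mult_left_mono) auto
  also have "\<dots> = 2 * K0" using N by (simp add: h_def)
  finally show "real N * \<bar>real N * (w (real_of_int (i + 1) / real N) - w (real_of_int i / real N))
      - real N * (w (real_of_int i / real N) - w (real_of_int (i - 1) / real N))\<bar> \<le> 2 * K0"
    unfolding x x_def[symmetric] .
qed

lemma good_pos: "good N \<Longrightarrow> 0 < N" "good N \<Longrightarrow> 0 < real N" by (auto simp: good_def)

lemma good_steps: assumes "good N"
  shows "0 < 1 / real N" "1 / real N \<le> 1" "0 < 1 / (4 * (real N)\<^sup>2)" "1 / (4 * (real N)\<^sup>2) \<le> 1"
proof -
  have N: "1 \<le> real N" using good_pos(1)[OF assms] by linarith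
  then have "1 \<le> (real N)\<^sup>2" by (rule one_le_power)
  then have "1 \<le> 4 * (real N)\<^sup>2" by linarith
  with N show "0 < 1 / real N" "1 / real N \<le> 1" "0 < 1 / (4 * (real N)\<^sup>2)" "1 / (4 * (real N)\<^sup>2) \<le> 1"
    by (auto simp: divide_le_eq_1)
qed

lemma scheme_C: "good N \<Longrightarrow> explicit_scheme.C B M (2 * K0) = CC"
  by (simp add: explicit_scheme.C_def[OF scheme] CC_def)

lemma scheme_K: "good N \<Longrightarrow> explicit_scheme.K a B M (2 * K0) = KK"
  by (simp add: explicit_scheme.K_def[OF scheme] KK_def scheme_C)

lemma pN_slope: assumes "good N"
  shows "pN N x t = explicit_scheme.slope A G N (gN N) (wN N)
    (nat \<lfloor>4 * (real N)\<^sup>2 * t\<rfloor>) \<lfloor>real N * x\<rfloor>"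
proof -
  have "real N * (x + 1 / real N) = real N * x + 1" using good_pos[OF assms] by (simp add: field_simps)
  then have "\<lfloor>real N * (x + 1 / real N)\<rfloor> = \<lfloor>real N * x\<rfloor> + 1" by linarith
  then show ?thesis by (simp add: pN_def uN_def explicit_scheme.slope_def[OF scheme[OF assms]] grid_def)
qed

lemma KK_nonneg: "0 \<le> KK" and CC_nonneg: "0 \<le> CC"
  using M_nonneg B_nonneg K0_nonneg a_pos by (auto simp: KK_def CC_def)

lemma uN_per: assumes "good N" shows "uN N (x + 1) t = uN N x t"
proof -
  have "real N * (x + 1) = real N * x + real_of_int (int N)" by (simp add: algebra_simps)
  then have "\<lfloor>real N * (x + 1)\<rfloor> = \<lfloor>real N * x\<rfloor> + int N" by linarith
  then show ?thesis
    using explicit_scheme.U_periodic[OF scheme[OF assms]] by (simp add: uN_def grid_def)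
qed

lemma pN_per: assumes "good N" shows "pN N (x + 1) t = pN N x t"
  using uN_per[OF assms, of x t] uN_per[OF assms, of "x + 1 / real N" t] by (simp add: pN_def ac_simps)

lemma pN_bound: assumes "good N" shows "\<bar>pN N x t\<bar> \<le> KK"
  using explicit_scheme.slope_bound[OF scheme[OF assms]] scheme_K[OF assms] by (simp add: pN_slope[OF assms])

text \<open>Rounding to the grid displaces a point by less than one cell, so the step functions are
  Lipschitz up to an additive defect of mesh size, which vanishes in the limit.\<close>

lemma floor_mult_diff_le:
  assumes "good N" shows "\<bar>real_of_int \<lfloor>real N * x\<rfloor> - real_of_int \<lfloor>real N * y\<rfloor>\<bar> / real N \<le> \<bar>x - y\<bar> + 1 / real N"
proof -
  have N: "real N > 0" using good_pos[OF assms] by simp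
  have "\<bar>real_of_int \<lfloor>real N * x\<rfloor> - real_of_int \<lfloor>real N * y\<rfloor>\<bar> / real N \<le> (\<bar>real N * x - real N * y\<bar> + 1) / real N"
    using N by (intro divide_right_mono floor_diff_le) auto
  also have "\<dots> = \<bar>x - y\<bar> + 1 / real N"
    using N by (simp add: right_diff_distrib[symmetric] abs_mult add_divide_distrib)
  finally show ?thesis .
qed

lemma pN_lipschitz: assumes "good N" shows "\<bar>pN N x t - pN N y t\<bar> \<le> KK * (\<bar>x - y\<bar> + 1 / real N)"
proof -
  interpret S: explicit_scheme A G a B N "gN N" "wN N" M "2 * K0"
    by (rule scheme[OF assms])
  have *: "\<bar>S.slope n i - S.slope n j\<bar> \<le> KK * (\<bar>real_of_int i - real_of_int j\<bar> / real N)" for n i j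
    using S.slope_lipschitz[of n j "nat (i - j)"] S.slope_lipschitz[of n i "nat (j - i)"] scheme_K[OF assms]
    by (cases "j \<le> i") (auto simp: abs_minus_commute)
  show ?thesis unfolding pN_slope[OF assms]
    by (rule order_trans[OF * mult_left_mono[OF floor_mult_diff_le[OF assms] KK_nonneg]])
qed

lemma uN_lipschitz: assumes "good N"
  shows "\<bar>uN N x t - uN N y s\<bar> \<le> KK * (\<bar>x - y\<bar> + 1 / real N) + CC * (\<bar>t - s\<bar> + 1 / (4 * (real N)\<^sup>2))"
proof -
  interpret S: explicit_scheme A G a B N "gN N" "wN N" M "2 * K0"
    by (rule scheme[OF assms])
  have N: "0 < 4 * (real N)\<^sup>2" using good_pos[OF assms] by simp
  have 1: "\<bar>S.U n i - S.U n j\<bar> \<le> KK * (\<bar>real_of_int i - real_of_int j\<bar> / real N)" for n i j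
    using S.U_space_lipschitz[of n j "nat (i - j)"] S.U_space_lipschitz[of n i "nat (j - i)"] scheme_K[OF assms]
    by (cases "j \<le> i") (auto simp: abs_minus_commute)
  have 2: "\<bar>S.U n i - S.U m i\<bar> \<le> CC * (\<bar>real n - real m\<bar> / (4 * (real N)\<^sup>2))" for n m i
    using S.U_time_lipschitz[of m "n - m" i] S.U_time_lipschitz[of n "m - n" i] scheme_C[OF assms]
    by (cases "m \<le> n") (auto simp: abs_minus_commute of_nat_diff)
  have "\<bar>uN N x t - uN N y t\<bar> \<le> KK * (\<bar>x - y\<bar> + 1 / real N)"
    unfolding uN_def grid_def
    by (rule order_trans[OF 1 mult_left_mono[OF floor_mult_diff_le[OF assms] KK_nonneg]])
  moreover have "\<bar>uN N y t - uN N y s\<bar> \<le> CC * (\<bar>t - s\<bar> + 1 / (4 * (real N)\<^sup>2))"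
  proof -
    have "\<bar>real (nat \<lfloor>4 * (real N)\<^sup>2 * t\<rfloor>) - real (nat \<lfloor>4 * (real N)\<^sup>2 * s\<rfloor>)\<bar> / (4 * (real N)\<^sup>2)
      \<le> (\<bar>4 * (real N)\<^sup>2 * t - 4 * (real N)\<^sup>2 * s\<bar> + 1) / (4 * (real N)\<^sup>2)"
      using N by (intro divide_right_mono nat_floor_diff_le) auto
    also have "\<dots> = \<bar>t - s\<bar> + 1 / (4 * (real N)\<^sup>2)"
      using N by (simp only: right_diff_distrib[symmetric] abs_mult add_divide_distrib) simp
    finally show ?thesis
      unfolding uN_def grid_def by (rule order_trans[OF 2 mult_left_mono[OF _ CC_nonneg]])
  qed
  ultimately show ?thesis by linarith
qed

text \<open>The number j of grid steps between the cells of x and y differs from N * (y - x) by at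
  most 1. This enlarges the quadratic term to y - x + 1 / N, and replacing j / N by y - x in the
  linear term costs KK / N.\<close>

lemma uN_taylor: assumes "good N" "x \<le> y"
  shows "\<bar>uN N y t - uN N x t - (y - x) * pN N x t\<bar> \<le> KK * (y - x + 1 / real N)\<^sup>2 + KK / real N"
proof -
  interpret S: explicit_scheme A G a B N "gN N" "wN N" M "2 * K0"
    by (rule scheme[OF assms(1)])
  have N: "real N > 0" using good_pos[OF assms(1)] by simp
  define j where "j = nat (\<lfloor>real N * y\<rfloor> - \<lfloor>real N * x\<rfloor>)"
  have le: "\<lfloor>real N * x\<rfloor> \<le> \<lfloor>real N * y\<rfloor>" using assms(2) by (intro floor_mono mult_left_mono) auto
  then have j: "\<lfloor>real N * y\<rfloor> = \<lfloor>real N * x\<rfloor> + int j" by (simp add: j_def)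
  have rj: "real j = real_of_int \<lfloor>real N * y\<rfloor> - real_of_int \<lfloor>real N * x\<rfloor>" using j by simp
  have "\<bar>real j - real N * (y - x)\<bar> \<le> 1" unfolding rj right_diff_distrib by linarith
  then have "\<bar>real j - real N * (y - x)\<bar> / real N \<le> 1 / real N" using N by (intro divide_right_mono) auto
  moreover have "\<bar>real j / real N - (y - x)\<bar> = \<bar>real j - real N * (y - x)\<bar> / real N"
  proof -
    have "real j / real N - (y - x) = (real j - real N * (y - x)) / real N" using N by (simp add: diff_divide_distrib)
    then show ?thesis by (simp only: abs_divide abs_of_nat)
  qed
  ultimately have jd: "\<bar>real j / real N - (y - x)\<bar> \<le> 1 / real N" by simp
  have 1: "\<bar>uN N y t - uN N x t - real j / real N * pN N x t\<bar> \<le> KK * (real j / real N)\<^sup>2"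
    using S.U_taylor[of _ "\<lfloor>real N * x\<rfloor>" j] scheme_K[OF assms(1)]
    by (simp add: uN_def grid_def pN_slope[OF assms(1)] j)
  have 2: "KK * (real j / real N)\<^sup>2 \<le> KK * (y - x + 1 / real N)\<^sup>2"
    using jd by (intro mult_left_mono KK_nonneg power_mono) auto
  have 3: "\<bar>(real j / real N - (y - x)) * pN N x t\<bar> \<le> KK / real N"
    using mult_mono[OF jd pN_bound[OF assms(1), of x t]] by (simp add: abs_mult)
  have "uN N y t - uN N x t - (y - x) * pN N x t
     = (uN N y t - uN N x t - real j / real N * pN N x t) + (real j / real N - (y - x)) * pN N x t"
    by (simp add: algebra_simps)
  then show ?thesis
    using order_trans[OF abs_triangle_ineq add_mono[OF order_trans[OF 1 2] 3]] by (simp only:)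
qed

text \<open>The condition 0 \<le> t makes one time step raise the level by exactly one; for negative
  t the cast \<open>nat\<close> keeps it at 0.\<close>

lemma uN_step: assumes "good N" "0 \<le> t"
  shows "(uN N x (t + 1 / (4 * (real N)\<^sup>2)) - uN N x t) * (4 * (real N)\<^sup>2)
    = real N * (A (pN N x t) - A (pN N (x - 1 / real N) t))
      + g_avg N (real_of_int \<lfloor>real N * x\<rfloor> / real N) * G (pN N x t)"
proof -
  interpret S: explicit_scheme A G a B N "gN N" "wN N" M "2 * K0"
    by (rule scheme[OF assms(1)])
  have N: "real N > 0" "4 * (real N)\<^sup>2 > 0" using good_pos[OF assms(1)] by simp_all
  have "4 * (real N)\<^sup>2 * (t + 1 / (4 * (real N)\<^sup>2)) = 4 * (real N)\<^sup>2 * t + 1"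
    using N by (simp add: distrib_left)
  moreover have "0 \<le> 4 * (real N)\<^sup>2 * t" using N(2) assms(2) by (intro mult_nonneg_nonneg) auto
  ultimately have 1: "nat \<lfloor>4 * (real N)\<^sup>2 * (t + 1 / (4 * (real N)\<^sup>2))\<rfloor> = Suc (nat \<lfloor>4 * (real N)\<^sup>2 * t\<rfloor>)"
    by (simp add: Suc_nat_eq_nat_zadd1 add.commute)
  have "real N * (x - 1 / real N) = real N * x - 1" using N by (simp add: field_simps)
  then have 2: "\<lfloor>real N * (x - 1 / real N)\<rfloor> = \<lfloor>real N * x\<rfloor> - 1" by linarith
  show ?thesis
    using N unfolding uN_def grid_def 1 S.U_Suc pN_slope[OF assms(1)] 2
    by (simp add: S.velocity_def)
qed

lemma uN_initial: assumes "good N" "t \<le> 0" shows "uN N x t = w (real_of_int \<lfloor>real N * x\<rfloor> / real N)"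
proof -
  interpret S: explicit_scheme A G a B N "gN N" "wN N" M "2 * K0"
    by (rule scheme[OF assms(1)])
  have "4 * (real N)\<^sup>2 * t \<le> 0" using assms(2) by (simp add: mult_nonneg_nonpos)
  then have "nat \<lfloor>4 * (real N)\<^sup>2 * t\<rfloor> = 0" by linarith
  then show ?thesis by (simp add: uN_def grid_def)
qed

lemma measurable_uN: "(\<lambda>z. uN N (fst z) (snd z)) \<in> borel_measurable borel"
proof -
  have f: "(\<lambda>z::real \<times> real. \<lfloor>real N * fst z\<rfloor>) \<in> borel \<rightarrow>\<^sub>M count_space UNIV"
    "(\<lambda>z::real \<times> real. nat \<lfloor>4 * (real N)\<^sup>2 * snd z\<rfloor>) \<in> borel \<rightarrow>\<^sub>M count_space UNIV"
    by (intro measurable_compose[OF _ measurable_real_floor]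
        measurable_compose[OF measurable_compose[OF _ measurable_real_floor], where g=nat]; simp add: borel_prod[symmetric])+
  show ?thesis
    unfolding uN_def
    by (rule measurable_compose_countable[OF _ f(1)], rule measurable_compose_countable[OF _ f(2)]) simp
qed

text \<open>A majorant for all good N at once, from the value at the origin and the Lipschitz bounds
  with mesh sizes at most 1. The final summand 1 makes it positive, so that \<open>uN\<close> can be
  divided by it before a subsequence is extracted.\<close>

definition uB :: "real \<times> real \<Rightarrow> real" where
  "uB z = \<bar>w 0\<bar> + KK * (\<bar>fst z\<bar> + 1) + CC * (\<bar>snd z\<bar> + 1) + 1"

lemma uB_pos: "0 < uB z"
  unfolding uB_def by (intro add_nonneg_pos add_nonneg_nonneg mult_nonneg_nonneg KK_nonneg CC_nonneg) auto

lemma uN_bound: assumes that: "good N" shows "\<bar>uN N x t\<bar> \<le> uB (x, t)"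
proof -
  note good_steps(2,4)[OF that]
  then have "KK * (\<bar>x - 0\<bar> + 1 / real N) \<le> KK * (\<bar>x\<bar> + 1)" "CC * (\<bar>t - 0\<bar> + 1 / (4 * (real N)\<^sup>2)) \<le> CC * (\<bar>t\<bar> + 1)"
    by (intro mult_left_mono KK_nonneg CC_nonneg; simp)+
  from order_trans[OF uN_lipschitz[OF that, of x t 0 0] add_mono[OF this]] uN_initial[OF that, of 0 0]
  have "\<bar>uN N x t - w 0\<bar> \<le> KK * (\<bar>x\<bar> + 1) + CC * (\<bar>t\<bar> + 1)" by simp
  moreover have "\<bar>uN N x t\<bar> \<le> \<bar>w 0\<bar> + \<bar>uN N x t - w 0\<bar>" by linarith
  ultimately show ?thesis unfolding uB_def fst_conv snd_conv by linarith
qed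

text \<open>The normalised functions are bounded by 1, so a diagonal subsequence converges at all
  rational points, and near-Lipschitz continuity spreads this to the plane. No modulus of continuity
  in t is at hand for \<open>pN\<close>; its convergence is deduced from difference quotients of
  \<open>uN\<close> of fixed width d, which differ from \<open>pN\<close> by about KK * d.\<close>

lemma exists_limit:
  obtains r u p where "strict_mono (r :: nat \<Rightarrow> nat)" "\<And>k. good (r k)"
    "\<And>x t. (\<lambda>k. uN (r k) x t) \<longlonglongrightarrow> u x t" "\<And>x t. (\<lambda>k. pN (r k) x t) \<longlonglongrightarrow> p x t"
proof -
  define N1 where "N1 = nat \<lceil>M / a\<rceil> + 1"
  have good1: "good (k + N1)" for k
  proof -
    have "M / a \<le> real (k + N1)" unfolding N1_def by linarith
    then show ?thesis using a_pos by (simp add: good_def N1_def field_simps)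
  qed
  have "countable (\<rat> \<times> \<rat> :: (real \<times> real) set)" by (simp add: countable_rat)
  moreover have "norm (uN (k + N1) (fst z) (snd z) / uB z) \<le> 1" for k z
    using uN_bound[OF good1, of k "fst z" "snd z"] uB_pos[of z] by (simp add: abs_divide divide_le_eq)
  ultimately obtain q where q: "strict_mono (q :: nat \<Rightarrow> nat)"
    and qlim: "\<And>z. z \<in> \<rat> \<times> \<rat> \<Longrightarrow> \<exists>l. (\<lambda>n. uN (q n + N1) (fst z) (snd z) / uB z) \<longlonglongrightarrow> l"
    by (rule function_convergent_subsequence[where f="\<lambda>k z. uN (k + N1) (fst z) (snd z) / uB z" and S="\<rat> \<times> \<rat>" and M=1])
      auto
  define r where "r k = q k + N1" for k
  have r: "strict_mono r" using q by (simp add: strict_mono_def r_def)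
  have good: "good (r k)" for k by (simp add: r_def good1)
  note r0 = grid_steps_tendsto_0(1)[OF r] and r02 = grid_steps_tendsto_0(2)[OF r]
  have rat: "convergent (\<lambda>k. uN (r k) x t)" if xt: "x \<in> \<rat>" "t \<in> \<rat>" for x t
  proof -
    obtain l where "(\<lambda>k. uN (r k) x t / uB (x, t)) \<longlonglongrightarrow> l" using qlim[of "(x, t)"] xt by (auto simp: r_def)
    then have "(\<lambda>k. uN (r k) x t / uB (x, t) * uB (x, t)) \<longlonglongrightarrow> l * uB (x, t)" by (rule tendsto_mult_right)
    then show ?thesis using uB_pos[of "(x, t)"] by (auto simp: convergent_def)
  qed
  have cu: "convergent (\<lambda>k. uN (r k) x t)" for x t
  proof (rule convergent_if_approx)
    fix e :: real assume e: "e > 0"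
    \<comment> \<open>A rational point within d in both coordinates costs at most e / 2; the rest of
      e absorbs the mesh terms for large k. The 1 in the denominator keeps it positive.\<close>
    define d where "d = e / 2 / (KK + CC + 1)"
    have KC: "KK + CC + 1 > 0" using KK_nonneg CC_nonneg by linarith
    have d: "d > 0" using e KC by (simp add: d_def)
    obtain x' where x': "x' \<in> \<rat>" "x < x'" "x' < x + d" using Rats_dense_in_real[of x "x + d"] d by auto
    obtain t' where t': "t' \<in> \<rat>" "t < t'" "t' < t + d" using Rats_dense_in_real[of t "t + d"] d by auto
    have "(\<lambda>k. KK * (\<bar>x - x'\<bar> + 1 / real (r k)) + CC * (\<bar>t - t'\<bar> + 1 / (4 * (real (r k))\<^sup>2)))
       \<longlonglongrightarrow> KK * (\<bar>x - x'\<bar> + 0) + CC * (\<bar>t - t'\<bar> + 0)"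
      by (intro tendsto_intros r0 r02)
    moreover have "KK * (\<bar>x - x'\<bar> + 0) + CC * (\<bar>t - t'\<bar> + 0) < e"
    proof -
      have "KK * (\<bar>x - x'\<bar> + 0) + CC * (\<bar>t - t'\<bar> + 0) \<le> KK * d + CC * d"
        using x' t' KK_nonneg CC_nonneg by (intro add_mono mult_left_mono) auto
      also have "\<dots> \<le> (KK + CC + 1) * d" using d by (simp add: algebra_simps)
      also have "\<dots> = e / 2" unfolding d_def using less_imp_neq[OF KC] by (metis nonzero_mult_div_cancel_left times_divide_eq_right)
      finally show ?thesis using e by simp
    qed
    ultimately have "\<forall>\<^sub>F k in sequentially. KK * (\<bar>x - x'\<bar> + 1 / real (r k)) + CC * (\<bar>t - t'\<bar> + 1 / (4 * (real (r k))\<^sup>2)) < e"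
      by (rule order_tendstoD(2))
    then have "\<forall>\<^sub>F k in sequentially. \<bar>uN (r k) x t - uN (r k) x' t'\<bar> \<le> e"
    proof eventually_elim
      case (elim k)
      show ?case using uN_lipschitz[OF good[of k], of x t x' t'] elim by linarith
    qed
    then show "\<exists>c. convergent c \<and> (\<forall>\<^sub>F k in sequentially. \<bar>uN (r k) x t - c k\<bar> \<le> e)"
      using rat[OF x'(1) t'(1)] by blast
  qed
  have cp: "convergent (\<lambda>k. pN (r k) x t)" for x t
  proof (rule convergent_if_approx)
    fix e :: real assume e: "e > 0"
    \<comment> \<open>The width d stays fixed while the mesh tends to 0, which leaves an error KK *
      d of at most e / 2.\<close>
    define d where "d = e / 2 / (KK + 1)"
    have K1: "KK + 1 > 0" using KK_nonneg by linarith
    have d: "d > 0" using e K1 by (simp add: d_def)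
    have "(\<lambda>k. (KK * (d + 1 / real (r k))\<^sup>2 + KK * (1 / real (r k))) / d) \<longlonglongrightarrow> (KK * (d + 0)\<^sup>2 + KK * 0) / d"
      using d by (intro tendsto_intros r0) auto
    moreover have "(KK * (d + 0)\<^sup>2 + KK * 0) / d < e"
    proof -
      have "(KK * (d + 0)\<^sup>2 + KK * 0) / d = KK * d" using d by (simp add: power2_eq_square)
      also have "\<dots> \<le> (KK + 1) * d" using d by (simp add: algebra_simps)
      also have "\<dots> = e / 2" unfolding d_def using less_imp_neq[OF K1] by (metis nonzero_mult_div_cancel_left times_divide_eq_right)
      also have "\<dots> < e" using e by simp
      finally show ?thesis .
    qed
    ultimately have "\<forall>\<^sub>F k in sequentially. (KK * (d + 1 / real (r k))\<^sup>2 + KK * (1 / real (r k))) / d < e"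
      by (rule order_tendstoD(2))
    then have ev: "\<forall>\<^sub>F k in sequentially. \<bar>pN (r k) x t - (uN (r k) (x + d) t - uN (r k) x t) / d\<bar> \<le> e"
    proof eventually_elim
      case (elim k)
      have "\<bar>uN (r k) (x + d) t - uN (r k) x t - d * pN (r k) x t\<bar> \<le> KK * (d + 1 / real (r k))\<^sup>2 + KK / real (r k)"
        using uN_taylor[OF good[of k], of x "x + d" t] d by simp
      then have "\<bar>uN (r k) (x + d) t - uN (r k) x t - d * pN (r k) x t\<bar> / d \<le> (KK * (d + 1 / real (r k))\<^sup>2 + KK * (1 / real (r k))) / d"
        using d by (intro divide_right_mono) auto
      moreover have "\<bar>pN (r k) x t - (uN (r k) (x + d) t - uN (r k) x t) / d\<bar>
         = \<bar>uN (r k) (x + d) t - uN (r k) x t - d * pN (r k) x t\<bar> / d"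
      proof -
        have "(uN (r k) (x + d) t - uN (r k) x t - d * pN (r k) x t) / d = (uN (r k) (x + d) t - uN (r k) x t) / d - pN (r k) x t"
          using d by (simp add: diff_divide_distrib)
        then have "\<bar>uN (r k) (x + d) t - uN (r k) x t - d * pN (r k) x t\<bar> / \<bar>d\<bar> = \<bar>(uN (r k) (x + d) t - uN (r k) x t) / d - pN (r k) x t\<bar>"
          by (metis abs_divide)
        then show ?thesis using d by (simp add: abs_minus_commute)
      qed
      ultimately show ?case using elim by linarith
    qed
    have "convergent (\<lambda>k. (uN (r k) (x + d) t - uN (r k) x t) / d)"
    proof -
      obtain l1 l2 where "(\<lambda>k. uN (r k) (x + d) t) \<longlonglongrightarrow> l1" "(\<lambda>k. uN (r k) x t) \<longlonglongrightarrow> l2"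
        using cu by (metis convergent_def)
      then have "(\<lambda>k. (uN (r k) (x + d) t - uN (r k) x t) / d) \<longlonglongrightarrow> (l1 - l2) / d"
        using d by (intro tendsto_intros) auto
      then show ?thesis by (auto simp: convergent_def)
    qed
    with ev show "\<exists>c. convergent c \<and> (\<forall>\<^sub>F k in sequentially. \<bar>pN (r k) x t - c k\<bar> \<le> e)" by blast
  qed
  show ?thesis
    by (rule that[OF r good, of "\<lambda>x t. lim (\<lambda>k. uN (r k) x t)" "\<lambda>x t. lim (\<lambda>k. pN (r k) x t)"])
      (use cu cp in \<open>simp_all add: convergent_LIMSEQ_iff\<close>)
qed

text \<open>Put s = 1 / sqrt N. The averaging interval has length s and starts at a grid point
  within s^2 of x, so moving its start to x changes the integral by at most 2 M s^2 and the average
  by at most 2 M s. Lebesgue's differentiation theorem handles the interval starting at x.\<close>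

lemma g_avg_tendsto_AE:
  assumes r: "strict_mono r" and good: "\<And>k. good (r k)"
  shows "AE x in lborel. (\<lambda>k. g_avg (r k) (real_of_int \<lfloor>real (r k) * x\<rfloor> / real (r k))) \<longlonglongrightarrow> g x"
proof -
  have "AE x in lborel. ((\<lambda>h. integral {x..x + h} g / h) \<longlongrightarrow> g x) (at_right 0)"
    by (rule average_tendsto_AE[OF g_integrable])
  then show ?thesis
  proof eventually_elim
    case (elim x)
    define s where "s k = 1 / sqrt (real (r k))" for k
    have rp: "real (r k) > 0" for k using good_pos(2)[OF good] .
    have sp: "s k > 0" for k using rp by (simp add: s_def)
    have "(\<lambda>k. inverse (sqrt (real (r k)))) \<longlonglongrightarrow> 0"
      by (intro tendsto_inverse_0_at_top filterlim_compose[OF sqrt_at_top]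
          filterlim_compose[OF filterlim_real_sequentially] filterlim_subseq r)
    then have s0: "s \<longlonglongrightarrow> 0" by (simp add: s_def[abs_def] inverse_eq_divide)
    have "filterlim s (at_right 0) sequentially"
      unfolding filterlim_at using s0 less_imp_neq[OF sp] sp by auto
    then have 1: "(\<lambda>k. integral {x..x + s k} g / s k) \<longlonglongrightarrow> g x"
      by (rule filterlim_compose[OF elim])
    have 2: "(\<lambda>k. g_avg (r k) (real_of_int \<lfloor>real (r k) * x\<rfloor> / real (r k)) - integral {x..x + s k} g / s k) \<longlonglongrightarrow> 0"
    proof (rule Lim_null_comparison[of _ "\<lambda>k. 2 * M * s k"])
      show "(\<lambda>k. 2 * M * s k) \<longlonglongrightarrow> 0" using tendsto_mult_left[OF s0, of "2 * M"] by simp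
      show "\<forall>\<^sub>F k in sequentially. norm (g_avg (r k) (real_of_int \<lfloor>real (r k) * x\<rfloor> / real (r k)) - integral {x..x + s k} g / s k) \<le> 2 * M * s k"
      proof (intro always_eventually allI)
        fix k
        define y where "y = real_of_int \<lfloor>real (r k) * x\<rfloor> / real (r k)"
        have s2: "s k * s k = 1 / real (r k)" using rp[of k] by (simp add: s_def)
        have y: "y \<le> x" "x \<le> y + s k * s k"
          unfolding s2 y_def using rp[of k] by (simp_all add: field_simps) linarith+
        have c: "integral {c..d} g + integral {d..e} g = integral {c..e} g" if "c \<le> d" "d \<le> e" for c d e
          by (rule Henstock_Kurzweil_Integration.integral_combine[OF that g_integrable])
        have "integral {y..y + s k} g - integral {x..x + s k} g = integral {y..x} g - integral {y + s k..x + s k} g"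
          using c[of y x "x + s k"] c[of y "y + s k" "x + s k"] y sp[of k] by simp
        then have "\<bar>integral {y..y + s k} g - integral {x..x + s k} g\<bar> \<le> M * (s k * s k) + M * (s k * s k)"
        proof -
          have "\<bar>integral {y..x} g\<bar> \<le> M * (s k * s k)"
            using integral_g_bound[of y x] y mult_left_mono[OF _ M_nonneg, of "\<bar>x - y\<bar>" "s k * s k"] by simp
          moreover have "\<bar>integral {y + s k..x + s k} g\<bar> \<le> M * (s k * s k)"
            using integral_g_bound[of "y + s k" "x + s k"] y mult_left_mono[OF _ M_nonneg, of "\<bar>x - y\<bar>" "s k * s k"] by simp
          ultimately show ?thesis
            using \<open>integral {y..y + s k} g - integral {x..x + s k} g = _\<close> by linarith
        qed
        then have "\<bar>integral {y..y + s k} g - integral {x..x + s k} g\<bar> / s k \<le> (2 * M * s k) * s k / s k"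
          using sp[of k] by (intro divide_right_mono) (auto simp: algebra_simps)
        moreover have "g_avg (r k) y = integral {y..y + s k} g / s k" by (simp add: g_avg_def s_def mult.commute)
        ultimately show "norm (g_avg (r k) (real_of_int \<lfloor>real (r k) * x\<rfloor> / real (r k)) - integral {x..x + s k} g / s k) \<le> 2 * M * s k"
          using sp[of k] by (simp add: y_def[symmetric] diff_divide_distrib[symmetric] abs_divide)
      qed
    qed
    show ?case using tendsto_add[OF 2 1] by simp
  qed
qed

end

section \<open>The limit equation\<close>

lemma partial_derivs:
  assumes "\<And>z. (\<phi> has_derivative (\<lambda>h. fst h * \<phi>x z + snd h * \<phi>t z)) (at z)"
  shows "((\<lambda>s. \<phi> (s, t)) has_real_derivative \<phi>x (x, t)) (at x)"
    and "((\<lambda>s. \<phi> (x, s)) has_real_derivative \<phi>t (x, t)) (at t)"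
proof -
  have "((\<lambda>s. (s, t)) has_derivative (\<lambda>h. (h, 0))) (at x)"
    by (auto intro!: derivative_eq_intros)
  from has_derivative_compose[OF this assms] show "((\<lambda>s. \<phi> (s, t)) has_real_derivative \<phi>x (x, t)) (at x)"
    by (simp add: has_field_derivative_def mult.commute[of _ "\<phi>x _"] mult.commute[of _ "\<phi>t _"])
  have "((\<lambda>s. (x, s)) has_derivative (\<lambda>h. (0, h))) (at t)"
    by (auto intro!: derivative_eq_intros)
  from has_derivative_compose[OF this assms] show "((\<lambda>s. \<phi> (x, s)) has_real_derivative \<phi>t (x, t)) (at t)"
    by (simp add: has_field_derivative_def mult.commute[of _ "\<phi>x _"] mult.commute[of _ "\<phi>t _"])
qed

lemma partial_derivs_continuous:
  fixes \<phi> :: "real \<times> real \<Rightarrow> real"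
  assumes "\<And>z. (\<phi> has_derivative (\<lambda>h. fst h * \<phi>x z + snd h * \<phi>t z)) (at z)"
  shows "continuous_on UNIV \<phi>"
  using has_derivative_continuous[OF assms] by (simp add: continuous_on_eq_continuous_at)

lemma partial_derivs_zero:
  assumes d: "\<And>z. (\<phi> has_derivative (\<lambda>h. fst h * \<phi>x z + snd h * \<phi>t z)) (at z)"
    and S: "closed S" and zero: "\<And>z. z \<notin> S \<Longrightarrow> \<phi> z = 0" and z: "z \<notin> S"
  shows "\<phi>x z = 0" "\<phi>t z = (0::real)"
proof -
  have "(\<phi> has_derivative (\<lambda>_. 0)) (at z)"
    by (rule has_derivative_transform_within_open[where f="\<lambda>_. 0" and s="- S"])
      (use S zero z in auto)
  then have "(\<lambda>h. fst h * \<phi>x z + snd h * \<phi>t z) = (\<lambda>_. 0)"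
    by (rule has_derivative_unique[OF d])
  from fun_cong[OF this, of "(1, 0)"] fun_cong[OF this, of "(0, 1)"]
  show "\<phi>x z = 0" "\<phi>t z = 0" by simp_all
qed

lemma lipschitz_from_deriv:
  fixes f :: "real \<Rightarrow> real"
  assumes "\<And>x. x \<in> {a..b} \<Longrightarrow> (f has_real_derivative f' x) (at x)" "\<And>x. x \<in> {a..b} \<Longrightarrow> \<bar>f' x\<bar> \<le> B"
    and "x \<in> {a..b}" "y \<in> {a..b}"
  shows "\<bar>f x - f y\<bar> \<le> B * \<bar>x - y\<bar>"
  using field_differentiable_bound[of "{a..b}" f f' B x y] assms
  by (auto intro: has_field_derivative_at_within)

lemma DERIV_quotient_sequence:
  fixes f :: "real \<Rightarrow> real"
  assumes "(f has_real_derivative D) (at x)" "s \<longlonglongrightarrow> 0" "\<And>k. s k \<noteq> 0"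
  shows "(\<lambda>k. (f (x + s k) - f x) / s k) \<longlonglongrightarrow> D"
proof -
  have "((\<lambda>h. (f (x + h) - f x) / h) \<longlongrightarrow> D) (at 0)" using assms(1) by (simp add: DERIV_def)
  moreover have "filterlim s (at 0) sequentially" using assms(2,3) by (auto simp: filterlim_at)
  ultimately show ?thesis by (rule filterlim_compose)
qed

text \<open>Half-open in x, so that integer translates tile the plane; unrestricted in t, since the
  test functions vanish outside a compact time interval.\<close>

abbreviation cell :: "real \<times> real \<Rightarrow> real" where "cell \<equiv> indicator ({0..<1} \<times> UNIV)"

lemma sets_slab [measurable]: "{a..<b::real} \<times> (UNIV :: real set) \<in> sets borel"
  unfolding borel_prod[symmetric] by measurable

lemma integrable_slab:
  fixes h :: "real \<times> real \<Rightarrow> real"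
  assumes [measurable]: "h \<in> borel_measurable borel"
    and bd: "\<And>x t. 0 \<le> x \<Longrightarrow> x \<le> 2 \<Longrightarrow> \<bar>t\<bar> \<le> R \<Longrightarrow> \<bar>h (x, t)\<bar> \<le> B"
    and zero: "\<And>x t. 0 \<le> x \<Longrightarrow> x \<le> 2 \<Longrightarrow> \<not> \<bar>t\<bar> \<le> R \<Longrightarrow> h (x, t) = 0" and ab: "0 \<le> a" "b \<le> 2"
  shows "integrable lborel (\<lambda>z. indicator ({a..<b} \<times> UNIV) z * h z)"
proof (rule integrable_bounded_support[where r="2 + \<bar>R\<bar>" and B="\<bar>B\<bar>"])
  show "(\<lambda>z. indicator ({a..<b} \<times> UNIV) z * h z) \<in> borel_measurable borel" by measurable
  fix z :: "real \<times> real"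
  obtain x t where z: "z = (x, t)" by (cases z)
  show "\<bar>indicator ({a..<b} \<times> UNIV) z * h z\<bar> \<le> \<bar>B\<bar>"
    using bd[of x t] zero[of x t] ab by (cases "\<bar>t\<bar> \<le> R") (auto simp: z indicator_def)
  assume n: "2 + \<bar>R\<bar> < norm z"
  show "indicator ({a..<b} \<times> UNIV) z * h z = 0"
  proof (cases "x \<in> {a..<b}")
    case True
    have "norm z \<le> \<bar>x\<bar> + \<bar>t\<bar>" unfolding z using norm_Pair_le[of x t] by simp
    then have "\<not> \<bar>t\<bar> \<le> R" using n True ab by auto
    then show ?thesis using zero[of x t] True ab by (simp add: z)
  qed (simp add: z)
qed

text \<open>The shift moves the window from [0, 1) to [c, 1 + c); its part beyond 1 is brought back
  by one period and fills [0, c).\<close>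

lemma integral_periodic_shift:
  fixes F :: "real \<times> real \<Rightarrow> real"
  assumes [measurable]: "F \<in> borel_measurable borel"
    and bd: "\<And>x t. 0 \<le> x \<Longrightarrow> x \<le> 2 \<Longrightarrow> \<bar>t\<bar> \<le> R \<Longrightarrow> \<bar>F (x, t)\<bar> \<le> B"
    and zero: "\<And>x t. 0 \<le> x \<Longrightarrow> x \<le> 2 \<Longrightarrow> \<not> \<bar>t\<bar> \<le> R \<Longrightarrow> F (x, t) = 0"
    and per: "\<And>z. F (z + (1, 0)) = F z" and c: "0 \<le> c" "c \<le> 1"
  shows "(\<integral>z. cell z * F (z + (c, 0)) \<partial>lborel) = (\<integral>z. cell z * F z \<partial>lborel)"
proof -
  let ?I = "\<lambda>a b z. indicator ({a..<b} \<times> UNIV) z :: real"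
  have m: "(\<lambda>z. ?I a b z * F z) \<in> borel_measurable borel" for a b by measurable
  have int: "integrable lborel (\<lambda>z. ?I a b z * F z)" if "0 \<le> a" "b \<le> 2" for a b
    by (rule integrable_slab[OF assms(1-3) that])
  have "(\<integral>z. cell z * F (z + (c, 0)) \<partial>lborel) = (\<integral>z. ?I c (1 + c) (z + (c, 0)) * F (z + (c, 0)) \<partial>lborel)"
    by (intro Bochner_Integration.integral_cong refl arg_cong2[where f="(*)"]) (auto simp: indicator_def)
  also have "\<dots> = (\<integral>z. ?I c (1 + c) z * F z \<partial>lborel)" by (rule integral_lborel_translate[OF m])
  also have "\<dots> = (\<integral>z. ?I c 1 z * F z + ?I 1 (1 + c) z * F z \<partial>lborel)"
    using c by (intro Bochner_Integration.integral_cong) (auto simp: indicator_def)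
  also have "\<dots> = (\<integral>z. ?I c 1 z * F z \<partial>lborel) + (\<integral>z. ?I 1 (1 + c) z * F z \<partial>lborel)"
    using c by (intro Bochner_Integration.integral_add int) auto
  also have "(\<integral>z. ?I 1 (1 + c) z * F z \<partial>lborel) = (\<integral>z. ?I 1 (1 + c) (z + (1, 0)) * F (z + (1, 0)) \<partial>lborel)"
    by (rule integral_lborel_translate[OF m, symmetric])
  also have "\<dots> = (\<integral>z. ?I 0 c z * F z \<partial>lborel)"
    unfolding per by (intro Bochner_Integration.integral_cong refl arg_cong2[where f="(*)"]) (auto simp: indicator_def)
  also have "(\<integral>z. ?I c 1 z * F z \<partial>lborel) + (\<integral>z. ?I 0 c z * F z \<partial>lborel) = (\<integral>z. ?I c 1 z * F z + ?I 0 c z * F z \<partial>lborel)"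
    using c by (intro Bochner_Integration.integral_add[symmetric] int) auto
  also have "\<dots> = (\<integral>z. cell z * F z \<partial>lborel)"
    using c by (intro Bochner_Integration.integral_cong) (auto simp: indicator_def)
  finally show ?thesis .
qed

text \<open>Periodic test functions have no compact support in x, so the bounds come from
  compactness on [0, 2], which contains the cell and its shifts to the right by up to one period.
  Off the closed strip [a, b] in time the function vanishes on an open set, hence so do its partial
  derivatives.\<close>

lemma per_test_bounds:
  assumes "per_test T \<phi> \<phi>x \<phi>t"
  obtains B where "0 \<le> B" "\<And>x t. 0 \<le> x \<Longrightarrow> x \<le> 2 \<Longrightarrow> \<bar>\<phi> (x, t)\<bar> \<le> B"
    "\<And>x t. 0 \<le> x \<Longrightarrow> x \<le> 2 \<Longrightarrow> \<bar>\<phi>x (x, t)\<bar> \<le> B" "\<And>x t. 0 \<le> x \<Longrightarrow> x \<le> 2 \<Longrightarrow> \<bar>\<phi>t (x, t)\<bar> \<le> B"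
    "\<And>x t. t \<notin> {0<..<T} \<Longrightarrow> \<phi> (x, t) = 0 \<and> \<phi>x (x, t) = 0 \<and> \<phi>t (x, t) = 0"
proof -
  have d: "\<And>z. (\<phi> has_derivative (\<lambda>h. fst h * \<phi>x z + snd h * \<phi>t z)) (at z)"
    and cx: "continuous_on UNIV \<phi>x" and ct: "continuous_on UNIV \<phi>t"
    using assms by (auto simp: per_test_def)
  obtain a b where ab: "0 < a" "b < T" and zero: "\<And>x t. t \<notin> {a..b} \<Longrightarrow> \<phi> (x, t) = 0"
    using assms unfolding per_test_def by blast
  note c = partial_derivs_continuous[OF d]
  have z0: "\<phi> z = 0 \<and> \<phi>x z = 0 \<and> \<phi>t z = 0" if "snd z \<notin> {a..b}" for z
  proof -
    have cl: "closed ((UNIV :: real set) \<times> {a..b})" by (intro closed_Times) auto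
    show ?thesis
      using partial_derivs_zero[OF d cl, of z] zero[of "snd z" "fst z"] that zero
      by (auto simp: mem_Times_iff)
  qed
  let ?Q = "{0..2::real} \<times> {a..b}"
  have Q: "compact ?Q" by (intro compact_Times) auto
  have "\<exists>B. \<forall>z\<in>?Q. \<bar>f z\<bar> \<le> B" if "continuous_on UNIV f" for f :: "real \<times> real \<Rightarrow> real"
    using compact_imp_bounded[OF compact_continuous_image[OF continuous_on_subset[OF that] Q]]
    by (auto simp: bounded_iff)
  then obtain B1 B2 B3 where B: "\<And>z. z \<in> ?Q \<Longrightarrow> \<bar>\<phi> z\<bar> \<le> B1" "\<And>z. z \<in> ?Q \<Longrightarrow> \<bar>\<phi>x z\<bar> \<le> B2" "\<And>z. z \<in> ?Q \<Longrightarrow> \<bar>\<phi>t z\<bar> \<le> B3"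
    using c cx ct by meson
  define B where "B = \<bar>B1\<bar> + \<bar>B2\<bar> + \<bar>B3\<bar>"
  have *: "\<bar>\<phi> (x, t)\<bar> \<le> B \<and> \<bar>\<phi>x (x, t)\<bar> \<le> B \<and> \<bar>\<phi>t (x, t)\<bar> \<le> B" if "0 \<le> x" "x \<le> 2" for x t
  proof (cases "t \<in> {a..b}")
    case True
    then show ?thesis using B[of "(x, t)"] that by (auto simp: B_def)
  next
    case False
    then show ?thesis using z0[of "(x, t)"] by (simp add: B_def)
  qed
  have z1: "\<phi> (x, t) = 0 \<and> \<phi>x (x, t) = 0 \<and> \<phi>t (x, t) = 0" if "t \<notin> {0<..<T}" for x t
    by (rule z0) (use ab that in auto)
  show ?thesis by (rule that[of B]) (use * z1 in \<open>auto simp: B_def\<close>)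
qed

section \<open>Summation by parts and passage to the limit\<close>

context scheme_limit
begin

lemma measurable_pN: "(\<lambda>z. pN N (fst z) (snd z)) \<in> borel_measurable borel"
proof -
  have "(\<lambda>z::real \<times> real. uN N (fst (z + (1 / real N, 0))) (snd (z + (1 / real N, 0)))) \<in> borel_measurable borel"
    by (rule measurable_compose[OF _ measurable_uN]) measurable
  with measurable_uN[of N] show ?thesis unfolding pN_def by simp
qed

lemma A_bound: "\<bar>p\<bar> \<le> KK \<Longrightarrow> \<bar>A p\<bar> \<le> \<bar>A 0\<bar> + KK"
  using A_upper_abs[of p 0] by linarith

lemma uB_mono: assumes "\<bar>x\<bar> \<le> X" "\<bar>t\<bar> \<le> R" shows "uB (x, t) \<le> uB (X, R)"
proof -
  have "KK * (\<bar>x\<bar> + 1) \<le> KK * (\<bar>X\<bar> + 1)" "CC * (\<bar>t\<bar> + 1) \<le> CC * (\<bar>R\<bar> + 1)"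
    using assms by (intro mult_left_mono KK_nonneg CC_nonneg; auto)+
  then show ?thesis unfolding uB_def fst_conv snd_conv by linarith
qed

lemma measurable_g_floor: "(\<lambda>z::real \<times> real. g_avg N (real_of_int \<lfloor>real N * fst z\<rfloor> / real N)) \<in> borel_measurable borel"
proof (rule measurable_compose_countable[where g="\<lambda>z::real \<times> real. \<lfloor>real N * fst z\<rfloor>"])
  show "(\<lambda>z::real \<times> real. \<lfloor>real N * fst z\<rfloor>) \<in> borel \<rightarrow>\<^sub>M count_space UNIV"
    by (intro measurable_compose[OF _ measurable_real_floor]) (simp add: borel_prod[symmetric])
qed simp

text \<open>The scheme is multiplied by the test function and integrated over the cell. Translation
  in t turns the forward time difference of \<open>uN\<close> into a backward one of \<phi>; the
  periodic shift in x turns the backward difference of the flux into a forward one of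
  \<phi>.\<close>

lemma discrete_weak_form:
  assumes gd: "good N" and test: "per_test T \<phi> \<phi>x \<phi>t"
  defines "\<tau> \<equiv> 1 / (4 * (real N)\<^sup>2)" and "h \<equiv> 1 / real N"
  shows "(\<integral>z. cell z * (uN N (fst z) (snd z) * ((\<phi> (z - (0, \<tau>)) - \<phi> z) / \<tau>)
      + A (pN N (fst z) (snd z)) * ((\<phi> (z + (h, 0)) - \<phi> z) / h)
      - g_avg N (real_of_int \<lfloor>real N * fst z\<rfloor> / real N) * G (pN N (fst z) (snd z)) * \<phi> z) \<partial>lborel) = 0"
proof -
  obtain B\<phi> where Bp: "0 \<le> B\<phi>" and bphi: "\<And>x t. 0 \<le> x \<Longrightarrow> x \<le> 2 \<Longrightarrow> \<bar>\<phi> (x, t)\<bar> \<le> B\<phi>"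
    and z0: "\<And>x t. t \<notin> {0<..<T} \<Longrightarrow> \<phi> (x, t) = 0"
    using per_test_bounds[OF test] by metis
  have d: "\<And>z. (\<phi> has_derivative (\<lambda>h. fst h * \<phi>x z + snd h * \<phi>t z)) (at z)"
    and perphi: "\<And>x t. \<phi> (x + 1, t) = \<phi> (x, t)" using test by (auto simp: per_test_def)
  have tau: "0 < \<tau>" "\<tau> \<le> 1" "1 / \<tau> = 4 * (real N)\<^sup>2" and h: "0 < h" "h \<le> 1" "1 / h = real N"
    unfolding \<tau>_def h_def using good_steps[OF gd] by auto
  define v where "v z = uN N (fst z) (snd z)" for z :: "real \<times> real"
  define q where "q z = pN N (fst z) (snd z)" for z :: "real \<times> real"
  define \<gamma> where "\<gamma> z = g_avg N (real_of_int \<lfloor>real N * fst z\<rfloor> / real N)" for z :: "real \<times> real"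
  note c\<phi> = partial_derivs_continuous[OF d]
  have [measurable]: "v \<in> borel_measurable borel" "q \<in> borel_measurable borel" "\<gamma> \<in> borel_measurable borel"
    unfolding v_def q_def \<gamma>_def by (rule measurable_uN measurable_pN measurable_g_floor)+
  have [measurable]: "\<phi> \<in> borel_measurable borel" using c\<phi> by (rule borel_measurable_continuous_onI)
  have [measurable]: "A \<in> borel_measurable borel" "G \<in> borel_measurable borel"
    using continuous_A continuous_G by (auto intro: borel_measurable_continuous_onI)
  \<comment> \<open>\<phi> and its shift by \<tau> \<le> 1 both vanish when |t| exceeds R. The bound
    on v below reaches up to R + 1 because the scheme looks one time step ahead.\<close>
  define R where "R = \<bar>T\<bar> + 1"
  have far: "\<phi> (x, t) = 0" "\<phi> (x, t - \<tau>) = 0" if "\<not> \<bar>t\<bar> \<le> R" for x t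
    using that tau(1,2) by (auto simp: R_def intro!: z0)
  have vb: "\<bar>v (x, t)\<bar> \<le> uB (3, R + 1)" if "0 \<le> x" "x \<le> 2" "\<bar>t\<bar> \<le> R + 1" for x t
    using order_trans[OF uN_bound[OF gd] uB_mono[of x 3 t "R + 1"]] that by (simp add: v_def)
  have Ab: "\<bar>A (q z)\<bar> \<le> \<bar>A 0\<bar> + KK" for z unfolding q_def by (rule A_bound[OF pN_bound[OF gd]])
  have gb: "\<bar>\<gamma> z * G (q z)\<bar> \<le> M * B" for z
    unfolding abs_mult \<gamma>_def by (intro mult_mono g_avg_bound G_bound M_nonneg good_pos[OF gd]) auto
  have A0: "0 \<le> \<bar>A 0\<bar> + KK" using KK_nonneg by linarith
  have MB: "0 \<le> M * B" using M_nonneg B_nonneg by simp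
  have uB0: "0 \<le> uB (3, R + 1)" using uB_pos less_imp_le by blast
  have int: "integrable lborel (\<lambda>z. cell z * F z)" if "F \<in> borel_measurable borel"
    "\<And>x t. 0 \<le> x \<Longrightarrow> x \<le> 1 \<Longrightarrow> \<bar>t\<bar> \<le> R \<Longrightarrow> \<bar>F (x, t)\<bar> \<le> b"
    "\<And>x t. 0 \<le> x \<Longrightarrow> x \<le> 1 \<Longrightarrow> \<not> \<bar>t\<bar> \<le> R \<Longrightarrow> F (x, t) = 0" for F b
  proof -
    have "integrable lborel (\<lambda>z. cell z * (cell z * F z))"
      by (rule integrable_slab[where R=R and B="\<bar>b\<bar>"]) (use that in \<open>auto simp: indicator_def intro: order_trans[OF _ abs_ge_self]\<close>)
    then show ?thesis by (simp add: mult.assoc[symmetric] indicator_inter_arith[symmetric])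
  qed
  have i1: "integrable lborel (\<lambda>z. cell z * (v (z + (0, \<tau>)) * \<phi> z))"
    by (rule int[where b="uB (3, R + 1) * B\<phi>"])
      (use far tau in \<open>auto simp: abs_mult intro!: mult_mono vb bphi uB0\<close>)
  have i1': "integrable lborel (\<lambda>z. cell z * (v z * \<phi> (z - (0, \<tau>))))"
    by (rule int[where b="uB (3, R + 1) * B\<phi>"])
      (use far tau in \<open>auto simp: abs_mult intro!: mult_mono vb bphi uB0\<close>)
  have i2: "integrable lborel (\<lambda>z. cell z * (v z * \<phi> z))"
    by (rule int[where b="uB (3, R + 1) * B\<phi>"])
      (use far tau in \<open>auto simp: abs_mult intro!: mult_mono vb bphi uB0\<close>)
  have j1: "integrable lborel (\<lambda>z. cell z * (A (q z) * \<phi> z))"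
    by (rule int[where b="(\<bar>A 0\<bar> + KK) * B\<phi>"])
      (use far in \<open>auto simp: abs_mult intro!: mult_mono Ab bphi A0\<close>)
  have j2: "integrable lborel (\<lambda>z. cell z * (A (q (z - (h, 0))) * \<phi> z))"
    by (rule int[where b="(\<bar>A 0\<bar> + KK) * B\<phi>"])
      (use far in \<open>auto simp: abs_mult intro!: mult_mono Ab bphi A0\<close>)
  have j2': "integrable lborel (\<lambda>z. cell z * (A (q z) * \<phi> (z + (h, 0))))"
    by (rule int[where b="(\<bar>A 0\<bar> + KK) * B\<phi>"])
      (use far h in \<open>auto simp: abs_mult intro!: mult_mono Ab bphi A0\<close>)
  have l: "integrable lborel (\<lambda>z. cell z * (\<gamma> z * G (q z) * \<phi> z))"
    by (rule int[where b="M * B * B\<phi>"])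
      (use far in \<open>auto simp: abs_mult[of "_ * _"] intro!: mult_mono gb bphi MB\<close>)
  have t_shift: "(\<integral>z. cell z * (v (z + (0, \<tau>)) * \<phi> z) \<partial>lborel) = (\<integral>z. cell z * (v z * \<phi> (z - (0, \<tau>))) \<partial>lborel)"
  proof -
    have "cell z = cell (z + (0, \<tau>))" for z by (cases z) (auto simp: indicator_def)
    then have "(\<integral>z. cell z * (v (z + (0, \<tau>)) * \<phi> z) \<partial>lborel)
      = (\<integral>z. cell (z + (0, \<tau>)) * (v (z + (0, \<tau>)) * \<phi> (z + (0, \<tau>) - (0, \<tau>))) \<partial>lborel)" by simp
    also have "\<dots> = (\<integral>z. cell z * (v z * \<phi> (z - (0, \<tau>))) \<partial>lborel)"
      by (rule integral_lborel_translate[where h="\<lambda>z. cell z * (v z * \<phi> (z - (0, \<tau>)))"]) measurable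
    finally show ?thesis .
  qed
  have x_shift: "(\<integral>z. cell z * (A (q (z - (h, 0))) * \<phi> z) \<partial>lborel) = (\<integral>z. cell z * (A (q z) * \<phi> (z + (h, 0))) \<partial>lborel)"
  proof -
    have "(\<integral>z. cell z * (A (q (z + (h, 0) - (h, 0))) * \<phi> (z + (h, 0))) \<partial>lborel) = (\<integral>z. cell z * (A (q (z - (h, 0))) * \<phi> z) \<partial>lborel)"
    proof (rule integral_periodic_shift[where R=R and B="(\<bar>A 0\<bar> + KK) * B\<phi>" and F="\<lambda>z. A (q (z - (h, 0))) * \<phi> z"])
      fix z :: "real \<times> real"
      obtain x t where z: "z = (x, t)" by (cases z)
      have "pN N (x + 1 - h) t = pN N (x - h) t" using pN_per[OF gd, of "x - h" t] by (simp add: algebra_simps)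
      then show "A (q (z + (1, 0) - (h, 0))) * \<phi> (z + (1, 0)) = A (q (z - (h, 0))) * \<phi> z"
        by (simp add: z perphi q_def)
    qed (use far h in \<open>auto simp: abs_mult intro!: mult_mono Ab bphi A0\<close>)
    then show ?thesis by simp
  qed
  \<comment> \<open>For t < 0 the backward extension does not satisfy the scheme, but there \<phi>
    vanishes and both sides are 0.\<close>
  have pointwise: "(v (z + (0, \<tau>)) * \<phi> z - v z * \<phi> z) / \<tau>
      = (A (q z) * \<phi> z - A (q (z - (h, 0))) * \<phi> z) / h + \<gamma> z * G (q z) * \<phi> z" for z
  proof -
    obtain x t where z: "z = (x, t)" by (cases z)
    show ?thesis
    proof (cases "0 \<le> t")
      case True
      have "(v (z + (0, \<tau>)) - v z) * (1 / \<tau>) = 1 / h * (A (q z) - A (q (z - (h, 0)))) + \<gamma> z * G (q z)"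
        unfolding tau(3) h(3)
        using uN_step[OF gd True, of x] by (simp add: z v_def q_def \<gamma>_def \<tau>_def h_def)
      then have "(v (z + (0, \<tau>)) - v z) * (1 / \<tau>) * \<phi> z = (1 / h * (A (q z) - A (q (z - (h, 0)))) + \<gamma> z * G (q z)) * \<phi> z"
        by simp
      then show ?thesis by (simp add: algebra_simps diff_divide_distrib)
    next
      case False
      then show ?thesis using z0[of t x] by (simp add: z)
    qed
  qed
  let ?I = "\<lambda>F. (\<integral>z. cell z * F z \<partial>lborel)"
  have "(?I (\<lambda>z. v (z + (0, \<tau>)) * \<phi> z) - ?I (\<lambda>z. v z * \<phi> z)) / \<tau>
     = (\<integral>z. cell z * ((v (z + (0, \<tau>)) * \<phi> z - v z * \<phi> z) / \<tau>) \<partial>lborel)"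
    by (subst Bochner_Integration.integral_diff[symmetric, OF i1 i2], subst integral_divide_zero[symmetric])
      (simp add: algebra_simps)
  also have "\<dots> = (\<integral>z. (cell z * (A (q z) * \<phi> z) - cell z * (A (q (z - (h, 0))) * \<phi> z)) / h + cell z * (\<gamma> z * G (q z) * \<phi> z) \<partial>lborel)"
    unfolding pointwise by (simp add: algebra_simps diff_divide_distrib)
  also have "\<dots> = (\<integral>z. (cell z * (A (q z) * \<phi> z) - cell z * (A (q (z - (h, 0))) * \<phi> z)) / h \<partial>lborel) + ?I (\<lambda>z. \<gamma> z * G (q z) * \<phi> z)"
    by (intro Bochner_Integration.integral_add integrable_divide_zero Bochner_Integration.integrable_diff j1 j2 l)
  also have "(\<integral>z. (cell z * (A (q z) * \<phi> z) - cell z * (A (q (z - (h, 0))) * \<phi> z)) / h \<partial>lborel)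
     = (?I (\<lambda>z. A (q z) * \<phi> z) - ?I (\<lambda>z. A (q (z - (h, 0))) * \<phi> z)) / h"
    unfolding integral_divide_zero by (simp only: Bochner_Integration.integral_diff[OF j1 j2])
  finally have eq: "(?I (\<lambda>z. v z * \<phi> (z - (0, \<tau>))) - ?I (\<lambda>z. v z * \<phi> z)) / \<tau>
     = (?I (\<lambda>z. A (q z) * \<phi> z) - ?I (\<lambda>z. A (q z) * \<phi> (z + (h, 0)))) / h + ?I (\<lambda>z. \<gamma> z * G (q z) * \<phi> z)"
    unfolding t_shift x_shift .
  have "(\<integral>z. cell z * (v z * ((\<phi> (z - (0, \<tau>)) - \<phi> z) / \<tau>)
      + A (q z) * ((\<phi> (z + (h, 0)) - \<phi> z) / h) - \<gamma> z * G (q z) * \<phi> z) \<partial>lborel)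
    = (\<integral>z. ((cell z * (v z * \<phi> (z - (0, \<tau>))) - cell z * (v z * \<phi> z)) / \<tau>
        + (cell z * (A (q z) * \<phi> (z + (h, 0))) - cell z * (A (q z) * \<phi> z)) / h) - cell z * (\<gamma> z * G (q z) * \<phi> z) \<partial>lborel)"
    by (simp add: algebra_simps diff_divide_distrib)
  also have "\<dots> = ((?I (\<lambda>z. v z * \<phi> (z - (0, \<tau>))) - ?I (\<lambda>z. v z * \<phi> z)) / \<tau>
     + (?I (\<lambda>z. A (q z) * \<phi> (z + (h, 0))) - ?I (\<lambda>z. A (q z) * \<phi> z)) / h) - ?I (\<lambda>z. \<gamma> z * G (q z) * \<phi> z)"
    by (subst Bochner_Integration.integral_diff, intro Bochner_Integration.integrable_add integrable_divide_zero Bochner_Integration.integrable_diff i1' i2 j1 j2', rule l,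
        subst Bochner_Integration.integral_add, intro integrable_divide_zero Bochner_Integration.integrable_diff i1' i2,
        intro integrable_divide_zero Bochner_Integration.integrable_diff j1 j2',
        unfold integral_divide_zero Bochner_Integration.integral_diff[OF i1' i2] Bochner_Integration.integral_diff[OF j2' j1]) simp
  also have "\<dots> = 0" unfolding eq by (simp add: diff_divide_distrib)
  finally show ?thesis unfolding v_def q_def \<gamma>_def .
qed

text \<open>Every discrete integral is 0, and a multiple of the indicator of a bounded part of the
  cell dominates all integrands. They converge almost everywhere, the exceptional points coming from
  the averages of g alone; the nonlinear terms pass by continuity of \<open>A\<close> and
  \<open>G\<close> and pointwise convergence of the slopes.\<close>

lemma limit_weak_form:
  assumes r: "strict_mono r" and gd: "\<And>k. good (r k)"
    and u: "\<And>x t. (\<lambda>k. uN (r k) x t) \<longlonglongrightarrow> u x t" and p: "\<And>x t. (\<lambda>k. pN (r k) x t) \<longlonglongrightarrow> p x t"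
    and test: "per_test T \<phi> \<phi>x \<phi>t"
  shows "integrable lborel (\<lambda>z. cell z * (- (u (fst z) (snd z) * \<phi>t z) + A (p (fst z) (snd z)) * \<phi>x z
      - g (fst z) * G (p (fst z) (snd z)) * \<phi> z))" (is "integrable _ ?f")
    and "(\<integral>z. cell z * (- (u (fst z) (snd z) * \<phi>t z) + A (p (fst z) (snd z)) * \<phi>x z
      - g (fst z) * G (p (fst z) (snd z)) * \<phi> z) \<partial>lborel) = 0"
proof -
  obtain B\<phi> where Bp: "0 \<le> B\<phi>" and bphi: "\<And>x t. 0 \<le> x \<Longrightarrow> x \<le> 2 \<Longrightarrow> \<bar>\<phi> (x, t)\<bar> \<le> B\<phi>"
    and bx: "\<And>x t. 0 \<le> x \<Longrightarrow> x \<le> 2 \<Longrightarrow> \<bar>\<phi>x (x, t)\<bar> \<le> B\<phi>"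
    and bt: "\<And>x t. 0 \<le> x \<Longrightarrow> x \<le> 2 \<Longrightarrow> \<bar>\<phi>t (x, t)\<bar> \<le> B\<phi>"
    and z0: "\<And>x t. t \<notin> {0<..<T} \<Longrightarrow> \<phi> (x, t) = 0"
    using per_test_bounds[OF test] by metis
  have d: "\<And>z. (\<phi> has_derivative (\<lambda>h. fst h * \<phi>x z + snd h * \<phi>t z)) (at z)"
    and cx: "continuous_on UNIV \<phi>x" and ct: "continuous_on UNIV \<phi>t" using test by (auto simp: per_test_def)
  note c\<phi> = partial_derivs_continuous[OF d]
  define \<tau> where "\<tau> k = 1 / (4 * (real (r k))\<^sup>2)" for k
  define h where "h k = 1 / real (r k)" for k
  have tau: "0 < \<tau> k" "\<tau> k \<le> 1" and h: "0 < h k" "h k \<le> 1" for k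
    unfolding \<tau>_def h_def by (rule good_steps[OF gd])+
  have h0: "h \<longlonglongrightarrow> 0" and tau0: "\<tau> \<longlonglongrightarrow> 0"
    unfolding h_def[abs_def] \<tau>_def[abs_def] using grid_steps_tendsto_0[OF r] by auto
  define v where "v k z = uN (r k) (fst z) (snd z)" for k and z :: "real \<times> real"
  define q where "q k z = pN (r k) (fst z) (snd z)" for k and z :: "real \<times> real"
  define \<gamma> where "\<gamma> k z = g_avg (r k) (real_of_int \<lfloor>real (r k) * fst z\<rfloor> / real (r k))" for k and z :: "real \<times> real"
  have m[measurable]: "v k \<in> borel_measurable borel" "q k \<in> borel_measurable borel" "\<gamma> k \<in> borel_measurable borel" for k
    unfolding v_def[abs_def] q_def[abs_def] \<gamma>_def[abs_def] by (rule measurable_uN measurable_pN measurable_g_floor)+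
  have [measurable]: "\<phi> \<in> borel_measurable borel" "\<phi>x \<in> borel_measurable borel" "\<phi>t \<in> borel_measurable borel"
    using c\<phi> cx ct by (auto intro: borel_measurable_continuous_onI)
  have Am[measurable]: "A \<in> borel_measurable borel" "G \<in> borel_measurable borel"
    using continuous_A continuous_G by (auto intro: borel_measurable_continuous_onI)
  have um[measurable]: "(\<lambda>z. u (fst z) (snd z)) \<in> borel_measurable borel" "(\<lambda>z. p (fst z) (snd z)) \<in> borel_measurable borel"
    using borel_measurable_LIMSEQ_real[where u=v and u'="\<lambda>z. u (fst z) (snd z)" and M=borel]
      borel_measurable_LIMSEQ_real[where u=q and u'="\<lambda>z. p (fst z) (snd z)" and M=borel] u p m
    by (simp_all add: v_def q_def)
  have gm[measurable]: "(\<lambda>z::real \<times> real. g (fst z)) \<in> borel_measurable borel"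
    by (rule measurable_compose[OF _ g_meas]) (simp add: borel_prod[symmetric])
  define R where "R = \<bar>T\<bar> + 1"
  have far: "\<phi> (x, t) = 0" "\<phi> (x, t - \<tau> k) = 0" if "\<not> \<bar>t\<bar> \<le> R" for x t k
    using that tau[of k] by (auto simp: R_def intro!: z0)
  have uB0: "0 \<le> uB (3, R + 1)" using uB_pos less_imp_le by blast
  have A0: "0 \<le> \<bar>A 0\<bar> + KK" using KK_nonneg by linarith
  have MB: "0 \<le> M * B" using M_nonneg B_nonneg by simp
  \<comment> \<open>The sum of the bounds of the three terms; the quotients of \<phi> are controlled
    by its partial derivatives through the mean value estimate.\<close>
  define W where "W = uB (3, R + 1) * B\<phi> + (\<bar>A 0\<bar> + KK) * B\<phi> + M * B * B\<phi>"
  have W0: "0 \<le> W" unfolding W_def using uB0 A0 MB Bp by simp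
  define E where "E k z = cell z * (v k z * ((\<phi> (z - (0, \<tau> k)) - \<phi> z) / \<tau> k)
      + A (q k z) * ((\<phi> (z + (h k, 0)) - \<phi> z) / h k) - \<gamma> k z * G (q k z) * \<phi> z)" for k z
  have E0: "(\<integral>z. E k z \<partial>lborel) = 0" for k
    using discrete_weak_form[OF gd[of k] test]
    unfolding E_def v_def q_def \<gamma>_def \<tau>_def h_def .
  have Em: "E k \<in> borel_measurable lborel" for k unfolding E_def[abs_def] by measurable
  have fm: "?f \<in> borel_measurable lborel" by measurable
  have dom: "AE z in lborel. norm (E k z) \<le> cell z * (W * indicator {z. \<bar>snd z\<bar> \<le> R} z)" for k
  proof (intro AE_I2)
    fix z :: "real \<times> real"
    obtain x t where z: "z = (x, t)" by (cases z)
    show "norm (E k z) \<le> cell z * (W * indicator {z. \<bar>snd z\<bar> \<le> R} z)"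
    proof (cases "0 \<le> x \<and> x < 1")
      case x: True
      show ?thesis
      proof (cases "\<bar>t\<bar> \<le> R")
        case True
        have "\<bar>\<phi> (x, t - \<tau> k) - \<phi> (x, t)\<bar> \<le> B\<phi> * \<bar>t - \<tau> k - t\<bar>"
          by (rule lipschitz_from_deriv[where a="t - \<tau> k" and b=t and f="\<lambda>s. \<phi> (x, s)" and f'="\<lambda>s. \<phi>t (x, s)"])
            (use partial_derivs(2)[OF d] bt x tau[of k] in auto)
        then have 1: "\<bar>(\<phi> (x, t - \<tau> k) - \<phi> (x, t)) / \<tau> k\<bar> \<le> B\<phi>"
          using tau(1)[of k] by (simp add: abs_divide divide_le_eq)
        have "\<bar>\<phi> (x + h k, t) - \<phi> (x, t)\<bar> \<le> B\<phi> * \<bar>x + h k - x\<bar>"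
          by (rule lipschitz_from_deriv[where a=x and b="x + h k" and f="\<lambda>s. \<phi> (s, t)" and f'="\<lambda>s. \<phi>x (s, t)"])
            (use partial_derivs(1)[OF d] bx x h[of k] in auto)
        then have 2: "\<bar>(\<phi> (x + h k, t) - \<phi> (x, t)) / h k\<bar> \<le> B\<phi>"
          using h(1)[of k] by (simp add: abs_divide divide_le_eq)
        have v: "\<bar>v k (x, t)\<bar> \<le> uB (3, R + 1)"
          using order_trans[OF uN_bound[OF gd] uB_mono[of x 3 t "R + 1"]] x True by (simp add: v_def)
        have "\<bar>v k (x, t) * ((\<phi> (x, t - \<tau> k) - \<phi> (x, t)) / \<tau> k)\<bar> \<le> uB (3, R + 1) * B\<phi>"
          unfolding abs_mult by (rule mult_mono[OF v 1 uB0]) simp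
        moreover have "\<bar>A (q k (x, t)) * ((\<phi> (x + h k, t) - \<phi> (x, t)) / h k)\<bar> \<le> (\<bar>A 0\<bar> + KK) * B\<phi>"
          unfolding abs_mult q_def by (rule mult_mono[OF A_bound[OF pN_bound[OF gd]] 2 A0]) simp
        moreover have "\<bar>\<gamma> k (x, t) * G (q k (x, t)) * \<phi> (x, t)\<bar> \<le> M * B * B\<phi>"
          unfolding abs_mult \<gamma>_def
          by (intro mult_mono g_avg_bound G_bound bphi M_nonneg MB good_pos[OF gd] mult_nonneg_nonneg) (use x in auto)
        moreover have "\<bar>a1 + a2 - a3\<bar> \<le> b1 + b2 + b3" if "\<bar>a1\<bar> \<le> b1" "\<bar>a2\<bar> \<le> b2" "\<bar>a3\<bar> \<le> b3" for a1 a2 a3 b1 b2 b3 :: real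
          using that by linarith
        ultimately have "\<bar>v k (x, t) * ((\<phi> (x, t - \<tau> k) - \<phi> (x, t)) / \<tau> k) + A (q k (x, t)) * ((\<phi> (x + h k, t) - \<phi> (x, t)) / h k)
           - \<gamma> k (x, t) * G (q k (x, t)) * \<phi> (x, t)\<bar> \<le> W"
          unfolding W_def by blast
        then show ?thesis using x True by (simp add: E_def z)
      next
        case False
        then show ?thesis by (simp add: E_def z far)
      qed
    qed (simp add: E_def z)
  qed
  have mR: "{z::real \<times> real. \<bar>snd z\<bar> \<le> R} \<in> sets borel"
  proof -
    have "closed {z::real \<times> real. \<bar>snd z\<bar> \<le> R}" by (intro closed_Collect_le continuous_intros)
    then show ?thesis by simp
  qed
  have di: "integrable lborel (\<lambda>z. cell z * (W * indicator {z. \<bar>snd z\<bar> \<le> R} z))"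
  proof (rule integrable_slab[where R=R and B=W])
    show "(\<lambda>z::real \<times> real. W * indicator {z. \<bar>snd z\<bar> \<le> R} z) \<in> borel_measurable borel"
      using mR by (intro borel_measurable_times borel_measurable_const borel_measurable_indicator)
  qed (use W0 in auto)
  have gAE: "AE z in lborel. (\<lambda>k. \<gamma> k z) \<longlonglongrightarrow> g (fst z)"
    unfolding \<gamma>_def by (rule AE_lborel_fst[OF g_avg_tendsto_AE[OF r gd]])
  have lim: "AE z in lborel. (\<lambda>k. E k z) \<longlonglongrightarrow> ?f z"
    using gAE
  proof eventually_elim
    case (elim z)
    obtain x t where z: "z = (x, t)" by (cases z)
    \<comment> \<open>The time quotient of \<phi> is backward, so the derivative is taken along
      negative steps; the change of sign then produces the minus in front of \<phi>t.\<close>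
    have 1: "(\<lambda>k. (\<phi> (x, t + (- \<tau> k)) - \<phi> (x, t)) / (- \<tau> k)) \<longlonglongrightarrow> \<phi>t (x, t)"
      by (rule DERIV_quotient_sequence[OF partial_derivs(2)[OF d], of "\<lambda>k. - \<tau> k"])
        (use tendsto_minus[OF tau0] tau(1) in \<open>auto simp: less_imp_neq[symmetric]\<close>)
    have 2: "(\<lambda>k. (\<phi> (x + h k, t) - \<phi> (x, t)) / h k) \<longlonglongrightarrow> \<phi>x (x, t)"
      by (rule DERIV_quotient_sequence[OF partial_derivs(1)[OF d] h0]) (use h(1) in \<open>auto simp: less_imp_neq[symmetric]\<close>)
    have 3: "(\<lambda>k. A (q k z)) \<longlonglongrightarrow> A (p (fst z) (snd z))" "(\<lambda>k. G (q k z)) \<longlonglongrightarrow> G (p (fst z) (snd z))"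
      unfolding q_def
      by (rule continuous_on_tendsto_compose[OF continuous_A p] continuous_on_tendsto_compose[OF continuous_G p]; simp)+
    have 4: "(\<lambda>k. v k z) \<longlonglongrightarrow> u (fst z) (snd z)" unfolding v_def by (rule u)
    have 5: "(\<lambda>k. (\<phi> (z - (0, \<tau> k)) - \<phi> z) / \<tau> k) \<longlonglongrightarrow> - \<phi>t z" using tendsto_minus[OF 1] by (simp add: z)
    have 6: "(\<lambda>k. (\<phi> (z + (h k, 0)) - \<phi> z) / h k) \<longlonglongrightarrow> \<phi>x z" using 2 by (simp add: z)
    have "(\<lambda>k. E k z) \<longlonglongrightarrow> cell z * (u (fst z) (snd z) * - \<phi>t z + A (p (fst z) (snd z)) * \<phi>x z
      - g (fst z) * G (p (fst z) (snd z)) * \<phi> z)"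
      unfolding E_def by (intro tendsto_intros 3 4 5 6 elim)
    then show ?case by simp
  qed
  show "integrable lborel ?f" by (rule integrable_dominated_convergence[OF fm Em di lim dom])
  have "(\<lambda>k. \<integral>z. E k z \<partial>lborel) \<longlonglongrightarrow> (\<integral>z. ?f z \<partial>lborel)"
    by (rule integral_dominated_convergence[OF fm Em di lim dom])
  then show "(\<integral>z. ?f z \<partial>lborel) = 0" by (simp add: E0 LIMSEQ_const_iff)
qed

text \<open>All estimates survive pointwise limits and lose their mesh terms. The Taylor estimate
  identifies p as the x-derivative of u at every point, and the Lipschitz bound on p in x is what
  remains of the bound on second differences.\<close>

lemma exists_solution:
  obtains u p where "(\<lambda>z. p (fst z) (snd z)) \<in> borel_measurable borel"
    "\<And>x t y s. \<bar>u x t - u y s\<bar> \<le> KK * \<bar>x - y\<bar> + CC * \<bar>t - s\<bar>"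
    "\<And>x t. u (x + 1) t = u x t" "\<And>x t. t \<le> 0 \<Longrightarrow> u x t = w x"
    "\<And>x t. \<bar>p x t\<bar> \<le> KK" "\<And>x y t. \<bar>p x t - p y t\<bar> \<le> KK * \<bar>x - y\<bar>"
    "\<And>x y t. x \<le> y \<Longrightarrow> \<bar>u y t - u x t - (y - x) * p x t\<bar> \<le> KK * (y - x)\<^sup>2"
    "\<And>T \<phi> \<phi>x \<phi>t. per_test T \<phi> \<phi>x \<phi>t \<Longrightarrow> integrable lborel (\<lambda>z. cell z * (- (u (fst z) (snd z) * \<phi>t z)
      + A (p (fst z) (snd z)) * \<phi>x z - g (fst z) * G (p (fst z) (snd z)) * \<phi> z))"
    "\<And>T \<phi> \<phi>x \<phi>t. per_test T \<phi> \<phi>x \<phi>t \<Longrightarrow> (\<integral>z. cell z * (- (u (fst z) (snd z) * \<phi>t z)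
      + A (p (fst z) (snd z)) * \<phi>x z - g (fst z) * G (p (fst z) (snd z)) * \<phi> z) \<partial>lborel) = 0"
proof -
  obtain r u p where r: "strict_mono (r :: nat \<Rightarrow> nat)" and gd: "\<And>k. good (r k)"
    and u: "\<And>x t. (\<lambda>k. uN (r k) x t) \<longlonglongrightarrow> u x t" and p: "\<And>x t. (\<lambda>k. pN (r k) x t) \<longlonglongrightarrow> p x t"
    using exists_limit by blast
  note h0 = grid_steps_tendsto_0(1)[OF r] and tau0 = grid_steps_tendsto_0(2)[OF r]
  show ?thesis
  proof (rule that[of p u])
    show "(\<lambda>z. p (fst z) (snd z)) \<in> borel_measurable borel"
      by (rule borel_measurable_LIMSEQ_real[where u="\<lambda>k z. pN (r k) (fst z) (snd z)"]) (use p measurable_pN in auto)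
    fix x t y s :: real
    have "(\<lambda>k. KK * (\<bar>x - y\<bar> + 1 / real (r k)) + CC * (\<bar>t - s\<bar> + 1 / (4 * (real (r k))\<^sup>2))) \<longlonglongrightarrow> KK * (\<bar>x - y\<bar> + 0) + CC * (\<bar>t - s\<bar> + 0)"
      by (intro tendsto_intros h0 tau0)
    moreover have "(\<lambda>k. \<bar>uN (r k) x t - uN (r k) y s\<bar>) \<longlonglongrightarrow> \<bar>u x t - u y s\<bar>"
      by (intro tendsto_intros u)
    ultimately have "\<bar>u x t - u y s\<bar> \<le> KK * (\<bar>x - y\<bar> + 0) + CC * (\<bar>t - s\<bar> + 0)"
      using uN_lipschitz[OF gd] by (intro LIMSEQ_le) auto
    then show "\<bar>u x t - u y s\<bar> \<le> KK * \<bar>x - y\<bar> + CC * \<bar>t - s\<bar>" by simp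
    show "u (x + 1) t = u x t" using LIMSEQ_unique[OF u[of "x + 1" t]] u[of x t] by (simp add: uN_per[OF gd])
    show "\<bar>p x t\<bar> \<le> KK"
      by (rule LIMSEQ_le_const2[OF tendsto_rabs[OF p]]) (use pN_bound[OF gd] in auto)
    have "(\<lambda>k. KK * (\<bar>x - y\<bar> + 1 / real (r k))) \<longlonglongrightarrow> KK * (\<bar>x - y\<bar> + 0)"
      by (intro tendsto_intros h0)
    moreover have "(\<lambda>k. \<bar>pN (r k) x t - pN (r k) y t\<bar>) \<longlonglongrightarrow> \<bar>p x t - p y t\<bar>"
      by (intro tendsto_intros p)
    ultimately have "\<bar>p x t - p y t\<bar> \<le> KK * (\<bar>x - y\<bar> + 0)"
      using pN_lipschitz[OF gd] by (intro LIMSEQ_le) auto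
    then show "\<bar>p x t - p y t\<bar> \<le> KK * \<bar>x - y\<bar>" by simp
  next
    fix x t :: real assume t: "t \<le> 0"
    have "(\<lambda>k. w (real_of_int \<lfloor>real (r k) * x\<rfloor> / real (r k))) \<longlonglongrightarrow> w x"
    proof (rule continuous_on_tendsto_compose[where s=UNIV and f=w])
      show "continuous_on UNIV w" using w_deriv by (intro continuous_at_imp_continuous_on ballI DERIV_isCont)
      have "(\<lambda>k. real_of_int \<lfloor>real (r k) * x\<rfloor> / real (r k) - x) \<longlonglongrightarrow> 0"
      proof (rule Lim_null_comparison[OF _ h0], intro always_eventually allI)
        fix k
        have rp: "real (r k) > 0" using good_pos(2)[OF gd] .
        have "\<bar>real_of_int \<lfloor>real (r k) * x\<rfloor> - real (r k) * x\<bar> \<le> 1" by linarith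
        then have "\<bar>real_of_int \<lfloor>real (r k) * x\<rfloor> - real (r k) * x\<bar> / real (r k) \<le> 1 / real (r k)"
          using rp by (intro divide_right_mono) auto
        moreover have "real_of_int \<lfloor>real (r k) * x\<rfloor> / real (r k) - x = (real_of_int \<lfloor>real (r k) * x\<rfloor> - real (r k) * x) / real (r k)"
          using rp by (simp add: diff_divide_distrib)
        ultimately show "norm (real_of_int \<lfloor>real (r k) * x\<rfloor> / real (r k) - x) \<le> 1 / real (r k)"
          by (simp only: real_norm_def abs_divide abs_of_nat)
      qed
      then show "(\<lambda>k. real_of_int \<lfloor>real (r k) * x\<rfloor> / real (r k)) \<longlonglongrightarrow> x" by (rule LIM_zero_cancel)
    qed auto
    then show "u x t = w x" using LIMSEQ_unique[OF u[of x t]] by (simp add: uN_initial[OF gd t])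
  next
    fix x y t :: real assume xy: "x \<le> y"
    have "(\<lambda>k. KK * (y - x + 1 / real (r k))\<^sup>2 + KK * (1 / real (r k))) \<longlonglongrightarrow> KK * (y - x + 0)\<^sup>2 + KK * 0"
      by (intro tendsto_intros h0)
    moreover have "(\<lambda>k. \<bar>uN (r k) y t - uN (r k) x t - (y - x) * pN (r k) x t\<bar>) \<longlonglongrightarrow> \<bar>u y t - u x t - (y - x) * p x t\<bar>"
      by (intro tendsto_intros u p)
    ultimately have "\<bar>u y t - u x t - (y - x) * p x t\<bar> \<le> KK * (y - x + 0)\<^sup>2 + KK * 0"
      using uN_taylor[OF gd xy] by (intro LIMSEQ_le) auto
    then show "\<bar>u y t - u x t - (y - x) * p x t\<bar> \<le> KK * (y - x)\<^sup>2" by simp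
  qed (use limit_weak_form[OF r gd u p] in auto)
qed

end

section \<open>Weak solutions\<close>

text \<open>The notions of solution are phrased with \<open>lebesgue\<close>, while the constructed
  functions are Borel and the given g is only Lebesgue measurable. Completeness makes an
  almost-everywhere modification of a Borel function measurable, with the same integral.\<close>

lemma lebesgue_AE_transfer:
  fixes f F :: "'a::euclidean_space \<Rightarrow> real"
  assumes F: "integrable lborel F" and ae: "AE z in lborel. f z = F z"
  shows "integrable lebesgue f" "(\<integral>z. f z \<partial>lebesgue) = (\<integral>z. F z \<partial>lborel)"
proof -
  have Fm: "F \<in> borel_measurable lborel" using F by (rule borel_measurable_integrable)
  then have FL: "F \<in> borel_measurable lebesgue" by (rule measurable_completion)
  obtain Z where Z: "Z \<in> null_sets lborel" "\<And>z. z \<notin> Z \<Longrightarrow> f z = F z"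
    using ae by (auto elim!: AE_E3)
  have ZL: "Z \<in> null_sets lebesgue" using Z(1) by (rule null_sets_completionI)
  have fm: "f \<in> borel_measurable lebesgue"
  proof (rule borel_measurableI)
    fix S :: "real set" assume "open S"
    then have 1: "F -` S \<in> sets lebesgue" using measurable_sets[OF FL, of S] by (simp add: space_completion)
    have 2: "f -` S \<inter> Z \<in> sets lebesgue"
      using null_sets_completion_subset[OF _ ZL, of "f -` S \<inter> Z"] by auto
    have "f -` S \<inter> space lebesgue = (F -` S - Z) \<union> (f -` S \<inter> Z)" using Z(2) by auto
    also have "\<dots> \<in> sets lebesgue" by (rule sets.Un[OF sets.Diff[OF 1 null_setsD2[OF ZL]] 2])
    finally show "f -` S \<inter> space lebesgue \<in> sets lebesgue" .
  qed
  have ae': "AE z in lebesgue. F z = f z" using AE_completion[OF ae] by (auto elim: eventually_mono)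
  show "integrable lebesgue f"
    by (rule integrable_cong_AE_imp[OF _ fm]) (use F Fm ae' in \<open>auto simp: integrable_completion\<close>)
  have "(\<integral>z. f z \<partial>lebesgue) = (\<integral>z. F z \<partial>lebesgue)"
    by (rule integral_cong_AE[OF fm FL]) (use ae' in \<open>auto elim: eventually_mono\<close>)
  then show "(\<integral>z. f z \<partial>lebesgue) = (\<integral>z. F z \<partial>lborel)" using Fm by (simp add: integral_completion)
qed

lemma integrable_bounded_set:
  fixes F :: "'a::euclidean_space \<Rightarrow> real"
  assumes [measurable]: "F \<in> borel_measurable borel" "S \<in> sets borel"
    and S: "bounded S" and b: "\<And>z. z \<in> S \<Longrightarrow> \<bar>F z\<bar> \<le> B"
  shows "integrable lborel (\<lambda>z. indicator S z * F z)"
proof -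
  obtain r where r: "\<And>z. z \<in> S \<Longrightarrow> norm z \<le> r" using S by (auto simp: bounded_iff)
  show ?thesis
    by (rule integrable_bounded_support[where r=r and B="\<bar>B\<bar>"])
      (use b r in \<open>auto simp: indicator_def not_le[symmetric] intro: order_trans[OF _ abs_ge_self]\<close>)
qed

lemma set_integrable_lebesgue_bounded:
  fixes F :: "'a::euclidean_space \<Rightarrow> real"
  assumes "F \<in> borel_measurable borel" "S \<in> sets borel" "bounded S" "\<And>z. z \<in> S \<Longrightarrow> \<bar>F z\<bar> \<le> B"
  shows "set_integrable lebesgue S F"
  unfolding set_integrable_def using lebesgue_AE_transfer(1)[OF integrable_bounded_set[OF assms]] by simp

lemma Linf_on_bounded:
  assumes "F \<in> borel_measurable borel" "S \<in> sets borel" "\<And>z. z \<in> S \<Longrightarrow> \<bar>F z\<bar> \<le> B"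
  shows "Linf_on S F"
  unfolding Linf_on_def set_borel_measurable_def using assms
  by (auto intro!: measurable_completion exI[of _ B])

lemma L2_on_bounded:
  assumes [measurable]: "F \<in> borel_measurable borel" and S: "S \<in> sets borel" "bounded S" "\<And>z. z \<in> S \<Longrightarrow> \<bar>F z\<bar> \<le> B"
  shows "L2_on S F"
proof -
  have "set_integrable lebesgue S (\<lambda>z. (F z)\<^sup>2)"
  proof (rule set_integrable_lebesgue_bounded[where B="B\<^sup>2"])
    fix z assume "z \<in> S"
    then have "\<bar>F z\<bar> \<le> \<bar>B\<bar>" using S(3) by (intro order_trans[OF _ abs_ge_self])
    then show "\<bar>(F z)\<^sup>2\<bar> \<le> B\<^sup>2" by (simp add: abs_le_square_iff)
  qed (use S in auto)
  then show ?thesis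
    unfolding L2_on_def set_borel_measurable_def using S(1) by (auto intro!: measurable_completion)
qed

lemma loc_int_on_bounded:
  assumes "F \<in> borel_measurable borel" "\<And>r. \<exists>B. \<forall>z. norm z \<le> r \<longrightarrow> \<bar>F z\<bar> \<le> B"
  shows "loc_int_on U F"
  unfolding loc_int_on_def
proof (intro allI impI)
  fix K assume K: "compact K \<and> K \<subseteq> U"
  then have "bounded K" by (simp add: compact_imp_bounded)
  then obtain r where r: "\<And>z. z \<in> K \<Longrightarrow> norm z \<le> r" by (auto simp: bounded_iff)
  obtain B where "\<And>z. norm z \<le> r \<Longrightarrow> \<bar>F z\<bar> \<le> B" using assms(2) by blast
  then show "set_integrable lebesgue K F"
    using K r assms(1) by (intro set_integrable_lebesgue_bounded[where B=B]) (auto simp: compact_imp_bounded borel_compact)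
qed

text \<open>Since \<phi> has compact support in U, integrals over U are integrals over the plane,
  where the directional formula applies. Thus the almost-everywhere directional derivative of a
  function that is Lipschitz along e is its weak derivative.\<close>

lemma test2_by_parts:
  assumes fm: "f \<in> borel_measurable borel" and fem: "fe \<in> borel_measurable borel"
    and fb: "\<And>r. \<exists>B. \<forall>z. norm z \<le> r \<longrightarrow> \<bar>f z\<bar> \<le> B"
    and lipf: "\<And>z s. 0 \<le> s \<Longrightarrow> \<bar>f (z + s *\<^sub>R e) - f z\<bar> \<le> C * s"
    and convf: "AE z in lborel. (\<lambda>n. (f (z + (1 / real (Suc n)) *\<^sub>R e) - f z) * real (Suc n)) \<longlonglongrightarrow> fe z"
    and test: "test2 U \<phi> \<phi>x \<phi>t" and e: "e = (1, 0) \<and> \<phi>e = \<phi>x \<or> e = (0, 1) \<and> \<phi>e = \<phi>t"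
  shows "(LINT z:U|lebesgue. f z * \<phi>e z) = - (LINT z:U|lebesgue. fe z * \<phi> z)"
proof -
  have d: "\<And>z. (\<phi> has_derivative (\<lambda>h. fst h * \<phi>x z + snd h * \<phi>t z)) (at z)"
    and cx: "continuous_on UNIV \<phi>x" and ct: "continuous_on UNIV \<phi>t" using test by (auto simp: test2_def)
  obtain K where K: "compact K" "K \<subseteq> U" and zero: "\<And>z. z \<notin> K \<Longrightarrow> \<phi> z = 0" using test by (auto simp: test2_def)
  note c = partial_derivs_continuous[OF d]
  have ce: "continuous_on UNIV \<phi>e" using e cx ct by auto
  have [measurable]: "\<phi> \<in> borel_measurable borel" "\<phi>e \<in> borel_measurable borel"
    using c ce by (auto intro: borel_measurable_continuous_onI)
  have zero': "\<phi>e z = 0" if "z \<notin> K" for z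
    using partial_derivs_zero[OF d compact_imp_closed[OF K(1)] zero that] e by auto
  have bK: "\<exists>B. \<forall>z\<in>K. \<bar>F z\<bar> \<le> B" if "continuous_on UNIV F" for F :: "real \<times> real \<Rightarrow> real"
    using compact_imp_bounded[OF compact_continuous_image[OF continuous_on_subset[OF that] K(1)]]
    by (auto simp: bounded_iff)
  obtain B1 B2 where B: "\<And>z. z \<in> K \<Longrightarrow> \<bar>\<phi> z\<bar> \<le> B1" "\<And>z. z \<in> K \<Longrightarrow> \<bar>\<phi>e z\<bar> \<le> B2" using bK[OF c] bK[OF ce] by blast
  have b1: "\<bar>\<phi> z\<bar> \<le> \<bar>B1\<bar>" and b2: "\<bar>\<phi>e z\<bar> \<le> \<bar>B2\<bar>" for z
    using B[of z] zero[of z] zero'[of z] by (cases "z \<in> K"; auto)+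
  obtain r where r: "\<And>z. z \<in> K \<Longrightarrow> norm z \<le> r" 
    using compact_imp_bounded[OF K(1)] by (auto simp: bounded_iff)
  have dir: "((\<lambda>s. \<phi> (z + s *\<^sub>R e)) has_real_derivative \<phi>e (z + s *\<^sub>R e)) (at s)" for z s
  proof -
    have "((\<lambda>s. z + s *\<^sub>R e) has_derivative (\<lambda>h. h *\<^sub>R e)) (at s)" by (auto intro!: derivative_eq_intros)
    from has_derivative_compose[OF this d] e show ?thesis
      by (auto simp: has_field_derivative_def mult.commute[of _ "\<phi>x _"] mult.commute[of _ "\<phi>t _"])
  qed
  have lip: "\<bar>\<phi> (z - s *\<^sub>R e) - \<phi> z\<bar> \<le> \<bar>B2\<bar> * s" if "0 \<le> s" for z s
  proof -
    have "\<bar>\<phi> (z + (- s) *\<^sub>R e) - \<phi> (z + 0 *\<^sub>R e)\<bar> \<le> \<bar>B2\<bar> * \<bar>- s - 0\<bar>"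
      by (rule lipschitz_from_deriv[where a="- s" and b=0, OF dir b2]) (use that in auto)
    then show ?thesis using that by simp
  qed
  have conv: "(\<lambda>n. (\<phi> (z - (1 / real (Suc n)) *\<^sub>R e) - \<phi> z) * real (Suc n)) \<longlonglongrightarrow> - \<phi>e z" for z
  proof -
    have s0: "(\<lambda>n. - (1 / real (Suc n))) \<longlonglongrightarrow> 0"
      using tendsto_minus[OF LIMSEQ_inverse_real_of_nat] by (simp add: inverse_eq_divide)
    have "(\<lambda>n. (\<phi> (z + (0 + - (1 / real (Suc n))) *\<^sub>R e) - \<phi> (z + 0 *\<^sub>R e)) / - (1 / real (Suc n))) \<longlonglongrightarrow> \<phi>e (z + 0 *\<^sub>R e)"
      by (rule DERIV_quotient_sequence[OF dir s0]) simp
    from tendsto_minus[OF this] show ?thesis by simp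
  qed
  have supp: "\<phi> z = 0" if "r < norm z" for z using that r[of z] zero[of z] by fastforce
  note ibp = integral_directional_by_parts[OF fm _ _ fem fb lipf convf supp b1 lip conv]
  have 1: "(LINT z:U|lebesgue. f z * \<phi>e z) = (\<integral>z. f z * \<phi>e z \<partial>lborel)"
    unfolding set_lebesgue_integral_def
    by (rule lebesgue_AE_transfer(2)[OF ibp(2)]) (use zero' K(2) in \<open>auto simp: indicator_def intro!: AE_I2\<close>)
  have 2: "(LINT z:U|lebesgue. fe z * \<phi> z) = (\<integral>z. fe z * \<phi> z \<partial>lborel)"
    unfolding set_lebesgue_integral_def
    by (rule lebesgue_AE_transfer(2)[OF ibp(1)]) (use zero K(2) in \<open>auto simp: indicator_def intro!: AE_I2\<close>)
  show ?thesis unfolding 1 2 using ibp(3) by simp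
qed

text \<open>The test function is multiplied by the indicator of the cell. The product may jump in x
  but is Lipschitz and differentiable in t, which is what integration by parts in direction (0, 1)
  asks for.\<close>

lemma per_test_by_parts:
  assumes fm: "f \<in> borel_measurable borel" and fem: "fe \<in> borel_measurable borel"
    and fb: "\<And>r. \<exists>B. \<forall>z. norm z \<le> r \<longrightarrow> \<bar>f z\<bar> \<le> B"
    and lipf: "\<And>z s. 0 \<le> s \<Longrightarrow> \<bar>f (z + s *\<^sub>R (0, 1)) - f z\<bar> \<le> C * s"
    and convf: "AE z in lborel. (\<lambda>n. (f (z + (1 / real (Suc n)) *\<^sub>R (0, 1)) - f z) * real (Suc n)) \<longlonglongrightarrow> fe z"
    and test: "per_test T \<phi> \<phi>x \<phi>t"
  shows "integrable lborel (\<lambda>z. cell z * (fe z * \<phi> z))" "integrable lborel (\<lambda>z. cell z * (f z * \<phi>t z))"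
    "(\<integral>z. cell z * (fe z * \<phi> z) \<partial>lborel) = - (\<integral>z. cell z * (f z * \<phi>t z) \<partial>lborel)"
proof -
  obtain B where B0: "0 \<le> B" and bphi: "\<And>x t. 0 \<le> x \<Longrightarrow> x \<le> 2 \<Longrightarrow> \<bar>\<phi> (x, t)\<bar> \<le> B"
    and bt: "\<And>x t. 0 \<le> x \<Longrightarrow> x \<le> 2 \<Longrightarrow> \<bar>\<phi>t (x, t)\<bar> \<le> B"
    and z0: "\<And>x t. t \<notin> {0<..<T} \<Longrightarrow> \<phi> (x, t) = 0"
    using per_test_bounds[OF test] by metis
  have d: "\<And>z. (\<phi> has_derivative (\<lambda>h. fst h * \<phi>x z + snd h * \<phi>t z)) (at z)"
    and ct: "continuous_on UNIV \<phi>t" using test by (auto simp: per_test_def)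
  note c = partial_derivs_continuous[OF d]
  have [measurable]: "\<phi> \<in> borel_measurable borel" "\<phi>t \<in> borel_measurable borel"
    using c ct by (auto intro: borel_measurable_continuous_onI)
  define \<psi> where "\<psi> z = cell z * \<phi> z" for z
  define \<psi>' where "\<psi>' z = cell z * \<phi>t z" for z
  have m: "\<psi> \<in> borel_measurable borel" "\<psi>' \<in> borel_measurable borel"
    unfolding \<psi>_def[abs_def] \<psi>'_def[abs_def] by measurable
  have b: "\<bar>\<psi> z\<bar> \<le> B" for z
    using bphi[of "fst z" "snd z"] B0 by (cases z) (auto simp: \<psi>_def indicator_def)
  have supp: "\<psi> z = 0" if "1 + \<bar>T\<bar> < norm z" for z
  proof (cases z)
    case (Pair x t)
    have "norm z \<le> \<bar>x\<bar> + \<bar>t\<bar>" unfolding Pair using norm_Pair_le[of x t] by simp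
    then have "\<not> (0 \<le> x \<and> x < 1) \<or> t \<notin> {0<..<T}" using that by auto
    then show ?thesis using z0[of t x] by (auto simp: \<psi>_def Pair indicator_def)
  qed
  have lip: "\<bar>\<psi> (z - s *\<^sub>R (0, 1)) - \<psi> z\<bar> \<le> B * s" if s: "0 \<le> s" for z s
  proof (cases z)
    case (Pair x t)
    show ?thesis
    proof (cases "0 \<le> x \<and> x < 1")
      case True
      have "\<bar>\<phi> (x, t - s) - \<phi> (x, t)\<bar> \<le> B * \<bar>t - s - t\<bar>"
        by (rule lipschitz_from_deriv[where a="t - s" and b=t and f="\<lambda>s. \<phi> (x, s)", OF partial_derivs(2)[OF d]])
          (use bt True s in auto)
      then show ?thesis using True s by (simp add: \<psi>_def Pair)
    qed (use B0 s in \<open>auto simp: \<psi>_def Pair indicator_def\<close>)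
  qed
  have conv: "(\<lambda>n. (\<psi> (z - (1 / real (Suc n)) *\<^sub>R (0, 1)) - \<psi> z) * real (Suc n)) \<longlonglongrightarrow> - \<psi>' z" for z
  proof (cases z)
    case (Pair x t)
    have s0: "(\<lambda>n. - (1 / real (Suc n))) \<longlonglongrightarrow> 0"
      using tendsto_minus[OF LIMSEQ_inverse_real_of_nat] by (simp add: inverse_eq_divide)
    have "(\<lambda>n. (\<phi> (x, t + - (1 / real (Suc n))) - \<phi> (x, t)) / - (1 / real (Suc n))) \<longlonglongrightarrow> \<phi>t (x, t)"
      by (rule DERIV_quotient_sequence[OF partial_derivs(2)[OF d] s0]) simp
    from tendsto_mult_left[OF tendsto_minus[OF this], of "cell z"]
    have "(\<lambda>n. cell z * ((\<phi> (x, t - 1 / real (Suc n)) - \<phi> (x, t)) * real (Suc n))) \<longlonglongrightarrow> - (cell z * \<phi>t (x, t))"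
      by simp
    moreover have "cell (x, t - 1 / real (Suc n)) = cell z" for n by (simp add: Pair indicator_def)
    ultimately show ?thesis by (simp add: \<psi>_def \<psi>'_def Pair right_diff_distrib left_diff_distrib mult.assoc)
  qed
  note ibp = integral_directional_by_parts[OF fm m fem fb lipf convf supp b lip conv]
  have eq: "fe z * \<psi> z = cell z * (fe z * \<phi> z)" "f z * \<psi>' z = cell z * (f z * \<phi>t z)" for z
    by (simp_all add: \<psi>_def \<psi>'_def mult.left_commute)
  show "integrable lborel (\<lambda>z. cell z * (fe z * \<phi> z))" "integrable lborel (\<lambda>z. cell z * (f z * \<phi>t z))"
    "(\<integral>z. cell z * (fe z * \<phi> z) \<partial>lborel) = - (\<integral>z. cell z * (f z * \<phi>t z) \<partial>lborel)"
    using ibp unfolding eq by auto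
qed

section \<open>Truncation of the nonlinearities and of the forcing\<close>

definition truncate :: "real \<Rightarrow> real \<Rightarrow> real" where "truncate R p = max (- R) (min R p)"

lemma truncate_bounds: "0 \<le> R \<Longrightarrow> \<bar>truncate R p\<bar> \<le> R" "\<bar>p\<bar> \<le> R \<Longrightarrow> truncate R p = p"
  by (auto simp: truncate_def)

lemma truncate_mono: "q \<le> p \<Longrightarrow> truncate R q \<le> truncate R p" "q \<le> p \<Longrightarrow> truncate R p - truncate R q \<le> p - q"
  by (auto simp: truncate_def)

text \<open>sqrt (1 + x^2) is the Euclidean norm of (1, x), so this is the reverse triangle
  inequality.\<close>

lemma sqrt_one_plus_sq_lipschitz: "\<bar>sqrt (1 + x\<^sup>2) - sqrt (1 + y\<^sup>2)\<bar> \<le> \<bar>x - y\<bar>"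
  using norm_triangle_ineq3[of "(1::real, x)" "(1, y)"] by (simp add: norm_Pair)

text \<open>Beyond R the arctangent is continued with its slope 1 / (1 + R^2) at R, the smallest on
  [-R, R]. An increment splits into a truncated part, where the mean value theorem gives a slope 1 /
  (1 + z^2) with |z| \<le> R, and an excess e with slope exactly 1 / (1 + R^2).\<close>

lemma truncated_nonlinearity:
  assumes R: "0 \<le> R"
  shows "nonlinearity (\<lambda>p. arctan (truncate R p) + (p - truncate R p) / (1 + R\<^sup>2)) (\<lambda>p. sqrt (1 + (truncate R p)\<^sup>2))
    (1 / (1 + R\<^sup>2)) (sqrt (1 + R\<^sup>2))"
proof
  let ?a = "1 / (1 + R\<^sup>2)"
  have R2: "0 < 1 + R\<^sup>2" by (rule add_pos_nonneg) auto
  show a0: "0 < ?a" and a1: "?a \<le> 1" using R2 by auto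
  have c: "?a * (truncate R p - truncate R q) \<le> arctan (truncate R p) - arctan (truncate R q)
    \<and> arctan (truncate R p) - arctan (truncate R q) \<le> truncate R p - truncate R q" if "q \<le> p" for p q
  proof (cases "truncate R q = truncate R p")
    case False
    then have lt: "truncate R q < truncate R p" using truncate_mono(1)[OF that, of R] by simp
    obtain z where z: "truncate R q < z" "z < truncate R p"
      "arctan (truncate R p) - arctan (truncate R q) = (truncate R p - truncate R q) * inverse (1 + z\<^sup>2)"
      using MVT2[OF lt, of arctan "\<lambda>z. inverse (1 + z\<^sup>2)"] DERIV_arctan by auto
    have "\<bar>z\<bar> \<le> \<bar>R\<bar>" using z(1,2) truncate_bounds(1)[OF R, of p] truncate_bounds(1)[OF R, of q] by linarith
    then have "z\<^sup>2 \<le> R\<^sup>2" by (simp add: abs_le_square_iff)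
    then have "?a \<le> inverse (1 + z\<^sup>2)" "inverse (1 + z\<^sup>2) \<le> 1"
      unfolding inverse_eq_divide by (intro divide_left_mono mult_pos_pos R2 add_pos_nonneg; simp)+
        (simp add: add_pos_nonneg)
    then show ?thesis
      unfolding z(3) using lt mult_left_mono[of ?a "inverse (1 + z\<^sup>2)" "truncate R p - truncate R q"]
        mult_left_mono[of "inverse (1 + z\<^sup>2)" 1 "truncate R p - truncate R q"]
      by (simp add: mult.commute)
  qed simp
  fix p q :: real
  show "\<bar>sqrt (1 + (truncate R p)\<^sup>2)\<bar> \<le> sqrt (1 + R\<^sup>2)"
    using truncate_bounds(1)[OF R, of p] R by (simp add: abs_le_square_iff[symmetric])
  have "\<bar>truncate R p - truncate R q\<bar> \<le> \<bar>p - q\<bar>"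
    using truncate_mono[of p q R] truncate_mono[of q p R] by (cases "q \<le> p") auto
  then show "\<bar>sqrt (1 + (truncate R p)\<^sup>2) - sqrt (1 + (truncate R q)\<^sup>2)\<bar> \<le> \<bar>p - q\<bar>"
    using sqrt_one_plus_sq_lipschitz order_trans by blast
  assume qp: "q \<le> p"
  define e where "e = (p - truncate R p) - (q - truncate R q)"
  have e: "0 \<le> e" using truncate_mono(2)[OF qp, of R] by (simp add: e_def)
  have "?a * e \<le> 1 * e" by (rule mult_right_mono[OF a1 e])
  moreover have "?a * (p - q) = ?a * (truncate R p - truncate R q) + ?a * e"
    by (simp add: e_def algebra_simps add_divide_distrib diff_divide_distrib)
  moreover have "p - q = (truncate R p - truncate R q) + e" by (simp add: e_def)
  moreover have "arctan (truncate R p) + (p - truncate R p) / (1 + R\<^sup>2) - (arctan (truncate R q) + (q - truncate R q) / (1 + R\<^sup>2))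
    = (arctan (truncate R p) - arctan (truncate R q)) + ?a * e"
    by (simp add: e_def diff_divide_distrib)
  ultimately show "?a * (p - q) \<le> arctan (truncate R p) + (p - truncate R p) / (1 + R\<^sup>2) - (arctan (truncate R q) + (q - truncate R q) / (1 + R\<^sup>2))"
    "arctan (truncate R p) + (p - truncate R p) / (1 + R\<^sup>2) - (arctan (truncate R q) + (q - truncate R q) / (1 + R\<^sup>2)) \<le> p - q"
    using c[OF qp] by linarith+
qed

text \<open>The infimum in \<open>linf_norm\<close> is itself an almost-everywhere bound, because
  the countably many bounds M + 1 / (k + 1) hold simultaneously. Completion gives a Borel version,
  \<open>frac\<close> repeats it periodically, and clipping makes the bound hold everywhere; the
  clipping level has to be nonnegative, hence max M 0.\<close>

lemma periodic_bounded_representative: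
  fixes g :: "real \<Rightarrow> real"
  assumes L: "Linf_on {0..1} g" and n: "linf_norm {0..1} g = M"
  obtains g' where "g' \<in> borel_measurable borel" "\<And>x. \<bar>g' x\<bar> \<le> max M 0" "\<And>x. g' (x + 1) = g' x"
    "AE x in lborel. x \<in> {0..<1} \<longrightarrow> g x = g' x"
proof -
  let ?S = "{C. AE z in lebesgue. z \<in> {0..1} \<longrightarrow> \<bar>g z\<bar> \<le> C}"
  have ne: "?S \<noteq> {}" using L by (auto simp: Linf_on_def)
  have "AE z in lebesgue. z \<in> {0..1} \<longrightarrow> \<bar>g z\<bar> \<le> M + 1 / real (Suc k)" for k
  proof -
    have "Inf ?S < M + 1 / real (Suc k)" using n by (simp add: linf_norm_def)
    from cInf_lessD[OF ne this] obtain C where "AE z in lebesgue. z \<in> {0..1} \<longrightarrow> \<bar>g z\<bar> \<le> C" "C < M + 1 / real (Suc k)" by auto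
    then show ?thesis by (auto elim!: eventually_mono)
  qed
  then have "AE z in lebesgue. \<forall>k. z \<in> {0..1} \<longrightarrow> \<bar>g z\<bar> \<le> M + 1 / real (Suc k)"
    unfolding AE_all_countable by blast
  then have gM: "AE z in lebesgue. z \<in> {0..1} \<longrightarrow> \<bar>g z\<bar> \<le> M"
  proof eventually_elim
    case (elim z)
    show ?case
    proof
      assume z: "z \<in> {0..1}"
      have "(\<lambda>k. M + 1 / real (Suc k)) \<longlonglongrightarrow> M + 0"
        using LIMSEQ_inverse_real_of_nat by (intro tendsto_intros) (simp add: inverse_eq_divide)
      then show "\<bar>g z\<bar> \<le> M" using elim z by (intro LIMSEQ_le_const[where X="\<lambda>k. M + 1 / real (Suc k)" and x=M]) auto
    qed
  qed
  have "(\<lambda>x. indicator {0..1} x * g x) \<in> borel_measurable lebesgue"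
    using L by (simp add: Linf_on_def set_borel_measurable_def)
  from completion_ex_borel_measurable_real[OF this]
  obtain g0 where g0: "g0 \<in> borel_measurable lborel" "AE x in lborel. indicator {0..1} x * g x = g0 x" by auto
  define g' where "g' x = truncate (max M 0) (g0 (frac x))" for x
  have "g' \<in> borel_measurable borel"
    using g0(1) unfolding g'_def[abs_def] truncate_def frac_def by measurable
  moreover have "\<bar>g' x\<bar> \<le> max M 0" for x unfolding g'_def by (rule truncate_bounds) simp
  moreover have "g' (x + 1) = g' x" for x by (simp add: g'_def frac_1_eq)
  moreover have "AE x in lborel. x \<in> {0..<1} \<longrightarrow> g x = g' x"
    using g0(2) gM[unfolded AE_completion_iff]
  proof eventually_elim
    case (elim x)
    show ?case
    proof
      assume x: "x \<in> {0..<1}"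
      then have "frac x = x" by (simp add: frac_eq)
      then show "g x = g' x" using elim x by (simp add: g'_def truncate_bounds(2))
    qed
  qed
  ultimately show ?thesis using that by blast
qed

section \<open>Attainment of the datum and regularity of the limit\<close>

lemma lipschitz_borel:
  fixes f :: "real \<Rightarrow> real"
  assumes "\<And>x y. \<bar>f x - f y\<bar> \<le> K * \<bar>x - y\<bar>"
  shows "f \<in> borel_measurable borel"
proof -
  have "K-lipschitz_on UNIV f"
    using assms assms[of 0 1] by (auto simp: lipschitz_on_def dist_real_def)
  then show ?thesis by (intro borel_measurable_continuous_onI lipschitz_on_continuous_on)
qed

text \<open>The Lipschitz bound in t is uniform in x, so the squared distance is at most (C * t)^2.
  u0 may differ from the trace of u at time 0 on a null set, which the integrals ignore.\<close>

lemma initial_value_lipschitz: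
  fixes u :: "real \<Rightarrow> real \<Rightarrow> real"
  assumes lip: "\<And>x t y s. \<bar>u x t - u y s\<bar> \<le> K * \<bar>x - y\<bar> + C * \<bar>t - s\<bar>"
    and init: "AE x in lborel. u0 x = u x 0"
  shows "initial_value u u0"
proof -
  define D where "D t x = (u x t - u x 0)\<^sup>2" for t x
  have m: "(\<lambda>x. u x t) \<in> borel_measurable borel" for t
    by (rule lipschitz_borel[of _ K]) (use lip[of _ t _ t] in auto)
  have Dm: "D t \<in> borel_measurable borel" for t unfolding D_def[abs_def] using m by measurable
  have Db: "\<bar>D t x\<bar> \<le> (C * t)\<^sup>2" for t x
  proof -
    have "\<bar>u x t - u x 0\<bar> \<le> \<bar>C * t\<bar>"
      using lip[of x t x 0] abs_ge_self[of "C * \<bar>t\<bar>"] by (simp add: abs_mult)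
    then show ?thesis by (simp add: D_def abs_le_square_iff)
  qed
  have int: "integrable lborel (\<lambda>x. indicator {0..1} x * D t x)" for t
    by (rule integrable_bounded_set[OF Dm]) (use Db in auto)
  have ae: "AE x in lborel. indicator {0..1} x *\<^sub>R (u x t - u0 x)\<^sup>2 = indicator {0..1} x * D t x" for t
    using init by eventually_elim (simp add: D_def)
  note tr = lebesgue_AE_transfer[OF int ae]
  have "\<bar>LINT x:{0..1}|lebesgue. (u x t - u0 x)\<^sup>2\<bar> \<le> (C * t)\<^sup>2" for t
  proof -
    have "(LINT x:{0..1}|lebesgue. (u x t - u0 x)\<^sup>2) = (\<integral>x. indicator {0..1} x * D t x \<partial>lborel)"
      unfolding set_lebesgue_integral_def by (rule tr(2))
    moreover have "(\<integral>x. indicator {0..1} x * D t x \<partial>lborel) \<le> (\<integral>x. indicator {0..1::real} x * (C * t)\<^sup>2 \<partial>lborel)"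
    proof (rule integral_mono[OF int])
      show "integrable lborel (\<lambda>x. indicator {0..1::real} x * (C * t)\<^sup>2)" by (rule integrable_bounded_set) auto
      show "indicator {0..1} x * D t x \<le> indicator {0..1} x * (C * t)\<^sup>2" for x
        using Db[of t x] by (auto simp: indicator_def)
    qed
    moreover have "0 \<le> (\<integral>x. indicator {0..1} x * D t x \<partial>lborel)"
      by (rule integral_nonneg_AE) (auto simp: D_def)
    ultimately show ?thesis by simp
  qed
  then have "\<forall>\<^sub>F t in at_right 0. norm (LINT x:{0..1}|lebesgue. (u x t - u0 x)\<^sup>2) \<le> (C * t)\<^sup>2" by simp
  moreover have "((\<lambda>t. (C * t)\<^sup>2) \<longlongrightarrow> 0) (at_right 0)" by (auto intro!: tendsto_eq_intros)
  ultimately have "((\<lambda>t. LINT x:{0..1}|lebesgue. (u x t - u0 x)\<^sup>2) \<longlongrightarrow> 0) (at_right 0)"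
    by (rule Lim_null_comparison)
  then show ?thesis unfolding initial_value_def set_integrable_def using tr(1) by simp
qed

text \<open>u_t and u_xx arise as almost-everywhere limits of difference quotients, bounded by the
  Lipschitz constants, while u_x is p itself by the Taylor estimate. In the weak form the time
  derivative is moved from \<phi> to u. \<open>AG\<close> expresses that on [0, T] the slopes stay
  where the modified nonlinearities agree with the original ones.\<close>

lemma regular_weak_solution:
  fixes u p :: "real \<Rightarrow> real \<Rightarrow> real" and A G g g' :: "real \<Rightarrow> real"
  assumes pm: "(\<lambda>z. p (fst z) (snd z)) \<in> borel_measurable borel"
    and lip: "\<And>x t y s. \<bar>u x t - u y s\<bar> \<le> K * \<bar>x - y\<bar> + C * \<bar>t - s\<bar>"
    and per: "\<And>x t. u (x + 1) t = u x t"
    and pb: "\<And>x t. \<bar>p x t\<bar> \<le> K" and plip: "\<And>x y t. \<bar>p x t - p y t\<bar> \<le> K * \<bar>x - y\<bar>"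
    and taylor: "\<And>x y t. x \<le> y \<Longrightarrow> \<bar>u y t - u x t - (y - x) * p x t\<bar> \<le> K * (y - x)\<^sup>2"
    and weak: "\<And>\<phi> \<phi>x \<phi>t. per_test T \<phi> \<phi>x \<phi>t \<Longrightarrow> integrable lborel (\<lambda>z. cell z * (- (u (fst z) (snd z) * \<phi>t z)
      + A (p (fst z) (snd z)) * \<phi>x z - g' (fst z) * G (p (fst z) (snd z)) * \<phi> z))"
      "\<And>\<phi> \<phi>x \<phi>t. per_test T \<phi> \<phi>x \<phi>t \<Longrightarrow> (\<integral>z. cell z * (- (u (fst z) (snd z) * \<phi>t z)
      + A (p (fst z) (snd z)) * \<phi>x z - g' (fst z) * G (p (fst z) (snd z)) * \<phi> z) \<partial>lborel) = 0"
    and AG: "\<And>x t. 0 \<le> t \<Longrightarrow> t \<le> T \<Longrightarrow> A (p x t) = arctan (p x t) \<and> G (p x t) = sqrt (1 + (p x t)\<^sup>2)"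
    and gg: "AE x in lborel. x \<in> {0..<1} \<longrightarrow> g x = g' x"
  shows "weak_solution g T u \<and> W1inf_W2inf T u"
proof -
  define f where "f z = u (fst z) (snd z)" for z
  define ux where "ux z = p (fst z) (snd z)" for z
  have K0: "0 \<le> K" using pb[of 0 0] by linarith
  have C0: "0 \<le> C" using lip[of 0 0 0 1] by simp
  have f_eq: "(\<lambda>(x, t). u x t) = f" by (auto simp: f_def)
  have "(K + C)-lipschitz_on UNIV f"
    unfolding lipschitz_on_def
  proof (intro conjI ballI)
    fix z z' :: "real \<times> real"
    have "\<bar>fst z - fst z'\<bar> \<le> dist z z'" "\<bar>snd z - snd z'\<bar> \<le> dist z z'"
      using dist_fst_le[of z z'] dist_snd_le[of z z'] by (simp_all add: dist_real_def)
    then have "K * \<bar>fst z - fst z'\<bar> + C * \<bar>snd z - snd z'\<bar> \<le> K * dist z z' + C * dist z z'"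
      using K0 C0 by (intro add_mono mult_left_mono)
    then show "dist (f z) (f z') \<le> (K + C) * dist z z'"
      using lip[of "fst z" "snd z" "fst z'" "snd z'"] by (simp add: f_def dist_real_def algebra_simps)
  qed (use K0 C0 in simp)
  then have fc: "continuous_on UNIV f" by (rule lipschitz_on_continuous_on)
  have fm: "f \<in> borel_measurable borel" using fc by (rule borel_measurable_continuous_onI)
  have uxm: "ux \<in> borel_measurable borel" using pm by (simp add: ux_def[abs_def])
  have bounded_cont: "\<exists>B. \<forall>z\<in>S. \<bar>f z\<bar> \<le> B" if "compact S" for S
    using compact_imp_bounded[OF compact_continuous_image[OF continuous_on_subset[OF fc] that]]
    by (auto simp: bounded_iff)
  have fb: "\<exists>B. \<forall>z. norm z \<le> r \<longrightarrow> \<bar>f z\<bar> \<le> B" for r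
    using bounded_cont[OF compact_cball, of 0 r] by (simp only: Ball_def mem_cball_0)
  have uxb: "\<exists>B. \<forall>z. norm z \<le> r \<longrightarrow> \<bar>ux z\<bar> \<le> B" for r using pb by (auto simp: ux_def)
  have lip_t: "\<bar>f (z + s *\<^sub>R (0, 1)) - f z\<bar> \<le> C * s" if "0 \<le> s" for z s
    using lip[of "fst z" "snd z + s" "fst z" "snd z"] that by (simp add: f_def)
  have lip_x: "\<bar>f (z + s *\<^sub>R (1, 0)) - f z\<bar> \<le> K * s" if "0 \<le> s" for z s
    using lip[of "fst z + s" "snd z" "fst z" "snd z"] that by (simp add: f_def)
  have lip_ux: "\<bar>ux (z + s *\<^sub>R (1, 0)) - ux z\<bar> \<le> K * s" if "0 \<le> s" for z s
    using plip[of "fst z + s" "snd z" "fst z"] that by (simp add: ux_def)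
  obtain ut where ut: "ut \<in> borel_measurable borel" "\<And>z. \<bar>ut z\<bar> \<le> C"
    "AE z in lborel. (\<lambda>n. (f (z + (1 / real (Suc n)) *\<^sub>R (0, 1)) - f z) * real (Suc n)) \<longlonglongrightarrow> ut z"
    by (rule lipschitz_direction_derivative[OF fm _ lip_t]) auto
  obtain uxx where uxx: "uxx \<in> borel_measurable borel" "\<And>z. \<bar>uxx z\<bar> \<le> K"
    "AE z in lborel. (\<lambda>n. (ux (z + (1 / real (Suc n)) *\<^sub>R (1, 0)) - ux z) * real (Suc n)) \<longlonglongrightarrow> uxx z"
    by (rule lipschitz_direction_derivative[OF uxm _ lip_ux]) auto
  have conv_x: "AE z in lborel. (\<lambda>n. (f (z + (1 / real (Suc n)) *\<^sub>R (1, 0)) - f z) * real (Suc n)) \<longlonglongrightarrow> ux z"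
  proof (intro AE_I2)
    fix z :: "real \<times> real"
    obtain x t where z: "z = (x, t)" by (cases z)
    have "(\<lambda>n. (f (z + (1 / real (Suc n)) *\<^sub>R (1, 0)) - f z) * real (Suc n) - ux z) \<longlonglongrightarrow> 0"
    proof (rule Lim_null_comparison[of _ "\<lambda>n. K * inverse (real (Suc n))"], intro always_eventually allI)
      show "(\<lambda>n. K * inverse (real (Suc n))) \<longlonglongrightarrow> 0"
        using tendsto_mult_left[OF LIMSEQ_inverse_real_of_nat, of K] by simp
      fix n
      define s where "s = 1 / real (Suc n)"
      have s: "s > 0" "1 / s = real (Suc n)" "s = inverse (real (Suc n))" by (auto simp: s_def inverse_eq_divide)
      have "\<bar>u (x + s) t - u x t - s * p x t\<bar> \<le> K * s\<^sup>2" using taylor[of x "x + s" t] s by simp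
      then have "\<bar>u (x + s) t - u x t - s * p x t\<bar> / s \<le> K * s\<^sup>2 / s" using s(1) by (intro divide_right_mono) auto
      moreover have "(u (x + s) t - u x t) * (1 / s) - p x t = (u (x + s) t - u x t - s * p x t) / s"
        using s(1) by (simp add: diff_divide_distrib)
      ultimately have "\<bar>(u (x + s) t - u x t) * (1 / s) - p x t\<bar> \<le> K * s"
        using s(1) by (simp add: abs_divide power2_eq_square)
      then show "norm ((f (z + (1 / real (Suc n)) *\<^sub>R (1, 0)) - f z) * real (Suc n) - ux z) \<le> K * inverse (real (Suc n))"
        unfolding s(2) s(3)[symmetric] s_def[symmetric] by (simp add: f_def ux_def z)
    qed
    then show "(\<lambda>n. (f (z + (1 / real (Suc n)) *\<^sub>R (1, 0)) - f z) * real (Suc n)) \<longlonglongrightarrow> ux z" by (rule LIM_zero_cancel)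
  qed
  have utb: "\<exists>B. \<forall>z. norm z \<le> r \<longrightarrow> \<bar>ut z\<bar> \<le> B" and uxxb: "\<exists>B. \<forall>z. norm z \<le> r \<longrightarrow> \<bar>uxx z\<bar> \<le> B" for r
    using ut(2) uxx(2) by blast+
  have wt: "weak_dt (strip T) f ut"
    unfolding weak_dt_def
    by (intro conjI allI impI loc_int_on_bounded fm fb ut(1) utb)
      (rule test2_by_parts[OF fm ut(1) fb lip_t ut(3)], auto)
  have wx: "weak_dx (strip T) f ux"
    unfolding weak_dx_def
    by (intro conjI allI impI loc_int_on_bounded fm fb uxm uxb)
      (rule test2_by_parts[OF fm uxm fb lip_x conv_x], auto)
  have wxx: "weak_dx (strip T) ux uxx"
    unfolding weak_dx_def
    by (intro conjI allI impI loc_int_on_bounded uxm uxb uxx(1) uxxb)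
      (rule test2_by_parts[OF uxm uxx(1) uxb lip_ux uxx(3)], auto)
  have cyl_c: "compact (cyl T)" unfolding cyl_def by (intro compact_Times) auto
  have cyl: "cyl T \<in> sets borel" "bounded (cyl T)"
    using cyl_c by (auto intro: borel_compact compact_imp_bounded)
  obtain Bf where Bf: "\<And>z. z \<in> cyl T \<Longrightarrow> \<bar>f z\<bar> \<le> Bf" using bounded_cont[OF cyl_c] by blast
  have uxK: "\<bar>ux z\<bar> \<le> K" for z using pb by (simp add: ux_def)
  have "W1inf_W2inf T u"
    unfolding W1inf_W2inf_def f_eq
    using wt wx wxx Linf_on_bounded[OF fm cyl(1) Bf] Linf_on_bounded[OF ut(1) cyl(1) ut(2)]
      Linf_on_bounded[OF uxm cyl(1) uxK] Linf_on_bounded[OF uxx(1) cyl(1) uxx(2)] by blast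
  moreover have "weak_solution g T u"
    unfolding weak_solution_def f_eq
  proof (rule conjI, intro allI per, rule exI[of _ ut], rule exI[of _ ux], intro conjI allI impI)
    show "weak_dt (strip T) f ut" "weak_dx (strip T) f ux" by fact+
    show "L2_on (cyl T) f" "L2_on (cyl T) ut" "L2_on (cyl T) ux"
      using L2_on_bounded[OF fm cyl Bf] L2_on_bounded[OF ut(1) cyl ut(2)] L2_on_bounded[OF uxm cyl uxK] by auto
    show "\<exists>C. AE t in lebesgue. t \<in> {0..T} \<longrightarrow> set_integrable lebesgue {0..1} (\<lambda>x. (u x t)\<^sup>2 + (ux (x, t))\<^sup>2) \<and>
        (LINT x:{0..1}|lebesgue. (u x t)\<^sup>2 + (ux (x, t))\<^sup>2) \<le> C"
    proof (rule exI[of _ "Bf\<^sup>2 + K\<^sup>2"], intro AE_I2 impI)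
      fix t assume t: "t \<in> {0..T}"
      define D where "D x = (u x t)\<^sup>2 + (ux (x, t))\<^sup>2" for x
      have [measurable]: "(\<lambda>x. u x t) \<in> borel_measurable borel" "(\<lambda>x. p x t) \<in> borel_measurable borel"
        using lipschitz_borel[of "\<lambda>x. u x t" K] lipschitz_borel[of "\<lambda>x. p x t" K] lip[of _ t _ t] plip by auto
      have Dm: "D \<in> borel_measurable borel" unfolding D_def[abs_def] ux_def by simp
      have Db: "0 \<le> D x" "x \<in> {0..1} \<Longrightarrow> D x \<le> Bf\<^sup>2 + K\<^sup>2" for x
      proof -
        show "0 \<le> D x" by (simp add: D_def)
        assume "x \<in> {0..1}"
        then have "\<bar>u x t\<bar> \<le> \<bar>Bf\<bar>" using Bf[of "(x, t)"] t by (intro order_trans[OF _ abs_ge_self]) (simp add: cyl_def f_def)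
        moreover have "\<bar>ux (x, t)\<bar> \<le> \<bar>K\<bar>" using uxK[of "(x, t)"] by (intro order_trans[OF _ abs_ge_self])
        ultimately show "D x \<le> Bf\<^sup>2 + K\<^sup>2" unfolding D_def abs_le_square_iff by (rule add_mono)
      qed
      have int: "integrable lborel (\<lambda>x. indicator {0..1} x * D x)"
        by (rule integrable_bounded_set[OF Dm, where B="Bf\<^sup>2 + K\<^sup>2"]) (use Db in auto)
      have eq: "AE x in lborel. indicator {0..1} x *\<^sub>R ((u x t)\<^sup>2 + (ux (x, t))\<^sup>2) = indicator {0..1} x * D x" by (simp add: D_def)
      note tr = lebesgue_AE_transfer[OF int eq]
      have "(\<integral>x. indicator {0..1} x * D x \<partial>lborel) \<le> (\<integral>x. indicator {0..1::real} x * (Bf\<^sup>2 + K\<^sup>2) \<partial>lborel)"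
      proof (rule integral_mono[OF int])
        show "integrable lborel (\<lambda>x. indicator {0..1::real} x * (Bf\<^sup>2 + K\<^sup>2))" by (rule integrable_bounded_set) auto
        show "indicator {0..1} x * D x \<le> indicator {0..1} x * (Bf\<^sup>2 + K\<^sup>2)" for x
          using Db[of x] by (auto simp: indicator_def)
      qed
      then show "set_integrable lebesgue {0..1} (\<lambda>x. (u x t)\<^sup>2 + (ux (x, t))\<^sup>2) \<and>
        (LINT x:{0..1}|lebesgue. (u x t)\<^sup>2 + (ux (x, t))\<^sup>2) \<le> Bf\<^sup>2 + K\<^sup>2"
        unfolding set_integrable_def set_lebesgue_integral_def using tr by simp
    qed
    fix \<phi> \<phi>x \<phi>t :: "real \<times> real \<Rightarrow> real"
    assume test: "per_test T \<phi> \<phi>x \<phi>t"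
    \<comment> \<open>Pointwise the terms with \<phi>t cancel and leave the integrand with u_t. In
      the integral the first and last terms cancel by parts, and the middle one is 0 by the limit
      identity.\<close>
    let ?F = "\<lambda>z. cell z * (ut z * \<phi> z) + (cell z * (- (f z * \<phi>t z) + A (ux z) * \<phi>x z - g' (fst z) * G (ux z) * \<phi> z)
        + cell z * (f z * \<phi>t z))"
    let ?H = "\<lambda>z. ut z * \<phi> z + arctan (ux z) * \<phi>x z - g (fst z) * sqrt (1 + (ux z)\<^sup>2) * \<phi> z"
    note ibp = per_test_by_parts[OF fm ut(1) fb lip_t ut(3) test]
    note wk = weak(1)[OF test, folded f_def ux_def] weak(2)[OF test, folded f_def ux_def]
    have Fi: "integrable lborel ?F"
      by (intro Bochner_Integration.integrable_add ibp(1,2) wk(1))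
    have F0: "(\<integral>z. ?F z \<partial>lborel) = 0"
      using Bochner_Integration.integral_add[OF ibp(1) Bochner_Integration.integrable_add[OF wk(1) ibp(2)]]
        Bochner_Integration.integral_add[OF wk(1) ibp(2)] ibp(3) wk(2) by simp
    have z0: "\<phi> (x, t) = 0 \<and> \<phi>x (x, t) = 0" if "t \<notin> {0..T}" for x t
    proof -
      have "t \<notin> {0<..<T}" using that by auto
      then show ?thesis using per_test_bounds[OF test] by metis
    qed
    \<comment> \<open>\<open>cyl T\<close> contains the edge x = 1 and \<open>cell\<close> does not;
      the edge is a null set and is excluded here.\<close>
    have "AE x in lborel. x \<noteq> 1 \<and> (x \<in> {0..<1} \<longrightarrow> g x = g' x)"
      using gg AE_lborel_singleton[of 1] by eventually_elim auto
    from AE_lborel_fst[OF this] have ae: "AE z in lborel. indicator (cyl T) z *\<^sub>R ?H z = ?F z"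
    proof eventually_elim
      case (elim z)
      obtain x t where z: "z = (x, t)" by (cases z)
      have x: "x \<noteq> 1" "x \<in> {0..<1} \<longrightarrow> g x = g' x" using elim by (auto simp: z)
      show ?case
      proof (cases "x \<in> {0..<1}")
        case x1: True
        show ?thesis
        proof (cases "t \<in> {0..T}")
          case True
          then have "(x, t) \<in> cyl T" using x1 by (simp add: cyl_def)
          then show ?thesis
            using AG[of t x] True x(2) x1 by (simp add: z ux_def)
        next
          case False
          then have "(x, t) \<notin> cyl T" by (simp add: cyl_def)
          then show ?thesis using z0[OF False, of x] by (simp add: z)
        qed
      next
        case False
        then have "(x, t) \<notin> cyl T" using x(1) by (auto simp: cyl_def)
        moreover have "cell (x, t) = 0" using False by simp
        ultimately show ?thesis by (simp add: z)
      qed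
    qed
    note tr = lebesgue_AE_transfer[OF Fi ae]
    show "set_integrable lebesgue (cyl T) ?H" unfolding set_integrable_def by (rule tr(1))
    show "(LINT z:cyl T|lebesgue. ?H z) = 0" unfolding set_lebesgue_integral_def tr(2) by (rule F0)
  qed
  ultimately show ?thesis by blast
qed

text \<open>An interpolation inequality of Landau type: expansions of u and w at the same point,
  with quadratic errors, turn uniform closeness c into closeness of slopes. The width \<delta>
  balances the two terms.\<close>

lemma slope_interpolation:
  fixes u w :: "real \<Rightarrow> real"
  assumes "\<bar>u (x + \<delta>) - u x - \<delta> * p\<bar> \<le> K * \<delta>\<^sup>2" "\<bar>w (x + \<delta>) - w x - \<delta> * q\<bar> \<le> L * \<delta>\<^sup>2"
    and close: "\<And>y. \<bar>u y - w y\<bar> \<le> c" and "0 < \<delta>"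
  shows "\<bar>p - q\<bar> \<le> 2 * c / \<delta> + (K + L) * \<delta>"
proof -
  have "\<bar>\<delta> * (p - q)\<bar> \<le> 2 * c + (K * \<delta>\<^sup>2 + L * \<delta>\<^sup>2)"
    using assms(1,2) close[of x] close[of "x + \<delta>"] unfolding right_diff_distrib by linarith
  then have "\<bar>\<delta> * (p - q)\<bar> / \<delta> \<le> (2 * c + (K * \<delta>\<^sup>2 + L * \<delta>\<^sup>2)) / \<delta>"
    using \<open>0 < \<delta>\<close> by (intro divide_right_mono) auto
  moreover have "\<bar>\<delta> * (p - q)\<bar> / \<delta> = \<bar>p - q\<bar>" using \<open>0 < \<delta>\<close> by (simp only: abs_mult) simp
  moreover have "(2 * c + (K * \<delta>\<^sup>2 + L * \<delta>\<^sup>2)) / \<delta> = 2 * c / \<delta> + (K + L) * \<delta>"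
    using \<open>0 < \<delta>\<close> by (simp add: add_divide_distrib power2_eq_square algebra_simps)
  ultimately show ?thesis by simp
qed

theorem theorem3:
  fixes u0 :: "real \<Rightarrow> real" and M :: real
  assumes "\<forall>x. u0 (x + 1) = u0 x"
    and "W2inf UNIV u0"
  shows "\<exists>T>0. \<forall>g :: real \<Rightarrow> real.
           (\<forall>x. g (x + 1) = g x) \<and> Linf_on {0..1} g \<and> linf_norm {0..1} g = M \<longrightarrow>
           (\<exists>u. weak_solution g T u \<and> initial_value u u0 \<and> W1inf_W2inf T u)"
proof -
  obtain w w' K0 where w: "AE x in lborel. u0 x = w x" "\<And>x. w (x + 1) = w x"
    "\<And>x. (w has_real_derivative w' x) (at x)" "\<And>x y. \<bar>w' x - w' y\<bar> \<le> K0 * \<bar>x - y\<bar>" "0 \<le> K0"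
    "\<And>x. \<bar>w' x\<bar> \<le> K0"
    using W2inf_periodic_representative[OF assms] by blast
  \<comment> \<open>One unit of room above the bound \<open>K0\<close> of w': slopes within 1 of w'
    stay where the truncation is the identity.\<close>
  define R where "R = K0 + 1"
  define A where "A p = arctan (truncate R p) + (p - truncate R p) / (1 + R\<^sup>2)" for p
  define G where "G p = sqrt (1 + (truncate R p)\<^sup>2)" for p
  define a where "a = 1 / (1 + R\<^sup>2)"
  define B where "B = sqrt (1 + R\<^sup>2)"
  define M' where "M' = max M 0"
  \<comment> \<open>These will be \<open>CC\<close> and \<open>KK\<close>, written out before any g
    is fixed. They involve g only through M, so T is common to all admissible g.\<close>
  define C where "C = 2 * K0 + M' * B"
  define K where "K = (C + M' * B) / a"
  \<comment> \<open>\<delta> makes the second-order term (K + K0) * \<delta> of the interpolation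
    inequality at most 1/2; T is then chosen so that the closeness term 2 * (C * T) / \<delta> is at
    most 1/2.\<close>
  define \<delta> where "\<delta> = 1 / (2 * (K + K0 + 1))"
  define T where "T = \<delta> / (4 * (C + 1))"
  have R0: "0 \<le> R" using w(5) by (simp add: R_def)
  interpret nonlinearity A G a B
    unfolding A_def[abs_def] G_def[abs_def] a_def B_def by (rule truncated_nonlinearity[OF R0])
  have M0: "0 \<le> M'" by (simp add: M'_def)
  have C0: "0 \<le> C" using w(5) M0 B_nonneg by (simp add: C_def)
  have K: "0 \<le> K" using C0 M0 B_nonneg a_pos by (simp add: K_def)
  have d0: "0 < \<delta>" using K w(5) by (simp add: \<delta>_def)
  have T0: "0 < T" using d0 C0 by (simp add: T_def)
  have small: "2 * (C * T) / \<delta> + (K + K0) * \<delta> \<le> 1"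
  proof -
    have "4 * (C + 1) * T = \<delta>" using C0 by (simp add: T_def)
    then have "2 * (C * T) \<le> 1 / 2 * \<delta>" using T0 by (simp add: algebra_simps)
    then have "2 * (C * T) / \<delta> \<le> 1 / 2" using d0 by (simp only: pos_divide_le_eq)
    moreover have "(K + K0) * \<delta> \<le> 1 / 2" using K w(5) by (simp add: \<delta>_def field_simps)
    ultimately show ?thesis by simp
  qed
  show ?thesis
  proof (intro exI[of _ T] conjI T0 allI impI)
    fix g :: "real \<Rightarrow> real"
    assume "(\<forall>x. g (x + 1) = g x) \<and> Linf_on {0..1} g \<and> linf_norm {0..1} g = M"
    then obtain g' where g': "g' \<in> borel_measurable borel" "\<And>x. \<bar>g' x\<bar> \<le> M'" "\<And>x. g' (x + 1) = g' x"
      "AE x in lborel. x \<in> {0..<1} \<longrightarrow> g x = g' x"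
      using periodic_bounded_representative[of g M] unfolding M'_def by blast
    interpret scheme_limit A G a B w w' g' M' K0
      by unfold_locales (use w g' in auto)
    have CK: "CC = C" "KK = K" by (simp_all add: CC_def C_def KK_def K_def)
    show "\<exists>u. weak_solution g T u \<and> initial_value u u0 \<and> W1inf_W2inf T u"
    proof (rule exists_solution[unfolded CK])
      fix u p
      assume pm: "(\<lambda>z. p (fst z) (snd z)) \<in> borel_measurable borel"
      and lip: "\<And>x t y s. \<bar>u x t - u y s\<bar> \<le> K * \<bar>x - y\<bar> + C * \<bar>t - s\<bar>"
      and per: "\<And>x t. u (x + 1) t = u x t" and init: "\<And>x t. t \<le> 0 \<Longrightarrow> u x t = w x"
      and pb: "\<And>x t. \<bar>p x t\<bar> \<le> K" and plip: "\<And>x y t. \<bar>p x t - p y t\<bar> \<le> K * \<bar>x - y\<bar>"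
      and taylor: "\<And>x y t. x \<le> y \<Longrightarrow> \<bar>u y t - u x t - (y - x) * p x t\<bar> \<le> K * (y - x)\<^sup>2"
      and weak: "\<And>T \<phi> \<phi>x \<phi>t. per_test T \<phi> \<phi>x \<phi>t \<Longrightarrow> integrable lborel (\<lambda>z. cell z * (- (u (fst z) (snd z) * \<phi>t z)
        + A (p (fst z) (snd z)) * \<phi>x z - g' (fst z) * G (p (fst z) (snd z)) * \<phi> z))"
        "\<And>T \<phi> \<phi>x \<phi>t. per_test T \<phi> \<phi>x \<phi>t \<Longrightarrow> (\<integral>z. cell z * (- (u (fst z) (snd z) * \<phi>t z)
        + A (p (fst z) (snd z)) * \<phi>x z - g' (fst z) * G (p (fst z) (snd z)) * \<phi> z) \<partial>lborel) = 0"
      have AG: "A (p x t) = arctan (p x t) \<and> G (p x t) = sqrt (1 + (p x t)\<^sup>2)" if t: "0 \<le> t" "t \<le> T" for x t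
      proof -
        have "\<bar>p x t - w' x\<bar> \<le> 2 * (C * T) / \<delta> + (K + K0) * \<delta>"
        proof (rule slope_interpolation[where u="\<lambda>x. u x t" and w=w and x=x])
          show "\<bar>u (x + \<delta>) t - u x t - \<delta> * p x t\<bar> \<le> K * \<delta>\<^sup>2" using taylor[of x "x + \<delta>" t] d0 by simp
          \<comment> \<open>The datum obeys a Taylor estimate with constant \<open>K0\<close>
            because w' is Lipschitz with that constant.\<close>
          obtain z where z: "x < z" "z < x + \<delta>" "w (x + \<delta>) - w x = (x + \<delta> - x) * w' z"
            using MVT2[of x "x + \<delta>" w w'] d0 w(3) by auto
          have "\<bar>w (x + \<delta>) - w x - \<delta> * w' x\<bar> = \<delta> * \<bar>w' z - w' x\<bar>"
            using z(3) d0 by (simp add: abs_mult right_diff_distrib[symmetric])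
          also have "\<dots> \<le> \<delta> * (K0 * \<bar>z - x\<bar>)" using d0 w(4) by (intro mult_left_mono) auto
          also have "\<dots> \<le> \<delta> * (K0 * \<delta>)" using d0 w(5) z by (intro mult_left_mono) auto
          finally show "\<bar>w (x + \<delta>) - w x - \<delta> * w' x\<bar> \<le> K0 * \<delta>\<^sup>2" by (simp add: power2_eq_square mult.left_commute)
          fix y
          have "\<bar>u y t - w y\<bar> \<le> C * t" using lip[of y t y 0] init[of 0 y] t by simp
          also have "\<dots> \<le> C * T" using t C0 by (intro mult_left_mono)
          finally show "\<bar>u y t - w y\<bar> \<le> C * T" .
        qed (rule d0)
        then have "\<bar>p x t\<bar> \<le> R" using small w(6)[of x] unfolding R_def by linarith
        then show ?thesis by (simp add: A_def G_def truncate_bounds(2))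
      qed
      have "weak_solution g T u \<and> W1inf_W2inf T u"
        by (rule regular_weak_solution[OF pm lip per pb plip taylor weak AG g'(4)])
      moreover have "initial_value u u0"
        by (rule initial_value_lipschitz[OF lip]) (use w(1) init[of 0] in auto)
      ultimately show "\<exists>u. weak_solution g T u \<and> initial_value u u0 \<and> W1inf_W2inf T u" by blast
    qed
  qed
qed

end
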